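(* Let $\alpha\in(0,1)$ and let $B=\mathrm{diag}(B^s,B^u)\in\mathbb{C}^{d\times d}$ be a matrix in Jordan normal form, where $B^s\in\mathbb{C}^{d_s\times d_s}$ consists of the Jordan blocks whose eigenvalues lie in $\Lambda_\alpha^s$ and $B^u\in\mathbb{C}^{d_u\times d_u}$ of those whose eigenvalues lie in $\Lambda_\alpha^u$, with $\sigma(B)\subset\Lambda_\alpha^u\cup\Lambda_\alpha^s$. Let $g=(g^s,g^u)^{\mathrm T}$ be a continuous function on $[0,\infty)$ with bounded components ($g^s$ with $d_s$ components, $g^u$ with $d_u$ components). Then: (1) the equation ${}^{C}D^\alpha_{0+}y^u=B^uy^u+g^u(t)$ has a unique solution $\bar\varphi$ bounded on $\mathbb{R}_{\ge0}$; (2) for every $y^s_0\in\mathbb{C}^{d_s}$ the solution $\varphi(\cdot;0,y^s_0)$ of ${}^{C}D^\alpha_{0+}y^s=B^sy^s+g^s(t)$, $y^s(0)=y^s_0$, is bounded on $\mathbb{R}_{\ge0}$; (3) the set of all bounded solutions of ${}^{C}D^\alpha_{0+}y(t)=By(t)+g(t)$ is exactly $\{(\varphi(\cdot;0,y^s_0),\bar\varphi(\cdot))^{\mathrm T}: y^s_0\in\mathbb{C}^{d_s}\}$. If moreover all components of $g$ tend to $0$ as $t\to\infty$, then every bounded solution of ${}^{C}D^\alpha_{0+}y=By+g$ tends to $0$ as $t\to\infty$.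
   Context: For $\alpha\in(0,1)$ the Caputo derivative is ${}^{C}D^\alpha_{0+}x(t)=\frac{1}{\Gamma(1-\alpha)}\int_0^t(t-\tau)^{-\alpha}x'(\tau)\,d\tau$, applied componentwise. Arguments of nonzero complex numbers are in $(-\pi,\pi]$; $\Lambda_\alpha^u:=\{\lambda\in\mathbb{C}\setminus\{0\}:|\arg\lambda|<\alpha\pi/2\}$ and $\Lambda_\alpha^s:=\{\lambda\in\mathbb{C}\setminus\{0\}:|\arg\lambda|>\alpha\pi/2\}$; $\sigma(B)$ is the set of eigenvalues of $B$. Solutions with initial value $y_0$ are given by $y(t)=E_\alpha(t^\alpha B)y_0+\int_0^t(t-\tau)^{\alpha-1}E_{\alpha,\alpha}((t-\tau)^\alpha B)g(\tau)\,d\tau$, where $E_{\alpha,\beta}(z)=\sum_{k\ge0}z^k/\Gamma(\alpha k+\beta)$, $E_\alpha=E_{\alpha,1}$. *)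

theory Defs
  imports "HOL-Analysis.Analysis" "Jordan_Normal_Form.Jordan_Normal_Form"
begin

text \<open>Sectors of the complex plane (Arg takes values in (-pi, pi]).\<close>
definition Lambda_u :: "real \<Rightarrow> complex set" where
  "Lambda_u \<alpha> = {z. z \<noteq> 0 \<and> \<bar>Arg z\<bar> < \<alpha> * pi / 2}"

definition Lambda_s :: "real \<Rightarrow> complex set" where
  "Lambda_s \<alpha> = {z. z \<noteq> 0 \<and> \<bar>Arg z\<bar> > \<alpha> * pi / 2}"

definition mittag_leffler_mat :: "real \<Rightarrow> real \<Rightarrow> complex mat \<Rightarrow> complex mat" where
  "mittag_leffler_mat \<alpha> \<beta> M = mat (dim_row M) (dim_col M)
     (\<lambda>(i,j). \<Sum>k. (M ^\<^sub>m k) $$ (i,j) / complex_of_real (Gamma (\<alpha> * real k + \<beta>)))"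

text \<open>The solution of  C-D^alpha y = B y + g(t), y(0) = y0, given by the variation of
  constants formula (integral taken componentwise).\<close>
definition frac_sol :: "real \<Rightarrow> complex mat \<Rightarrow> (real \<Rightarrow> complex vec) \<Rightarrow> complex vec \<Rightarrow> real \<Rightarrow> complex vec" where
  "frac_sol \<alpha> B g y0 t =
     mittag_leffler_mat \<alpha> 1 (complex_of_real (t powr \<alpha>) \<cdot>\<^sub>m B) *\<^sub>v y0
     + vec (dim_row B) (\<lambda>i. integral {0..t} (\<lambda>\<tau>.
          complex_of_real ((t - \<tau>) powr (\<alpha> - 1)) *
          ((mittag_leffler_mat \<alpha> \<alpha> (complex_of_real ((t - \<tau>) powr \<alpha>) \<cdot>\<^sub>m B) *\<^sub>v g \<tau>) $ i)))"

definition is_caputo_sol :: "real \<Rightarrow> complex mat \<Rightarrow> (real \<Rightarrow> complex vec) \<Rightarrow> (real \<Rightarrow> complex vec) \<Rightarrow> bool" where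
  "is_caputo_sol \<alpha> B g y \<longleftrightarrow>
     (\<exists>y0. dim_vec y0 = dim_col B \<and> (\<forall>t\<ge>0. y t = frac_sol \<alpha> B g y0 t))"

definition bounded_nonneg :: "(real \<Rightarrow> complex vec) \<Rightarrow> bool" where
  "bounded_nonneg y \<longleftrightarrow> (\<exists>M. \<forall>t\<ge>0. \<forall>i<dim_vec (y t). cmod (y t $ i) \<le> M)"

end

theory Submission
  imports Defs "HOL-Complex_Analysis.Complex_Analysis" "HOL-Real_Asymp.Real_Asymp"
begin

unbundle no vec_syntax

text \<open>Substituting \<open>u = e\<^sup>w\<close> in Hankel's integral for \<open>1/\<Gamma>\<close> turns the Mittag-Leffler function
  into an integral of a meromorphic function over the boundary of a horizontal strip
  \<open>|Im w| < \<theta>\<close> with \<open>\<pi>/2 < \<theta> \<le> \<pi>\<close>, so that the residue theorem yields its asymptotics along rays: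
  decay in the stable sector, a growing exponential plus a decaying remainder in the unstable one.
  Consequently the solution of a scalar equation is a decaying term plus the convolution of the
  forcing with an integrable kernel, plus (unstable case) a multiple of a growing exponential,
  which vanishes for exactly one initial value.
  For a triangular system every component of the variation of constants formula solves the scalar
  Volterra equation driven by the forcing and the later components. So the components can be
  treated one at a time from the last to the first; the Jordan form is used only through triangularity and the
  position of the diagonal entries.\<close>

section \<open>Hankel's integral for the reciprocal Gamma function\<close>

text \<open>The threshold \<alpha> * pi / 2 reflects the condition \<theta> > pi/2: on the line Im w
  = y the integrand has modulus exp (exp x * cos y) up to a simple exponential in x, so it decays to
  the right only for cos y < 0. The pole, where exp (\<alpha> w) = z, lies at height Arg z /
  \<alpha>. If this height exceeds pi/2 in modulus, \<theta> fits strictly between and no residue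
  arises; if it is smaller, \<theta> = pi encloses exactly one pole. Working in w rather than u
  removes the branch cut of the power u^\<alpha>. Improper contour integrals are avoided by limits
  of differences of primitives and by majorants with an explicit bounded primitive. A further
  obstacle is the singularity of the resolvent kernel at 0: it is only locally integrable, while
  solutions are locally bounded, so the convolution calculus pairs one factor of each kind. Going
  through scalar equations replaces the derivatives of Mittag-Leffler functions that a Jordan block
  would produce. The descending order is also the order in which the unstable initial values are
  forced: each is determined by a forcing that contains only components already known to be
  bounded.\<close>

text \<open>The integrand of Hankel's integral for \<open>1/\<Gamma>(s)\<close> in the variable \<open>w\<close> with \<open>u = e\<^sup>w\<close>. It is entire,
  so the integral along the Hankel contour is the limit of \<open>\<Psi>(R + i\<theta>) - \<Psi>(R - i\<theta>)\<close> for a primitive \<open>\<Psi>\<close>.\<close>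
definition hankel_fun :: "real \<Rightarrow> complex \<Rightarrow> complex" where
  "hankel_fun s w = exp (exp w + of_real (1 - s) * w)"

lemma norm_hankel_fun: "norm (hankel_fun s (Complex x y)) = exp (exp x * cos y + (1 - s) * x)"
  by (simp add: hankel_fun_def Re_exp)

lemma hankel_fun_holomorphic: "hankel_fun s holomorphic_on A"
  unfolding hankel_fun_def by (intro holomorphic_intros)

lemma hankel_fun_primitive: obtains \<Psi> where "\<And>w. (\<Psi> has_field_derivative hankel_fun s w) (at w)"
  using holomorphic_convex_primitive'[of UNIV "hankel_fun s"] hankel_fun_holomorphic[of s UNIV] by auto

text \<open>Mean value inequality on a vertical segment. It is used with \<open>c = 1\<close> for
  the segment joining the two horizontal lines, and with \<open>c = cos \<theta> < 0\<close> to
  change the angle of the contour at a cost that vanishes as \<open>x\<close> grows.\<close>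

lemma primitive_vertical_bound:
  assumes "\<And>w. (\<Psi> has_field_derivative hankel_fun s w) (at w)"
    and "\<And>y. min a b \<le> y \<Longrightarrow> y \<le> max a b \<Longrightarrow> cos y \<le> c"
  shows "norm (\<Psi> (Complex x a) - \<Psi> (Complex x b)) \<le> exp (exp x * c + (1 - s) * x) * \<bar>a - b\<bar>"
proof -
  have "norm (\<Psi> (Complex x a) - \<Psi> (Complex x b)) \<le> exp (exp x * c + (1 - s) * x) * norm (Complex x a - Complex x b)"
  proof (rule field_differentiable_bound[where f' = "hankel_fun s" and S = "closed_segment (Complex x a) (Complex x b)"])
    fix z assume z: "z \<in> closed_segment (Complex x a) (Complex x b)"
    then have "Re z = x" "Im z \<in> closed_segment a b"
      by (auto simp: closed_segment_same_Re)
    then obtain y where zy: "z = Complex x y" "min a b \<le> y" "y \<le> max a b"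
      by (cases z) (auto simp: closed_segment_eq_real_ivl split: if_splits)
    show "norm (hankel_fun s z) \<le> exp (exp x * c + (1 - s) * x)"
      unfolding zy norm_hankel_fun using assms(2)[OF zy(2,3)] by simp
  qed (use assms(1) in \<open>auto intro: has_field_derivative_at_within\<close>)
  also have "Complex x a - Complex x b = Complex 0 (a - b)" by (simp add: complex_eq_iff)
  also have "norm \<dots> = \<bar>a - b\<bar>" by (simp add: cmod_def)
  finally show ?thesis .
qed

lemma primitive_horizontal_derivative:
  assumes "\<And>w. (\<Psi> has_field_derivative hankel_fun s w) (at w)"
  shows "((\<lambda>x. \<Psi> (Complex x y)) has_vector_derivative hankel_fun s (Complex x y)) (at x)"
proof -
  have "((\<lambda>x. Complex x y) has_vector_derivative 1) (at x)"
    unfolding Complex_eq by (auto intro!: derivative_eq_intros)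
  from field_vector_diff_chain_at[OF this assms] show ?thesis
    by (simp add: o_def)
qed

text \<open>\<open>exp w\<close> is the same negative number on both lines, so the two values differ
  only in the phase of \<open>exp ((1 - s) * w)\<close>. That phase difference is the sine of the
  reflection formula.\<close>

lemma hankel_fun_at_pi_diff:
  "hankel_fun s (Complex x pi) - hankel_fun s (Complex x (-pi)) =
     of_real (exp ((1 - s) * x - exp x)) * (2 * \<i> * of_real (sin (pi * s)))"
proof -
  have e: "exp (Complex x pi) = - of_real (exp x)" "exp (Complex x (-pi)) = - of_real (exp x)"
    by (auto simp: complex_eq_iff Re_exp Im_exp)
  have 1: "hankel_fun s (Complex x pi) = of_real (exp ((1 - s) * x - exp x)) * exp (\<i> * of_real (pi * (1 - s)))"
    unfolding hankel_fun_def e by (simp add: exp_of_real[symmetric] exp_add[symmetric] Complex_eq algebra_simps del: exp_of_real)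
  have 2: "hankel_fun s (Complex x (-pi)) = of_real (exp ((1 - s) * x - exp x)) * exp (\<i> * of_real (- (pi * (1 - s))))"
    unfolding hankel_fun_def e by (simp add: exp_of_real[symmetric] exp_add[symmetric] Complex_eq algebra_simps del: exp_of_real)
  have 3: "exp (\<i> * of_real (pi * (1 - s))) - exp (\<i> * of_real (- (pi * (1 - s)))) = 2 * \<i> * of_real (sin (pi * (1 - s)))"
    by (simp add: complex_eq_iff Re_exp Im_exp del: of_real_mult)
  have "sin (pi * (1 - s)) = sin (pi * s)"
    using sin_diff[of pi "pi * s"] by (simp add: algebra_simps)
  then show ?thesis using 1 2 3 by (simp add: right_diff_distrib[symmetric])
qed

text \<open>On the lines \<open>Im w = \<plusminus>\<pi>\<close> the two integrands combine to the integrand of Euler's integral for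
  \<open>\<Gamma>(1 - s)\<close>, and the vertical segment contributes nothing as \<open>R \<rightarrow> -\<infinity>\<close>.\<close>
lemma hankel_base:
  assumes \<Psi>: "\<And>w. (\<Psi> has_field_derivative hankel_fun s w) (at w)" and s: "s < 1"
  shows "((\<lambda>R. \<Psi> (Complex R pi) - \<Psi> (Complex R (-pi))) \<longlongrightarrow> 2 * pi * \<i> * of_real (rGamma s)) at_top"
proof -
  define d where "d R = \<Psi> (Complex R pi) - \<Psi> (Complex R (-pi))" for R
  define c where "c = 2 * \<i> * of_real (sin (pi * s))"
  define h where "h t = t powr (-s) / exp t" for t :: real
  \<comment> \<open>The substitution is u = exp x. Putting \<open>g 0 = 0\<close>, the limit of
    \<open>d\<close> at minus infinity, makes \<open>g\<close> continuous on \<open>{0..v}\<close>,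
    so the fundamental theorem of calculus applies although \<open>h\<close> may be singular at
    0.\<close>
  define g where "g u = (if u = 0 then 0 else d (ln u))" for u :: real
  have d': "(d has_vector_derivative of_real (exp ((1 - s) * x - exp x)) * c) (at x)" for x
    unfolding d_def c_def hankel_fun_at_pi_diff[symmetric]
    by (intro has_vector_derivative_diff primitive_horizontal_derivative \<Psi>)
  have dbound: "norm (d x) \<le> exp (exp x + (1 - s) * x) * (2 * pi)" for x
    using primitive_vertical_bound[OF \<Psi>, of pi "-pi" 1 x] by (simp add: d_def)
  have dlim: "(d \<longlongrightarrow> 0) at_bot"
  proof (rule Lim_null_comparison)
    show "\<forall>\<^sub>F x in at_bot. norm (d x) \<le> exp 1 * exp ((1 - s) * x) * (2 * pi)"
      using eventually_le_at_bot[of 0]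
    proof eventually_elim
      case (elim x)
      have "exp (exp x + (1 - s) * x) * (2 * pi) \<le> exp 1 * exp ((1 - s) * x) * (2 * pi)"
        unfolding exp_add using elim by (intro mult_right_mono) auto
      with dbound[of x] show ?case by linarith
    qed
    have "((\<lambda>x::real. exp 1 * exp (p * x) * (2 * pi)) \<longlongrightarrow> 0) at_bot" if "p > 0" for p
      using that by real_asymp
    with s show "((\<lambda>x. exp 1 * exp ((1 - s) * x) * (2 * pi)) \<longlongrightarrow> 0) at_bot" by simp
  qed
  have g0: "(g \<longlongrightarrow> 0) (at_right 0)"
  proof -
    have "((\<lambda>u. d (ln u)) \<longlongrightarrow> 0) (at_right 0)"
      by (rule filterlim_compose[OF dlim ln_at_0])
    moreover have "\<forall>\<^sub>F u in at_right 0. d (ln u) = g u"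
      unfolding g_def eventually_at_filter by simp
    ultimately show ?thesis by (rule Lim_transform_eventually)
  qed
  have g': "(g has_vector_derivative of_real (h u) * c) (at u)" if "u > 0" for u
  proof -
    have "((\<lambda>u. d (ln u)) has_vector_derivative (1 / u) *\<^sub>R (of_real (exp ((1 - s) * ln u - exp (ln u))) * c)) (at u)"
    proof -
      have "(ln has_vector_derivative 1 / u) (at u)"
        using DERIV_ln_divide[OF that] by (simp add: has_real_derivative_iff_has_vector_derivative)
      from vector_diff_chain_at[OF this d'] show ?thesis by (simp only: o_def)
    qed
    moreover have "(1 / u) * exp ((1 - s) * ln u - exp (ln u)) = h u"
    proof -
      have "exp ((1 - s) * ln u - exp (ln u)) = u powr (1 - s) / exp u"
        using that by (simp add: exp_diff powr_def)
      then show ?thesis using that by (simp add: h_def powr_diff powr_minus field_simps)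
    qed
    ultimately have "((\<lambda>u. d (ln u)) has_vector_derivative of_real (h u) * c) (at u)"
      by (simp only: scaleR_conv_of_real mult.assoc[symmetric] of_real_mult[symmetric])
    then show ?thesis
      by (rule has_vector_derivative_transform_within_open[where S = "{0<..}"]) (use that in \<open>auto simp: g_def\<close>)
  qed
  have int: "((\<lambda>u. of_real (h u) * c) has_integral g v) {0..v}" if "v > 0" for v
  proof -
    have "((\<lambda>u. of_real (h u) * c) has_integral (g v - g 0)) {0..v}"
    proof (rule fundamental_theorem_of_calculus_interior)
      show "continuous_on {0..v} g"
        unfolding continuous_on_eq_continuous_within
      proof
        fix x assume x: "x \<in> {0..v}"
        show "continuous (at x within {0..v}) g"
        proof (cases "x = 0")
          case True
          have "(g \<longlongrightarrow> g 0) (at_right 0)" using g0 by (simp add: g_def)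
          then show ?thesis unfolding True continuous_within at_within_Icc_at_right[OF that] .
        next
          case False
          then show ?thesis using x g'[of x]
            by (auto intro: has_vector_derivative_continuous continuous_at_imp_continuous_at_within)
        qed
      qed
    qed (use that g' in auto)
    then show ?thesis by (simp add: g_def)
  qed
  have hG: "(h has_integral Gamma (1 - s)) {0..}"
    using Gamma_integral_real[of "1 - s"] s by (simp add: h_def[abs_def])
  have "h absolutely_integrable_on {0..}"
    by (rule nonnegative_absolutely_integrable_1) (use hG in \<open>auto simp: h_def\<close>)
  then have "((\<lambda>v. LINT u:{0..v}|lebesgue. h u) \<longlongrightarrow> (LINT u:{0..}|lebesgue. h u)) at_top"
    by (intro tendsto_set_lebesgue_integral_at_top) auto
  moreover have "(LINT u:{0..v}|lebesgue. h u) = integral {0..v} h" for v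
    by (rule set_lebesgue_integral_eq_integral)
      (rule set_integrable_subset[OF \<open>h absolutely_integrable_on {0..}\<close>], auto)
  moreover have "(LINT u:{0..}|lebesgue. h u) = Gamma (1 - s)"
    using set_lebesgue_integral_eq_integral(2)[OF \<open>h absolutely_integrable_on {0..}\<close>] hG by (simp add: integral_unique)
  ultimately have J: "((\<lambda>v. integral {0..v} h) \<longlongrightarrow> Gamma (1 - s)) at_top" by simp
  have gJ: "g v = of_real (integral {0..v} h) * c" if "v > 0" for v
  proof -
    have "h integrable_on {0..v}"
      by (rule integrable_on_subinterval[OF has_integral_integrable[OF hG]]) auto
    then have "((\<lambda>u. of_real (h u) * c) has_integral of_real (integral {0..v} h) * c) {0..v}"
      by (intro has_integral_mult_left has_integral_of_real integrable_integral)
    with int[OF that] show ?thesis by (rule has_integral_unique)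
  qed
  have "((\<lambda>v. of_real (integral {0..v} h) * c) \<longlongrightarrow> of_real (Gamma (1 - s)) * c) at_top"
    by (intro tendsto_intros J)
  then have "((\<lambda>R. of_real (integral {0..exp R} h) * c) \<longlongrightarrow> of_real (Gamma (1 - s)) * c) at_top"
    by (rule filterlim_compose[OF _ exp_at_top])
  moreover have "of_real (integral {0..exp R} h) * c = d R" for R
    using gJ[of "exp R"] by (simp add: g_def)
  \<comment> \<open>Euler's reflection formula, transported from complex to real arguments, turns
    sin (pi s) Gamma(1 - s) into pi / Gamma(s).\<close>
  moreover have "of_real (Gamma (1 - s)) * c = 2 * pi * \<i> * of_real (rGamma s)"
  proof -
    have "rGamma s * rGamma (1 - s) = sin (pi * s) / pi"
    proof -
      have "complex_of_real (rGamma s * rGamma (1 - s)) = of_real (sin (pi * s) / pi)"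
        using rGamma_reflection_complex[of "of_real s"]
        by (simp only: of_real_mult of_real_divide of_real_diff of_real_1 rGamma_complex_of_real[symmetric] sin_of_real[symmetric])
      then show ?thesis by (simp only: of_real_eq_iff)
    qed
    moreover have "Gamma (1 - s) * rGamma (1 - s) = 1"
    proof -
      have "Gamma (1 - s) > 0" using s by (intro Gamma_real_pos) simp
      then show ?thesis by (simp add: rGamma_inverse_Gamma)
    qed
    ultimately have G: "rGamma s * rGamma (1 - s) = sin (pi * s) / pi" "Gamma (1 - s) * rGamma (1 - s) = 1" by auto
    have "sin (pi * s) * Gamma (1 - s) = pi * (sin (pi * s) / pi) * Gamma (1 - s)" by simp
    also have "\<dots> = pi * rGamma s * (Gamma (1 - s) * rGamma (1 - s))" unfolding G(1)[symmetric] by (simp only: mult_ac)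
    finally have "sin (pi * s) * Gamma (1 - s) = pi * rGamma s" unfolding G(2) by simp
    moreover have "of_real (Gamma (1 - s)) * c = 2 * \<i> * of_real (sin (pi * s) * Gamma (1 - s))"
      by (simp add: c_def)
    ultimately show ?thesis by simp
  qed
  ultimately show ?thesis by (simp add: d_def)
qed

lemma norm_exp_minus_one_le: "norm (exp z - 1) \<le> exp (norm z) * norm (z :: complex)"
proof -
  have "norm (exp z - exp 0) \<le> exp (norm z) * norm (z - 0)"
    by (rule field_differentiable_bound[where f' = exp and S = "cball 0 (norm z)"])
      (auto intro!: derivative_eq_intros intro: order_trans[OF complex_Re_le_cmod])
  then show ?thesis by simp
qed

text \<open>Here sin (pi s) = 0, so the difference does not depend on \<open>R\<close>. Its value is
  read off at minus infinity, where the integrand \<open>exp (exp w)\<close> tends to 1 on a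
  vertical segment of length 2 pi; for \<open>s < 1\<close> that segment contributes 0
  instead.\<close>

lemma hankel_one:
  assumes \<Psi>: "\<And>w. (\<Psi> has_field_derivative hankel_fun 1 w) (at w)"
  shows "((\<lambda>R. \<Psi> (Complex R pi) - \<Psi> (Complex R (-pi))) \<longlongrightarrow> 2 * pi * \<i>) at_top"
proof -
  define d where "d R = \<Psi> (Complex R pi) - \<Psi> (Complex R (-pi))" for R
  have d': "(d has_vector_derivative 0) (at x)" for x
    using has_vector_derivative_diff[OF primitive_horizontal_derivative[OF \<Psi>] primitive_horizontal_derivative[OF \<Psi>],
        of pi "-pi" x] hankel_fun_at_pi_diff[of 1 x]
    unfolding d_def by simp
  then obtain k where k: "\<And>x. d x = k"
    using has_vector_derivative_zero_constant[of UNIV d] by auto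
  have db: "norm (d x - 2 * pi * \<i>) \<le> exp (exp x) * exp x * (2 * pi)" for x
  proof -
    have "norm ((\<Psi> (Complex x pi) - Complex x pi) - (\<Psi> (Complex x (-pi)) - Complex x (-pi))) \<le>
        (exp (exp x) * exp x) * norm (Complex x pi - Complex x (-pi))"
    proof (rule field_differentiable_bound[where f' = "\<lambda>w. hankel_fun 1 w - 1" and S = "closed_segment (Complex x pi) (Complex x (-pi))"])
      fix z assume "z \<in> closed_segment (Complex x pi) (Complex x (-pi))"
      then have "Re z = x" by (auto simp: closed_segment_same_Re)
      then have "norm (exp z) = exp x" by simp
      then show "norm (hankel_fun 1 z - 1) \<le> exp (exp x) * exp x"
        using norm_exp_minus_one_le[of "exp z"] by (simp add: hankel_fun_def)
    qed (auto intro!: derivative_eq_intros has_field_derivative_at_within[OF \<Psi>])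
    moreover have "Complex x pi - Complex x (-pi) = 2 * pi * \<i>" by (simp add: complex_eq_iff)
    ultimately show ?thesis by (simp add: d_def algebra_simps norm_mult)
  qed
  have "((\<lambda>x. d x - 2 * pi * \<i>) \<longlongrightarrow> 0) at_bot"
  proof (rule Lim_null_comparison)
    show "\<forall>\<^sub>F x in at_bot. norm (d x - 2 * pi * \<i>) \<le> exp (exp x) * exp x * (2 * pi)"
      using db by simp
    show "((\<lambda>x::real. exp (exp x) * exp x * (2 * pi)) \<longlongrightarrow> 0) at_bot" by real_asymp
  qed
  then have "k = 2 * pi * \<i>" by (simp add: k tendsto_const_iff)
  then have "(d \<longlongrightarrow> 2 * pi * \<i>) at_top" by (simp add: k[abs_def])
  then show ?thesis by (simp add: d_def[abs_def])
qed

text \<open>Induction over unit intervals of \<open>s\<close>, lifting \<open>s - 1\<close> to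
  \<open>s\<close> by the functional equation of 1/Gamma. The value \<open>s = 1\<close> is treated
  apart because the lifting divides by \<open>s - 1\<close>.\<close>

lemma hankel_pi:
  assumes "\<And>w. (\<Psi> has_field_derivative hankel_fun s w) (at w)" and "s \<ge> 0"
  shows "((\<lambda>R. \<Psi> (Complex R pi) - \<Psi> (Complex R (-pi))) \<longlongrightarrow> 2 * pi * \<i> * of_real (rGamma s)) at_top"
proof -
  obtain n :: nat where "s < real n + 1"
    using reals_Archimedean2[of s] less_add_one order_less_trans by blast
  with assms show ?thesis
  proof (induction n arbitrary: s \<Psi>)
    case 0
    then show ?case using hankel_base[OF 0(1)] by simp
  next
    case (Suc n)
    note \<Psi> = Suc.prems(1)
    consider "s < 1" | "s = 1" | "s > 1" by linarith
    then show ?case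
    proof cases
      case 1 then show ?thesis using hankel_base[OF \<Psi>] by simp
    next
      case 2 then show ?thesis using hankel_one[of \<Psi>] \<Psi> by simp
    next
      case 3
      let ?D = "\<lambda>f R. f (Complex R pi) - f (Complex R (-pi)) :: complex"
      obtain \<Psi>' where \<Psi>': "\<And>w. (\<Psi>' has_field_derivative hankel_fun (s - 1) w) (at w)" using hankel_fun_primitive by blast
      have "((\<lambda>R. ?D \<Psi>' R) \<longlongrightarrow> 2 * pi * \<i> * of_real (rGamma (s - 1))) at_top"
        using Suc.IH[OF \<Psi>'] 3 Suc.prems by simp
      moreover have "((\<lambda>R. ?D (hankel_fun s) R) \<longlongrightarrow> 0) at_top"
        unfolding hankel_fun_at_pi_diff
      proof (rule tendsto_mult_left_zero)
        have "((\<lambda>x. exp ((1 - s) * x - exp x)) \<longlongrightarrow> 0) at_top" by real_asymp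
        then show "((\<lambda>x. complex_of_real (exp ((1 - s) * x - exp x))) \<longlongrightarrow> 0) at_top"
          by (metis of_real_0 tendsto_of_real)
      qed
      ultimately have "((\<lambda>R. (?D \<Psi>' R - ?D (hankel_fun s) R) / of_real (s - 1))
          \<longlongrightarrow> (2 * pi * \<i> * of_real (rGamma (s - 1)) - 0) / of_real (s - 1)) at_top"
        using 3 by (intro tendsto_intros) auto
      moreover have "(?D \<Psi>' R - ?D (hankel_fun s) R) / of_real (s - 1)
           = ?D \<Psi> R" for R
      proof -
        \<comment> \<open>Integration by parts: the derivative of \<open>hankel_fun s\<close> is
          \<open>hankel_fun (s - 1)\<close> minus \<open>(s - 1)\<close> times
          \<open>hankel_fun s\<close>.\<close>
        have "((\<lambda>w. \<Psi>' w - of_real (s - 1) * \<Psi> w - hankel_fun s w) has_field_derivative 0) (at w)" for w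
        proof -
          have "(hankel_fun s has_field_derivative (exp w + of_real (1 - s)) * hankel_fun s w) (at w)"
            unfolding hankel_fun_def[abs_def] by (auto intro!: derivative_eq_intros simp: algebra_simps)
          moreover have "hankel_fun (s - 1) w = exp w * hankel_fun s w"
            by (simp add: hankel_fun_def exp_add[symmetric] algebra_simps)
          ultimately show ?thesis
            by (auto intro!: derivative_eq_intros \<Psi> \<Psi>' simp: algebra_simps)
        qed
        then obtain k where "\<And>w. \<Psi>' w - of_real (s - 1) * \<Psi> w - hankel_fun s w = k"
          using has_field_derivative_zero_constant[of UNIV "\<lambda>w. \<Psi>' w - of_real (s - 1) * \<Psi> w - hankel_fun s w"] by auto
        from this[of "Complex R pi"] this[of "Complex R (-pi)"] show ?thesis
          using 3 by (simp add: field_simps)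
      qed
      moreover have "(2 * pi * \<i> * of_real (rGamma (s - 1)) - 0) / of_real (s - 1) = 2 * pi * \<i> * of_real (rGamma s)"
      proof -
        have "rGamma (s - 1) = (s - 1) * rGamma s" using rGamma_plus1[of "s - 1"] by simp
        moreover have "complex_of_real (s - 1) \<noteq> 0" using 3 by (simp del: of_real_diff)
        ultimately show ?thesis by (simp del: of_real_diff)
      qed
      ultimately show ?thesis by (simp del: of_real_diff)
    qed
  qed
qed

text \<open>Between the angles \<theta> and pi the cosine is at most
  \<open>cos \<theta> < 0\<close>, so the vertical pieces separating the two contours vanish doubly
  exponentially.\<close>

lemma hankel:
  assumes \<Psi>: "\<And>w. (\<Psi> has_field_derivative hankel_fun s w) (at w)" and "s \<ge> 0" and \<theta>: "pi / 2 < \<theta>" "\<theta> \<le> pi"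
  shows "((\<lambda>R. \<Psi> (Complex R \<theta>) - \<Psi> (Complex R (-\<theta>))) \<longlongrightarrow> 2 * pi * \<i> * of_real (rGamma s)) at_top"
proof -
  define c where "c = cos \<theta>"
  have c: "c < 0" unfolding c_def using \<theta> cos_lt_zero_pi cos_monotone_0_pi[of "pi/2" \<theta>] by auto
  have cos_le: "cos y \<le> c" if "\<theta> \<le> \<bar>y\<bar>" "\<bar>y\<bar> \<le> pi" for y
    using cos_monotone_0_pi_le[of \<theta> "\<bar>y\<bar>"] that \<theta> by (simp add: c_def)
  have up: "norm (\<Psi> (Complex R pi) - \<Psi> (Complex R \<theta>)) \<le> exp (exp R * c + (1 - s) * R) * \<bar>pi - \<theta>\<bar>" for R
    by (rule primitive_vertical_bound[OF \<Psi>]) (use \<theta> in \<open>auto intro!: cos_le\<close>)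
  have low: "norm (\<Psi> (Complex R (-pi)) - \<Psi> (Complex R (-\<theta>))) \<le> exp (exp R * c + (1 - s) * R) * \<bar>- pi + \<theta>\<bar>" for R
    using primitive_vertical_bound[OF \<Psi>, of "-pi" "-\<theta>" c R] \<theta> by (force intro!: cos_le)
  have lim: "((\<lambda>R. exp (exp R * c + (1 - s) * R) * k) \<longlongrightarrow> 0) at_top" for k :: real
  proof -
    define e where "e = - c"
    then have e: "e > 0" "c = - e" using c by auto
    show ?thesis unfolding e(2) using e(1) by real_asymp
  qed
  have "((\<lambda>R. (\<Psi> (Complex R pi) - \<Psi> (Complex R (-pi))) - (\<Psi> (Complex R pi) - \<Psi> (Complex R \<theta>))
      + (\<Psi> (Complex R (-pi)) - \<Psi> (Complex R (-\<theta>)))) \<longlongrightarrow> 2 * pi * \<i> * of_real (rGamma s) - 0 + 0) at_top"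
    by (intro tendsto_intros hankel_pi[OF \<Psi> \<open>s \<ge> 0\<close>]
        Lim_null_comparison[OF always_eventually[OF allI[OF up]] lim]
        Lim_null_comparison[OF always_eventually[OF allI[OF low]] lim])
  then show ?thesis by simp
qed

section \<open>Tails of the Hankel integral and decay of 1/Gamma\<close>

lemma norm_diff_le_of_derivatives:
  fixes F :: "real \<Rightarrow> 'a :: euclidean_space" and G :: "real \<Rightarrow> real"
  assumes "a \<le> b"
    and F: "\<And>x. a \<le> x \<Longrightarrow> x \<le> b \<Longrightarrow> (F has_vector_derivative f x) (at x)"
    and G: "\<And>x. a \<le> x \<Longrightarrow> x \<le> b \<Longrightarrow> (G has_real_derivative g x) (at x)"
    and le: "\<And>x. a \<le> x \<Longrightarrow> x \<le> b \<Longrightarrow> norm (f x) \<le> g x"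
  shows "norm (F b - F a) \<le> G b - G a"
proof -
  have f: "(f has_integral (F b - F a)) {a..b}"
    using \<open>a \<le> b\<close> by (rule fundamental_theorem_of_calculus) (rule has_vector_derivative_at_within[OF F], simp_all)
  have "(G has_vector_derivative g x) (at x within {a..b})" if "x \<in> {a..b}" for x
    using has_vector_derivative_at_within[OF G[unfolded has_real_derivative_iff_has_vector_derivative]] that by simp
  then have g: "(g has_integral (G b - G a)) {a..b}"
    by (rule fundamental_theorem_of_calculus[OF \<open>a \<le> b\<close>])
  have "norm (integral {a..b} f) \<le> integral {a..b} g"
    by (rule integral_norm_bound_integral[OF has_integral_integrable[OF f] has_integral_integrable[OF g]]) (simp add: le)
  then show ?thesis
    by (simp only: integral_unique[OF f] integral_unique[OF g])
qed

text \<open>The exponent is split as \<open>\<sigma> + \<beta>\<close> so that \<sigma> enters the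
  bound only through \<open>exp (- \<sigma> * R)\<close>: for \<sigma> = \<alpha> k the tails then
  sum like a geometric series. The bound itself is the integral of a majorant from \<open>R\<close>
  to infinity.\<close>

lemma hankel_tail:
  assumes \<Psi>: "\<And>w. (\<Psi> has_field_derivative hankel_fun (\<sigma> + \<beta>) w) (at w)"
    and "\<sigma> \<ge> 0" "\<beta> \<ge> 0" and \<theta>: "pi / 2 < \<theta>" "\<theta> \<le> pi" and R: "R \<ge> 0"
  shows "norm (\<Psi> (Complex R \<theta>) - \<Psi> (Complex R (-\<theta>)) - 2 * pi * \<i> * of_real (rGamma (\<sigma> + \<beta>)))
     \<le> 2 / (- cos \<theta>) * exp (- \<sigma> * R) * exp (cos \<theta> * exp R)"
proof -
  let ?h = "\<lambda>x. hankel_fun (\<sigma> + \<beta>) (Complex x \<theta>) - hankel_fun (\<sigma> + \<beta>) (Complex x (-\<theta>))"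
  define c where "c = cos \<theta>"
  have c: "c < 0" unfolding c_def using \<theta> cos_lt_zero_pi cos_monotone_0_pi[of "pi/2" \<theta>] by auto
  define d where "d R = \<Psi> (Complex R \<theta>) - \<Psi> (Complex R (-\<theta>))" for R
  \<comment> \<open>Primitive of the majorant that results from \<open>x \<ge> R\<close> in the
    factor with \<sigma> and from \<open>exp (- \<beta> * x) \<le> 1\<close>; the remaining
    \<open>exp (c * exp x) * exp x\<close> integrates exactly.\<close>
  define G where "G x = 2 / c * exp (- \<sigma> * R) * exp (c * exp x)" for x
  have step: "norm (d R' - d R) \<le> - G R" if "R' \<ge> R" for R'
  proof -
    have "norm (d R' - d R) \<le> G R' - G R"
    proof (rule norm_diff_le_of_derivatives[OF that])
      fix x assume x: "R \<le> x" "x \<le> R'"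
      show "(d has_vector_derivative (?h x)) (at x)"
        unfolding d_def by (intro has_vector_derivative_diff primitive_horizontal_derivative \<Psi>)
      show "(G has_real_derivative 2 * exp (- \<sigma> * R) * exp (c * exp x) * exp x) (at x)"
        unfolding G_def using c by (auto intro!: derivative_eq_intros)
      have "norm (?h x) \<le> 2 * exp (exp x * c + (1 - (\<sigma> + \<beta>)) * x)"
        using norm_triangle_ineq4[of "hankel_fun (\<sigma> + \<beta>) (Complex x \<theta>)" "hankel_fun (\<sigma> + \<beta>) (Complex x (-\<theta>))"]
        by (simp add: norm_hankel_fun c_def)
      also have "\<dots> \<le> 2 * exp (- \<sigma> * R + c * exp x + x)"
      proof -
        have "\<sigma> * R \<le> \<sigma> * x" "0 \<le> \<beta> * x" using x R assms(2,3) by (auto intro: mult_left_mono)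
        then show ?thesis by (simp add: algebra_simps)
      qed
      finally show "norm (?h x) \<le> 2 * exp (- \<sigma> * R) * exp (c * exp x) * exp x"
        by (simp only: exp_add mult.assoc)
    qed
    moreover have "G R' \<le> 0" using c by (auto simp: G_def divide_nonneg_neg mult_nonpos_nonneg)
    ultimately show ?thesis by simp
  qed
  have "(d \<longlongrightarrow> 2 * pi * \<i> * of_real (rGamma (\<sigma> + \<beta>))) at_top"
    unfolding d_def using assms by (intro hankel) auto
  then have "((\<lambda>R'. norm (d R' - d R)) \<longlongrightarrow> norm (2 * pi * \<i> * of_real (rGamma (\<sigma> + \<beta>)) - d R)) at_top"
    by (intro tendsto_intros)
  then have "norm (2 * pi * \<i> * of_real (rGamma (\<sigma> + \<beta>)) - d R) \<le> - G R"
    by (rule tendsto_upperbound) (use eventually_mono[OF eventually_ge_at_top[of R] step] in \<open>auto\<close>)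
  then show ?thesis by (simp add: norm_minus_commute d_def G_def c_def)
qed

text \<open>1/Gamma decays faster than any exponential. The Hankel integral at angle pi is cut at an
  arbitrary \<open>R\<close>; the vertical segment and the tail both carry the factor
  \<open>exp (- \<sigma> * R)\<close>.\<close>

lemma rGamma_decay:
  fixes R \<beta> :: real
  assumes "R \<ge> 0" "\<beta> \<ge> 0"
  obtains K :: real where "K \<ge> 0" "\<And>\<sigma>. \<sigma> \<ge> 0 \<Longrightarrow> \<bar>rGamma (\<sigma> + \<beta>)\<bar> \<le> K * exp (- \<sigma> * R)"
proof -
  \<comment> \<open>The summands come from the vertical segment and from the tail; the factor 2 of
    the tail is enlarged to 2 pi so that 2 pi cancels.\<close>
  define K where "K = exp (exp R + (1 - \<beta>) * R) + exp (- exp R)"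
  have "\<bar>rGamma (\<sigma> + \<beta>)\<bar> \<le> K * exp (- \<sigma> * R)" if "\<sigma> \<ge> 0" for \<sigma>
  proof -
    obtain \<Psi> where \<Psi>: "\<And>w. (\<Psi> has_field_derivative hankel_fun (\<sigma> + \<beta>) w) (at w)" using hankel_fun_primitive by blast
    define d where "d = \<Psi> (Complex R pi) - \<Psi> (Complex R (-pi))"
    have "norm (2 * pi * \<i> * of_real (rGamma (\<sigma> + \<beta>)) :: complex) \<le> norm d + norm (d - 2 * pi * \<i> * of_real (rGamma (\<sigma> + \<beta>)))"
      using norm_triangle_sub norm_minus_commute by metis
    moreover have "norm (2 * pi * \<i> * of_real (rGamma (\<sigma> + \<beta>)) :: complex) = 2 * pi * \<bar>rGamma (\<sigma> + \<beta>)\<bar>"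
      by (simp add: norm_mult)
    moreover have "norm d \<le> 2 * pi * (exp (exp R + (1 - \<beta>) * R) * exp (- \<sigma> * R))"
      using primitive_vertical_bound[OF \<Psi>, of pi "-pi" 1 R] by (simp add: d_def exp_add[symmetric] algebra_simps)
    moreover have "norm (d - 2 * pi * \<i> * of_real (rGamma (\<sigma> + \<beta>))) \<le> 2 * (exp (- exp R) * exp (- \<sigma> * R))"
      unfolding d_def using hankel_tail[OF \<Psi> that assms(2), of pi R] assms by (simp add: mult_ac)
    moreover have "2 * (exp (- exp R) * exp (- \<sigma> * R)) \<le> 2 * pi * (exp (- exp R) * exp (- \<sigma> * R))"
      using pi_ge_two by (intro mult_right_mono) auto
    moreover have "2 * pi * (K * exp (- \<sigma> * R)) =
        2 * pi * (exp (exp R + (1 - \<beta>) * R) * exp (- \<sigma> * R)) + 2 * pi * (exp (- exp R) * exp (- \<sigma> * R))"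
      unfolding K_def by (simp only: distrib_left distrib_right)
    ultimately have "2 * pi * \<bar>rGamma (\<sigma> + \<beta>)\<bar> \<le> 2 * pi * (K * exp (- \<sigma> * R))"
      by linarith
    then show ?thesis by simp
  qed
  then show ?thesis using that[of K] by (simp add: K_def)
qed

section \<open>Asymptotics of the Mittag-Leffler function\<close>

text \<open>The reciprocal Gamma function keeps \<beta> = 0 meaningful: the term for
  \<open>k = 0\<close> then vanishes, which links this case to \<beta> = \<alpha>.\<close>

definition ml :: "real \<Rightarrow> real \<Rightarrow> complex \<Rightarrow> complex" where
  "ml \<alpha> \<beta> z = (\<Sum>k. z ^ k * of_real (rGamma (\<alpha> * real k + \<beta>)))"

lemma summable_rGamma:
  fixes x \<alpha> \<beta> :: real
  assumes "0 < \<alpha>" "0 \<le> \<beta>" "0 \<le> x"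
  shows "summable (\<lambda>k. x ^ k * \<bar>rGamma (\<alpha> * real k + \<beta>)\<bar>)"
proof -
  \<comment> \<open>Chosen so that \<open>exp (- (\<alpha> * R)) = 1 / (2 * x + 1)\<close>; the
    terms are then dominated by a geometric series of ratio
    \<open>x / (2 * x + 1) \<le> 1 / 2\<close>.\<close>
  define R where "R = ln (2 * x + 1) / \<alpha>"
  have R: "R \<ge> 0" "exp (- (\<alpha> * R)) = 1 / (2 * x + 1)"
    using assms by (auto simp: R_def exp_minus inverse_eq_divide)
  obtain K where K: "K \<ge> 0" "\<And>\<sigma>. \<sigma> \<ge> 0 \<Longrightarrow> \<bar>rGamma (\<sigma> + \<beta>)\<bar> \<le> K * exp (- \<sigma> * R)"
    using rGamma_decay[OF R(1) assms(2)] by blast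
  show ?thesis
  proof (rule summable_comparison_test')
    show "summable (\<lambda>k. K * (1 / 2) ^ k :: real)" by (intro summable_mult summable_geometric) simp
    fix k :: nat
    have "exp (- (\<alpha> * real k) * R) = exp (- (\<alpha> * R)) ^ k"
      by (simp add: exp_of_nat_mult[symmetric] mult_ac)
    then have "x ^ k * \<bar>rGamma (\<alpha> * real k + \<beta>)\<bar> \<le> x ^ k * (K * (1 / (2 * x + 1)) ^ k)"
      using K(2)[of "\<alpha> * real k"] assms unfolding R(2) by (intro mult_left_mono) auto
    also have "\<dots> = K * (x / (2 * x + 1)) ^ k" by (simp add: power_divide)
    also have "\<dots> \<le> K * (1 / 2) ^ k"
      using assms K(1) by (intro mult_left_mono power_mono) (auto simp: field_simps)
    finally show "norm (x ^ k * \<bar>rGamma (\<alpha> * real k + \<beta>)\<bar>) \<le> K * (1 / 2) ^ k"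
      using assms by (simp add: abs_mult)
  qed
qed

lemma summable_ml:
  assumes "0 < \<alpha>" "0 \<le> \<beta>"
  shows "summable (\<lambda>k. z ^ k * complex_of_real (rGamma (\<alpha> * real k + \<beta>)))"
  by (rule summable_norm_cancel) (use summable_rGamma[OF assms, of "norm z"] in \<open>simp add: norm_mult norm_power\<close>)

text \<open>In the variable u = exp w this is the classical integrand exp(u) u^(\<alpha> - \<beta>)
  / (u^\<alpha> - z) du; \<open>hankel_fun\<close> already contains the factor u of du = u
  dw.\<close>

definition ml_kernel :: "real \<Rightarrow> real \<Rightarrow> complex \<Rightarrow> complex \<Rightarrow> complex" where
  "ml_kernel \<alpha> \<beta> z w = hankel_fun \<beta> w * exp (of_real \<alpha> * w) / (exp (of_real \<alpha> * w) - z)"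

definition vseg :: "real \<Rightarrow> real \<Rightarrow> real \<Rightarrow> complex" where
  "vseg \<theta> x = linepath (Complex x (-\<theta>)) (Complex x \<theta>)"

lemma norm_vertical_diff: "0 \<le> \<theta> \<Longrightarrow> norm (Complex x \<theta> - Complex x (-\<theta>)) = 2 * \<theta>"
proof -
  assume "0 \<le> \<theta>"
  have "Complex x \<theta> - Complex x (-\<theta>) = \<i> * of_real (2 * \<theta>)" by (simp add: complex_eq_iff)
  with \<open>0 \<le> \<theta>\<close> show ?thesis by (simp only: norm_mult norm_of_real) simp
qed

lemma norm_exp_alpha: "norm (exp (of_real \<alpha> * Complex x y)) = exp (\<alpha> * x)"
  by simp

text \<open>A finite geometric sum with ratio z exp (- \<alpha> w). The remainder is kept exact, so
  convergence is discussed only after integration.\<close>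

lemma ml_kernel_expansion:
  assumes "exp (of_real \<alpha> * w) \<noteq> z"
  shows "ml_kernel \<alpha> \<beta> z w - (\<Sum>k<n. z ^ k * hankel_fun (\<alpha> * real k + \<beta>) w) =
    (z * exp (- (of_real \<alpha> * w))) ^ n * ml_kernel \<alpha> \<beta> z w"
proof -
  define q where "q = z * exp (- (of_real \<alpha> * w))"
  have q1: "q \<noteq> 1" using assms by (auto simp: q_def exp_minus field_simps)
  have "z ^ k * hankel_fun (\<alpha> * real k + \<beta>) w = hankel_fun \<beta> w * q ^ k" for k
  proof -
    have "hankel_fun (\<alpha> * real k + \<beta>) w = hankel_fun \<beta> w * exp (- (of_real \<alpha> * w)) ^ k"
      unfolding hankel_fun_def exp_of_nat_mult[symmetric] exp_add[symmetric] by (simp add: algebra_simps)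
    then show ?thesis by (simp add: q_def power_mult_distrib)
  qed
  then have "(\<Sum>k<n. z ^ k * hankel_fun (\<alpha> * real k + \<beta>) w) = hankel_fun \<beta> w * (\<Sum>k<n. q ^ k)"
    by (simp add: sum_distrib_left)
  also have "\<dots> = hankel_fun \<beta> w * ((1 - q ^ n) / (1 - q))"
    using q1 by (simp add: sum_gp_strict)
  finally have 1: "(\<Sum>k<n. z ^ k * hankel_fun (\<alpha> * real k + \<beta>) w) = hankel_fun \<beta> w * ((1 - q ^ n) / (1 - q))" .
  have 2: "ml_kernel \<alpha> \<beta> z w = hankel_fun \<beta> w * (1 / (1 - q))"
    using assms q1 unfolding ml_kernel_def q_def exp_minus by (simp add: field_simps)
  show ?thesis unfolding 1 2 q_def[symmetric] right_diff_distrib[symmetric] diff_divide_distrib[symmetric] by simp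
qed

text \<open>Geometric series expansion of the kernel, integrated termwise; the error is the sum of the tails
  of the Hankel integrals.\<close>
lemma ml_contour_bound:
  assumes \<alpha>: "0 < \<alpha>" and \<beta>: "0 \<le> \<beta>" and \<theta>: "pi / 2 < \<theta>" "\<theta> \<le> pi" and R: "0 \<le> R"
    and z: "norm z * exp (- (\<alpha> * R)) \<le> 1 / 2"
  shows "norm (contour_integral (vseg \<theta> R) (ml_kernel \<alpha> \<beta> z) - 2 * pi * \<i> * ml \<alpha> \<beta> z)
     \<le> 4 / (- cos \<theta>) * exp (cos \<theta> * exp R)"
proof -
  let ?G = "\<lambda>k. complex_of_real (2 * pi) * \<i> * of_real (rGamma (\<alpha> * real k + \<beta>))"
  define seg where "seg = closed_segment (Complex R (-\<theta>)) (Complex R \<theta>)"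
  have seg: "Re w = R" if "w \<in> seg" for w
    using that by (auto simp: seg_def closed_segment_same_Re)
  have ne: "exp (of_real \<alpha> * w) \<noteq> z" if "w \<in> seg" for w
  proof
    assume "exp (of_real \<alpha> * w) = z"
    then have "norm z = exp (\<alpha> * R)" using seg[OF that] by (auto simp: )
    with z show False by (simp add: exp_minus)
  qed
  define f where "f = ml_kernel \<alpha> \<beta> z"
  \<comment> \<open>Bound of \<open>hankel_fun\<close> on the segment, times 2 because a ratio
    \<open>q\<close> of modulus at most 1/2 gives |1 / (1 - q)| \<le> 2.\<close>
  define B where "B = exp (exp R + (1 - \<beta>) * R) * 2"
  have q: "norm (z * exp (- (of_real \<alpha> * w))) \<le> 1 / 2" if "w \<in> seg" for w
    using z seg[OF that] by (simp add: norm_mult)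
  have fB: "norm (f w) \<le> B" if "w \<in> seg" for w
  proof -
    define q where "q = z * exp (- (of_real \<alpha> * w))"
    have nq: "norm q \<le> 1 / 2" unfolding q_def by (rule q[OF that])
    then have "q \<noteq> 1" by auto
    have "f w = hankel_fun \<beta> w * (1 / (1 - q))"
      using ne[OF that] \<open>q \<noteq> 1\<close> unfolding f_def ml_kernel_def q_def exp_minus by (simp add: field_simps)
    moreover have "norm (hankel_fun \<beta> w) \<le> exp (exp R + (1 - \<beta>) * R)"
    proof -
      have "w = Complex R (Im w)" using seg[OF that] by (simp add: complex_eq_iff)
      then obtain y where "w = Complex R y" by blast
      then show ?thesis by (simp add: norm_hankel_fun)
    qed
    moreover have "norm (1 / (1 - q)) \<le> 2"
    proof -
      have "norm (1 - q) \<ge> 1 / 2" using norm_triangle_ineq2[of 1 q] nq by simp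
      moreover have "norm (1 - q) > 0" using \<open>q \<noteq> 1\<close> by simp
      ultimately show ?thesis by (simp add: norm_divide pos_divide_le_eq)
    qed
    ultimately show ?thesis unfolding B_def by (simp only: norm_mult) (intro mult_mono, simp_all)
  qed
  have "continuous_on seg f"
    unfolding f_def ml_kernel_def hankel_fun_def using ne by (auto intro!: continuous_intros)
  then have f_int: "(f has_contour_integral contour_integral (vseg \<theta> R) f) (vseg \<theta> R)"
    unfolding vseg_def seg_def by (intro has_contour_integral_integral contour_integrable_continuous_linepath)
  have "\<exists>\<Psi>. \<forall>w. (\<Psi> has_field_derivative hankel_fun (\<alpha> * real k + \<beta>) w) (at w)" for k
    using hankel_fun_primitive by metis
  then obtain \<Psi> where \<Psi>: "\<And>k w. (\<Psi> k has_field_derivative hankel_fun (\<alpha> * real k + \<beta>) w) (at w)"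
    by metis
  define D where "D k = \<Psi> k (Complex R \<theta>) - \<Psi> k (Complex R (-\<theta>))" for k
  have D_int: "(hankel_fun (\<alpha> * real k + \<beta>) has_contour_integral D k) (vseg \<theta> R)" for k
    using contour_integral_primitive[of UNIV "\<Psi> k" "hankel_fun (\<alpha> * real k + \<beta>)" "vseg \<theta> R"] \<Psi>
    by (simp add: D_def vseg_def)
  define E where "E = exp (cos \<theta> * exp R) / (- cos \<theta>)"
  have c: "cos \<theta> < 0" using \<theta> cos_lt_zero_pi cos_monotone_0_pi[of "pi/2" \<theta>] by auto
  then have E: "E \<ge> 0" unfolding E_def by (intro divide_nonneg_pos) auto
  define S where "S n = (\<Sum>k<n. z ^ k * ?G k)" for n
  \<comment> \<open>Two errors are separated: the geometric remainder on a segment of length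
    \<open>2 * \<theta>\<close>, which vanishes as \<open>n\<close> grows, and the tails cut off at
    \<open>R\<close>, which persist but sum to at most \<open>4 * E\<close>.\<close>
  have bound: "norm (contour_integral (vseg \<theta> R) f - S n) \<le> B * (1 / 2) ^ n * (2 * \<theta>) + 4 * E" for n
  proof -
    have "((\<lambda>w. f w - (\<Sum>k<n. z ^ k * hankel_fun (\<alpha> * real k + \<beta>) w)) has_contour_integral
        (contour_integral (vseg \<theta> R) f - (\<Sum>k<n. z ^ k * D k))) (vseg \<theta> R)"
      by (intro has_contour_integral_diff f_int has_contour_integral_sum has_contour_integral_lmul D_int) auto
    then have "norm (contour_integral (vseg \<theta> R) f - (\<Sum>k<n. z ^ k * D k)) \<le>
        B * (1 / 2) ^ n * norm (Complex R \<theta> - Complex R (-\<theta>))"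
      unfolding vseg_def
    proof (rule has_contour_integral_bound_linepath)
      show "0 \<le> B * (1 / 2) ^ n" by (simp add: B_def)
      fix w assume "w \<in> closed_segment (Complex R (- \<theta>)) (Complex R \<theta>)"
      then have w: "w \<in> seg" by (simp add: seg_def)
      show "norm (f w - (\<Sum>k<n. z ^ k * hankel_fun (\<alpha> * real k + \<beta>) w)) \<le> B * (1 / 2) ^ n"
        using mult_mono[OF power_mono[OF q[OF w], of n] fB[OF w]]
        unfolding f_def ml_kernel_expansion[OF ne[OF w]] norm_mult norm_power by (simp add: mult.commute)
    qed
    moreover have "norm (Complex R \<theta> - Complex R (-\<theta>)) = 2 * \<theta>"
      using \<theta> pi_gt_zero by (intro norm_vertical_diff) linarith
    moreover have "norm ((\<Sum>k<n. z ^ k * D k) - S n) \<le> 4 * E"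
    proof -
      have "norm ((\<Sum>k<n. z ^ k * D k) - S n) \<le> (\<Sum>k<n. (1 / 2) ^ k * (2 * E))"
        unfolding S_def sum_subtractf[symmetric]
      proof (rule sum_norm_le)
        fix k
        have "norm (D k - ?G k) \<le> 2 * E * exp (- (\<alpha> * R)) ^ k"
        proof -
          have "exp (- (\<alpha> * R)) ^ k = exp (- (\<alpha> * real k) * R)"
            by (simp add: exp_of_nat_mult[symmetric] mult_ac)
          then show ?thesis
            using hankel_tail[OF \<Psi>[of k] _ \<beta> \<theta> R] \<alpha> by (simp add: D_def E_def mult_ac)
        qed
        then have "norm z ^ k * norm (D k - ?G k)
            \<le> norm z ^ k * (2 * E * exp (- (\<alpha> * R)) ^ k)" by (intro mult_left_mono) auto
        also have "\<dots> = (norm z * exp (- (\<alpha> * R))) ^ k * (2 * E)" by (simp add: power_mult_distrib)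
        also have "\<dots> \<le> (1 / 2) ^ k * (2 * E)"
          using z E by (intro mult_right_mono power_mono) auto
        finally show "norm (z ^ k * D k - z ^ k * ?G k) \<le> (1 / 2) ^ k * (2 * E)"
          unfolding right_diff_distrib[symmetric] norm_mult norm_power .
      qed
      also have "\<dots> = (\<Sum>k<n. (1 / 2) ^ k) * (2 * E)" by (simp add: sum_distrib_right)
      also have "(\<Sum>k<n. (1 / 2) ^ k) \<le> (2 :: real)" by (simp add: sum_gp_strict)
      finally show ?thesis using E by (simp add: mult_right_mono)
    qed
    ultimately show ?thesis
      using norm_triangle_ineq[of "contour_integral (vseg \<theta> R) f - (\<Sum>k<n. z ^ k * D k)" "(\<Sum>k<n. z ^ k * D k) - S n"]
      by simp
  qed
  have "S \<longlonglongrightarrow> 2 * pi * \<i> * ml \<alpha> \<beta> z"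
  proof -
    have "(\<lambda>n. 2 * pi * \<i> * (\<Sum>k<n. z ^ k * of_real (rGamma (\<alpha> * real k + \<beta>)))) \<longlonglongrightarrow> 2 * pi * \<i> * ml \<alpha> \<beta> z"
      unfolding ml_def by (intro tendsto_intros summable_LIMSEQ summable_ml \<alpha> \<beta>)
    moreover have "S = (\<lambda>n. 2 * pi * \<i> * (\<Sum>k<n. z ^ k * of_real (rGamma (\<alpha> * real k + \<beta>))))"
      unfolding S_def sum_distrib_left by (intro ext sum.cong refl) (simp only: mult_ac)
    ultimately show ?thesis by simp
  qed
  then have "(\<lambda>n. norm (contour_integral (vseg \<theta> R) f - S n)) \<longlonglongrightarrow> norm (contour_integral (vseg \<theta> R) f - 2 * pi * \<i> * ml \<alpha> \<beta> z)"
    by (intro tendsto_intros)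
  moreover have "(\<lambda>n. B * (1 / 2) ^ n * (2 * \<theta>) + 4 * E) \<longlonglongrightarrow> B * 0 * (2 * \<theta>) + 4 * E"
    by (intro tendsto_intros LIMSEQ_power_zero) simp
  ultimately have "norm (contour_integral (vseg \<theta> R) f - 2 * pi * \<i> * ml \<alpha> \<beta> z) \<le> B * 0 * (2 * \<theta>) + 4 * E"
    by (rule LIMSEQ_le) (use bound in auto)
  then show ?thesis by (simp add: f_def E_def)
qed

text \<open>The point \<open>p\<close> may be a removable singularity or a point of holomorphy, with
  residue 0. One formula thus serves the case with a pole in the strip and the case without.\<close>

lemma rectangle_residue:
  assumes "a < b" "0 < \<theta>" and S: "open S" "convex S" "cbox (Complex a (-\<theta>)) (Complex b \<theta>) \<subseteq> S"
    and f: "f holomorphic_on S - {p}" and p: "p \<in> box (Complex a (-\<theta>)) (Complex b \<theta>)"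
  shows "contour_integral (vseg \<theta> b) f - contour_integral (vseg \<theta> a) f - 2 * pi * \<i> * residue f p =
    contour_integral (linepath (Complex a \<theta>) (Complex b \<theta>)) f -
    contour_integral (linepath (Complex a (-\<theta>)) (Complex b (-\<theta>))) f"
proof -
  let ?p = "Complex a (-\<theta>)" and ?q = "Complex b (-\<theta>)" and ?r = "Complex b \<theta>" and ?s = "Complex a \<theta>"
  define R where "R = rectpath ?p ?r"
  have path: "path_image R \<subseteq> S - {p}"
    using path_image_rectpath_cbox_minus_box[of ?p ?r] assms by (auto simp: R_def)
  have "contour_integral R f = 2 * pi * \<i> * (\<Sum>q\<in>{p}. winding_number R q * residue f q)"
  proof (rule Residue_theorem[of S])
    show "connected S" using S by (simp add: convex_connected)
    show "\<forall>z. z \<notin> S \<longrightarrow> winding_number R z = 0"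
      unfolding R_def using assms by (auto intro!: winding_number_rectpath_outside)
  qed (use S f path in \<open>auto simp: R_def\<close>)
  moreover have "winding_number R p = 1" unfolding R_def by (rule winding_number_rectpath[OF p])
  moreover have "contour_integral R f = contour_integral (linepath ?p ?q) f
      + (contour_integral (vseg \<theta> b) f + (- contour_integral (linepath ?s ?r) f
      + - contour_integral (vseg \<theta> a) f))"
  proof -
    have cont: "continuous_on (path_image R) f"
      using holomorphic_on_imp_continuous_on[OF f] path continuous_on_subset by blast
    have im: "path_image R = closed_segment ?p ?q \<union> closed_segment ?q ?r
        \<union> closed_segment ?r ?s \<union> closed_segment ?s ?p"
      unfolding R_def rectpath_def Let_def by (simp add: path_image_join Un_assoc)
    have c: "continuous_on (closed_segment ?p ?q) f"
      "continuous_on (closed_segment ?q ?r) f"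
      "continuous_on (closed_segment ?r ?s) f"
      "continuous_on (closed_segment ?s ?p) f"
      using cont unfolding im by (auto elim!: continuous_on_subset)
    have i: "f contour_integrable_on linepath ?p ?q"
      "f contour_integrable_on linepath ?q ?r"
      "f contour_integrable_on linepath ?r ?s"
      "f contour_integrable_on linepath ?s ?p"
      by (intro contour_integrable_continuous_linepath c)+
    show ?thesis
      unfolding R_def rectpath_def Let_def vseg_def
      using i contour_integral_reverse_linepath[OF c(3)] contour_integral_reverse_linepath[OF c(4)]
      by (simp add: contour_integrable_join)
  qed
  ultimately show ?thesis by (simp add: algebra_simps)
qed

text \<open>The majorant comes with a primitive, so the estimate involves only an increment of
  \<open>G\<close> and can stay uniform while both ends of the segment move to infinity.\<close>

lemma horizontal_contour_bound:
  assumes "a < b" and cont: "continuous_on (closed_segment (Complex a y) (Complex b y)) f"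
    and G: "\<And>x. (G has_real_derivative g x) (at x)"
    and le: "\<And>x. norm (f (Complex x y)) \<le> g x"
  shows "norm (contour_integral (linepath (Complex a y) (Complex b y)) f) \<le> G b - G a"
proof -
  define I where "I = contour_integral (linepath (Complex a y) (Complex b y)) f"
  have "(f has_contour_integral I) (linepath (Complex a y) (Complex b y))"
    unfolding I_def by (intro has_contour_integral_integral contour_integrable_continuous_linepath cont)
  then have I: "((\<lambda>t. f (Complex (a + t * (b - a)) y) * of_real (b - a)) has_integral I) {0..1}"
  proof -
    have "linepath (Complex a y) (Complex b y) t = Complex (a + t * (b - a)) y" for t
      by (simp add: linepath_def complex_eq_iff algebra_simps)
    moreover have "Complex b y - Complex a y = of_real (b - a)" by (simp add: complex_eq_iff)
    moreover assume "(f has_contour_integral I) (linepath (Complex a y) (Complex b y))"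
    ultimately show ?thesis unfolding has_contour_integral_linepath by simp
  qed
  have J: "((\<lambda>t. g (a + t * (b - a)) * (b - a)) has_integral (G (a + 1 * (b - a)) - G (a + 0 * (b - a)))) {0..1}"
  proof (rule fundamental_theorem_of_calculus)
    fix t :: real
    have "((\<lambda>t. G (a + t * (b - a))) has_real_derivative g (a + t * (b - a)) * (b - a)) (at t within {0..1})"
      by (rule DERIV_chain2[OF G]) (auto intro!: derivative_eq_intros)
    then show "((\<lambda>t. G (a + t * (b - a))) has_vector_derivative g (a + t * (b - a)) * (b - a)) (at t within {0..1})"
      by (simp add: has_real_derivative_iff_has_vector_derivative)
  qed simp
  have "norm (integral {0..1} (\<lambda>t. f (Complex (a + t * (b - a)) y) * of_real (b - a))) \<le> integral {0..1} (\<lambda>t. g (a + t * (b - a)) * (b - a))"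
  proof (rule integral_norm_bound_integral[OF has_integral_integrable[OF I] has_integral_integrable[OF J]])
    fix t :: real
    show "norm (f (Complex (a + t * (b - a)) y) * of_real (b - a)) \<le> g (a + t * (b - a)) * (b - a)"
      using \<open>a < b\<close> mult_right_mono[OF le, of "b - a" "a + t * (b - a)"] unfolding norm_mult norm_of_real by simp
  qed
  then show ?thesis unfolding integral_unique[OF I] integral_unique[OF J] by (simp add: I_def)
qed

text \<open>The function decays doubly exponentially on the right but only like exp (p x) on the
  left. It is dominated by a multiple of the derivative of a logistic function, whose increments are
  bounded.\<close>

lemma double_exponential_majorant:
  fixes c p :: real
  assumes "c > 0" "p > 0"
  obtains G g :: "real \<Rightarrow> real" and K where
    "\<And>x. (G has_real_derivative g x) (at x)"
    "\<And>x. exp (p * x - c * exp x) \<le> g x"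
    "\<And>a b. G b - G a \<le> K"
proof -
  \<comment> \<open>The maximum of \<open>2 * p * x - c * exp x\<close>, attained at
    \<open>exp x = 2 * p / c\<close>; the bound is 1 + y \<le> exp y in disguise.\<close>
  define M where "M = - 2 * p * (1 + ln (c / (2 * p)))"
  have M: "2 * p * x - c * exp x \<le> M" for x
  proof -
    have "2 * p * (1 + (x + ln (c / (2 * p)))) \<le> 2 * p * exp (x + ln (c / (2 * p)))"
      using assms exp_ge_add_one_self[of "x + ln (c / (2 * p))"] by (intro mult_left_mono) auto
    also have "\<dots> = c * exp x" using assms by (simp add: exp_add)
    finally show ?thesis by (simp add: M_def algebra_simps)
  qed
  \<comment> \<open>Bounds \<open>exp (- c * exp x) * (1 + exp (p * x))\<^sup>2\<close>, by (1 +
    X)^2 \<le> 2 + 2 X^2 and the maximum \<open>M\<close>.\<close>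
  define L where "L = 2 + 2 * exp M"
  define K where "K = L / p"
  define G where "G x = - K / (1 + exp (p * x))" for x
  define g where "g x = L * exp (p * x) / (1 + exp (p * x))\<^sup>2" for x
  have L: "L > 0" by (simp add: L_def add_pos_pos)
  show ?thesis
  proof
    fix x
    have "1 + exp (p * x) \<noteq> 0" using exp_gt_zero[of "p * x"] by linarith
    then show "(G has_real_derivative g x) (at x)"
      unfolding G_def g_def K_def using assms
      by (auto intro!: derivative_eq_intros simp: power2_eq_square)
    have "(1 + exp (p * x))\<^sup>2 \<le> 2 + 2 * (exp (p * x))\<^sup>2"
      using sum_squares_bound[of 1 "exp (p * x)"] by (simp add: power2_eq_square algebra_simps)
    then have "exp (- c * exp x) * (1 + exp (p * x))\<^sup>2 \<le> exp (- c * exp x) * (2 + 2 * (exp (p * x))\<^sup>2)"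
      by (intro mult_left_mono) auto
    also have "\<dots> = 2 * exp (- c * exp x) + 2 * exp (2 * p * x - c * exp x)"
      by (simp add: power2_eq_square exp_add[symmetric] algebra_simps)
    also have "\<dots> \<le> L"
      unfolding L_def using M[of x] assms by (intro add_mono) auto
    finally have "exp (- c * exp x) * (1 + exp (p * x))\<^sup>2 \<le> L" .
    then have "exp (- c * exp x) \<le> L / (1 + exp (p * x))\<^sup>2"
      using \<open>1 + exp (p * x) \<noteq> 0\<close> by (simp add: pos_le_divide_eq)
    from mult_left_mono[OF this, of "exp (p * x)"] show "exp (p * x - c * exp x) \<le> g x"
      unfolding g_def by (simp add: exp_diff exp_minus field_simps)
  next
    fix a b
    have K: "K > 0" using L assms by (simp add: K_def)
    have "K / (1 + exp (p * a)) \<le> K / 1" using K by (intro divide_left_mono) (auto simp: add_pos_pos)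
    moreover have "K / (1 + exp (p * b)) \<ge> 0" using K by (simp add: add_pos_pos)
    ultimately show "G b - G a \<le> K" by (simp add: G_def)
  qed
qed

lemma dist_nonneg_ray:
  assumes "\<And>\<rho>. \<rho> \<ge> 0 \<Longrightarrow> v \<noteq> complex_of_real \<rho>"
  obtains c where "c > 0" "\<And>\<rho>. \<rho> \<ge> 0 \<Longrightarrow> c \<le> norm (of_real \<rho> - v)"
proof (cases "Im v = 0")
  case False
  show ?thesis
  proof (rule that[of "\<bar>Im v\<bar>"])
    fix \<rho> :: real
    show "\<bar>Im v\<bar> \<le> norm (of_real \<rho> - v)" using abs_Im_le_cmod[of "of_real \<rho> - v"] by simp
  qed (use False in simp)
next
  case True
  then have "v = of_real (Re v)" by (simp add: complex_eq_iff)
  with assms[of "Re v"] have "Re v < 0" by (metis not_less)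
  show ?thesis
  proof (rule that[of "- Re v"])
    fix \<rho> :: real assume "\<rho> \<ge> 0"
    then show "- Re v \<le> norm (of_real \<rho> - v)" using abs_Re_le_cmod[of "of_real \<rho> - v"] \<open>Re v < 0\<close> by simp
  qed (use \<open>Re v < 0\<close> in simp)
qed

text \<open>On the line Im w = \<psi> / \<alpha> the function exp (\<alpha> w) runs through the ray
  of argument \<psi>. A point off the ray has positive distance to it, and multiplying the point by
  \<open>r > 0\<close> scales this distance by \<open>r\<close>; this is the source of the 1/r in
  the asymptotics.\<close>

lemma dist_ray_Arg:
  assumes "l \<noteq> 0" "Arg l \<noteq> \<psi>" "\<bar>\<psi>\<bar> < pi"
  obtains c where "c > 0" "\<And>\<rho>. \<rho> \<ge> 0 \<Longrightarrow> c \<le> norm (of_real \<rho> * cis \<psi> - l)"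
proof -
  have "l * cis (-\<psi>) \<noteq> of_real \<rho>" if "\<rho> \<ge> 0" for \<rho>
  proof
    assume *: "l * cis (-\<psi>) = of_real \<rho>"
    have "l = l * (cis (-\<psi>) * cis \<psi>)" by (simp add: cis_mult)
    also have "\<dots> = of_real \<rho> * cis \<psi>" by (simp only: mult.assoc[symmetric] *)
    finally have l: "l = of_real \<rho> * exp (\<i> * of_real \<psi>)" by (simp add: cis_conv_exp)
    with assms(1) that have "\<rho> > 0" by (cases "\<rho> = 0") auto
    then have "Arg l = \<psi>"
      using l assms(3) by (intro Arg_unique[of \<rho>]) (auto simp: abs_less_iff)
    with assms(2) show False by contradiction
  qed
  then obtain c where c: "c > 0" "\<And>\<rho>. \<rho> \<ge> 0 \<Longrightarrow> c \<le> norm (of_real \<rho> - l * cis (-\<psi>))"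
    using dist_nonneg_ray by blast
  have "norm (of_real \<rho> - l * cis (-\<psi>)) = norm (of_real \<rho> * cis \<psi> - l)" for \<rho>
  proof -
    have "norm (of_real \<rho> - l * cis (-\<psi>)) = norm ((of_real \<rho> - l * cis (-\<psi>)) * cis \<psi>)" by (simp add: norm_mult)
    also have "(of_real \<rho> - l * cis (-\<psi>)) * cis \<psi> = of_real \<rho> * cis \<psi> - l * (cis (-\<psi>) * cis \<psi>)"
      by (simp only: left_diff_distrib mult.assoc)
    finally show ?thesis by (simp add: cis_mult)
  qed
  with c that show ?thesis by metis
qed


text \<open>The integral over the vertical segment at \<open>Re w = x\<close> tends to \<open>2\<pi>i E\<^sub>\<alpha>\<^sub>,\<^sub>\<beta>(z)\<close> as \<open>x \<rightarrow> \<infinity>\<close> and to \<open>0\<close> as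
  \<open>x \<rightarrow> -\<infinity>\<close>. The horizontal sides stay away from the pole, hence are \<open>O(1/r)\<close>.\<close>
lemma ml_asymptotic:
  fixes a :: complex
  assumes \<alpha>: "0 < \<alpha>" "\<alpha> < 1" and \<beta>: "0 \<le> \<beta>" "\<beta> \<le> 1" and a: "a \<noteq> 0"
    and \<theta>: "pi / 2 < \<theta>" "\<theta> \<le> pi" and Arg: "\<bar>Arg a\<bar> \<noteq> \<alpha> * \<theta>"
  obtains C where "\<And>r. r > 0 \<Longrightarrow>
    norm (ml \<alpha> \<beta> (a * of_real r) -
      (if \<bar>Arg a\<bar> < \<alpha> * \<theta> then hankel_fun \<beta> ((Ln a + of_real (ln r)) / of_real \<alpha>) / of_real \<alpha> else 0)) \<le> C / r"
proof -
  have \<theta>0: "\<theta> > 0" using \<theta> pi_gt_zero by linarith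
  have "\<alpha> * \<theta> < 1 * \<theta>" by (rule mult_strict_right_mono[OF \<alpha>(2) \<theta>0])
  then have \<alpha>\<theta>: "\<alpha> * \<theta> < pi" "\<alpha> * \<theta> > 0" using \<theta> mult_pos_pos[OF \<alpha>(1) \<theta>0] by linarith+
  have ne: "Arg a \<noteq> \<alpha> * \<theta>" "Arg a \<noteq> - (\<alpha> * \<theta>)" "\<bar>\<alpha> * \<theta>\<bar> < pi" "\<bar>- (\<alpha> * \<theta>)\<bar> < pi"
    using Arg \<alpha>\<theta> by linarith+
  obtain c1 where c1: "c1 > 0" "\<And>\<rho>. \<rho> \<ge> 0 \<Longrightarrow> c1 \<le> norm (of_real \<rho> * cis (\<alpha> * \<theta>) - a)"
    using dist_ray_Arg[OF a ne(1,3)] by blast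
  obtain c2 where c2: "c2 > 0" "\<And>\<rho>. \<rho> \<ge> 0 \<Longrightarrow> c2 \<le> norm (of_real \<rho> * cis (- (\<alpha> * \<theta>)) - a)"
    using dist_ray_Arg[OF a ne(2,4)] by blast
  define c0 where "c0 = min c1 c2"
  have c0: "c0 > 0" using c1 c2 by (simp add: c0_def)
  define c where "c = - cos \<theta>"
  have c: "c > 0" unfolding c_def using \<theta> cos_lt_zero_pi cos_monotone_0_pi[of "pi/2" \<theta>] by auto
  \<comment> \<open>Exponential growth rate of the numerator of the kernel; on the horizontal lines
    it is multiplied by \<open>exp (- c * exp x)\<close>.\<close>
  define p where "p = 1 - \<beta> + \<alpha>"
  have p: "p > 0" using \<alpha> \<beta> by (simp add: p_def)
  obtain G g K where G: "\<And>x. (G has_real_derivative g x) (at x)"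
    and g: "\<And>x. exp (p * x - c * exp x) \<le> g x" and K: "\<And>a b. G b - G a \<le> K"
    using double_exponential_majorant[OF c p] by blast
  \<comment> \<open>Half-width of a larger open strip. Since
    \<open>\<alpha> * \<theta>' \<le> pi\<close>, the logarithm inverts the exponential there and
    \<open>w0\<close> is the only candidate for a root. Without a pole inside, the strip ends
    exactly at the height of \<open>w0\<close> and so excludes it.\<close>
  define \<theta>' where "\<theta>' = (if \<bar>Arg a\<bar> < \<alpha> * \<theta> then pi / \<alpha> else \<bar>Arg a\<bar> / \<alpha>)"
  have Arg_le: "\<bar>Arg a\<bar> \<le> pi" using Arg_bounded[of a] by linarith
  have \<theta>': "\<theta> < \<theta>'" "\<alpha> * \<theta>' \<le> pi"
    using \<alpha> \<alpha>\<theta> Arg Arg_le by (auto simp: \<theta>'_def pos_less_divide_eq mult.commute)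
  define S where "S = {w. - \<theta>' < Im w} \<inter> {w. Im w < \<theta>'}"
  have S: "open S" "convex S"
    unfolding S_def by (auto intro!: open_Int open_halfspace_Im_gt open_halfspace_Im_lt convex_Int
        convex_halfspace_Im_gt convex_halfspace_Im_lt)
  show ?thesis
  proof (rule that[of "K / c0"])
    fix r :: real assume r: "r > 0"
    define z where "z = a * of_real r"
    define w0 where "w0 = (Ln a + of_real (ln r)) / of_real \<alpha>"
    have z: "z \<noteq> 0" "Ln z = Ln a + of_real (ln r)"
      using a r Ln_times_of_real[OF r a] by (simp_all add: z_def mult.commute[of a] Ln_of_real)
    have w0_Im: "Im w0 = Arg a / \<alpha>"
      using a by (simp add: w0_def Arg_eq_Im_Ln Im_divide_of_real)
    have \<alpha>w0: "of_real \<alpha> * w0 = Ln z" using \<alpha> by (simp add: w0_def z)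
    have root: "w = w0" if "w \<in> S" "exp (of_real \<alpha> * w) = z" for w
    proof -
      have "\<alpha> * Im w < \<alpha> * \<theta>'" "\<alpha> * (- \<theta>') < \<alpha> * Im w"
        using that \<alpha> unfolding S_def by (intro mult_strict_left_mono; simp)+
      then have "Ln (exp (of_real \<alpha> * w)) = of_real \<alpha> * w"
        using \<theta>'(2) by (intro Ln_exp) auto
      with that(2) have "of_real \<alpha> * w = of_real \<alpha> * w0" by (simp add: \<alpha>w0)
      then show ?thesis using \<alpha> by simp
    qed
    define f where "f = ml_kernel \<alpha> \<beta> z"
    \<comment> \<open>If there is no pole, 0 serves as a marked point with residue 0, so that both
      cases share the argument below.\<close>
    define q where "q = (if \<bar>Arg a\<bar> < \<alpha> * \<theta> then w0 else 0)"
    have q_Im: "\<bar>Im q\<bar> < \<theta>"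
      using \<alpha> \<theta>0 by (simp add: q_def w0_Im abs_divide pos_divide_less_eq mult.commute)
    have not_root: "w0 \<notin> S" if "\<not> \<bar>Arg a\<bar> < \<alpha> * \<theta>"
    proof -
      have "\<theta>' = \<bar>Im w0\<bar>" using that \<alpha> by (simp add: w0_Im \<theta>'_def)
      then show ?thesis by (simp add: S_def)
    qed
    have f_hol: "f holomorphic_on S - {q}"
      unfolding f_def ml_kernel_def
    proof (intro holomorphic_intros hankel_fun_holomorphic)
      fix w assume "w \<in> S - {q}"
      then show "exp (of_real \<alpha> * w) - z \<noteq> 0" using root[of w] not_root by (auto simp: q_def split: if_splits)
    qed
    have residue: "residue f q = (if \<bar>Arg a\<bar> < \<alpha> * \<theta> then hankel_fun \<beta> w0 / of_real \<alpha> else 0)"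
    proof (cases "\<bar>Arg a\<bar> < \<alpha> * \<theta>")
      case True
      have "residue (\<lambda>w. (hankel_fun \<beta> w * exp (of_real \<alpha> * w)) / (exp (of_real \<alpha> * w) - z)) w0 =
          (hankel_fun \<beta> w0 * exp (of_real \<alpha> * w0)) / (of_real \<alpha> * exp (of_real \<alpha> * w0))"
        by (rule residue_simple_pole_deriv[of _ UNIV])
          (use z(1) \<alpha> in \<open>auto intro!: holomorphic_intros hankel_fun_holomorphic derivative_eq_intros simp: \<alpha>w0 hankel_fun_def\<close>)
      then show ?thesis using True by (simp add: f_def ml_kernel_def[abs_def] q_def)
    next
      case False
      have "f holomorphic_on S"
        unfolding f_def ml_kernel_def
      proof (intro holomorphic_intros hankel_fun_holomorphic)
        fix w assume "w \<in> S"
        then show "exp (of_real \<alpha> * w) - z \<noteq> 0" using root[of w] not_root[OF False] by auto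
      qed
      moreover have "q \<in> S" using False \<theta>0 \<theta>' by (auto simp: q_def S_def)
      ultimately show ?thesis using residue_holo[OF S(1)] False by simp
    qed
    define V where "V x = contour_integral (vseg \<theta> x) f" for x
    \<comment> \<open>By homogeneity the denominator is at least \<open>c0 * r\<close> on both
      horizontal lines; the sign \<open>s\<close> selects the upper or the lower one.\<close>
    have side: "norm (f (Complex x (\<theta> * s))) \<le> g x / (c0 * r)" if s: "s = 1 \<or> s = -1" for x s
    proof -
      have "c0 * r \<le> norm (exp (of_real \<alpha> * Complex x (\<theta> * s)) - z)"
      proof -
        define \<rho> where "\<rho> = exp (\<alpha> * x) / r"
        have "exp (of_real \<alpha> * Complex x (\<theta> * s)) - z = of_real r * (of_real \<rho> * cis (\<alpha> * \<theta> * s) - a)"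
        proof -
          have "exp (of_real \<alpha> * Complex x (\<theta> * s)) = of_real (exp (\<alpha> * x)) * cis (\<alpha> * \<theta> * s)"
            by (simp add: exp_eq_polar mult.assoc)
          also have "exp (\<alpha> * x) = r * \<rho>" using r by (simp add: \<rho>_def)
          finally show ?thesis by (simp add: z_def algebra_simps)
        qed
        moreover have "c0 \<le> norm (of_real \<rho> * cis (\<alpha> * \<theta> * s) - a)"
          using c1(2)[of \<rho>] c2(2)[of \<rho>] r s by (auto simp: c0_def \<rho>_def)
        ultimately show ?thesis using r by (simp add: norm_mult mult.commute)
      qed
      moreover have "norm (hankel_fun \<beta> (Complex x (\<theta> * s)) * exp (of_real \<alpha> * Complex x (\<theta> * s))) \<le> g x"
      proof -
        have "cos (\<theta> * s) = - c" using s by (auto simp: c_def)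
        then have "norm (hankel_fun \<beta> (Complex x (\<theta> * s)) * exp (of_real \<alpha> * Complex x (\<theta> * s))) = exp (p * x - c * exp x)"
          unfolding norm_mult norm_hankel_fun norm_exp_alpha exp_add[symmetric] by (simp add: p_def algebra_simps)
        then show ?thesis using g by simp
      qed
      ultimately show ?thesis
        unfolding f_def ml_kernel_def norm_divide using c0 r
        by (intro frac_le) (auto intro: order_trans[OF norm_ge_zero])
    qed
    have main: "norm (V y - V x - 2 * pi * \<i> * residue f q) \<le> 2 * K / (c0 * r)" if xy: "x < Re q" "Re q < y" for x y
    proof -
      let ?hseg = "\<lambda>h. linepath (Complex x h) (Complex y h)"
      have cb: "cbox (Complex x (-\<theta>)) (Complex y \<theta>) \<subseteq> S"
        using \<theta>' by (auto simp: in_cbox_complex_iff S_def)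
      have "V y - V x - 2 * pi * \<i> * residue f q =
          contour_integral (?hseg \<theta>) f - contour_integral (?hseg (-\<theta>)) f"
        unfolding V_def
        by (rule rectangle_residue[OF _ \<theta>0 S cb f_hol]) (use xy q_Im in \<open>auto simp: in_box_complex_iff\<close>)
      moreover have "norm (contour_integral (?hseg (\<theta> * s)) f) \<le> K / (c0 * r)"
        if s: "s = 1 \<or> s = -1" for s
      proof -
        have "norm (contour_integral (?hseg (\<theta> * s)) f) \<le> G y / (c0 * r) - G x / (c0 * r)"
        proof (rule horizontal_contour_bound)
          show "continuous_on (closed_segment (Complex x (\<theta> * s)) (Complex y (\<theta> * s))) f"
          proof (rule continuous_on_subset[OF holomorphic_on_imp_continuous_on[OF f_hol]], rule subsetI)
            fix w assume "w \<in> closed_segment (Complex x (\<theta> * s)) (Complex y (\<theta> * s))"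
            then have "Im w = \<theta> * s" by (auto simp: closed_segment_same_Im)
            then show "w \<in> S - {q}" using s \<theta>' q_Im \<theta>0 by (auto simp: S_def)
          qed
          show "((\<lambda>x. G x / (c0 * r)) has_real_derivative g x / (c0 * r)) (at x)" for x
            by (rule DERIV_cdivide[OF G])
        qed (use xy side[OF s] in auto)
        also have "\<dots> = (G y - G x) / (c0 * r)" by (simp add: diff_divide_distrib)
        also have "\<dots> \<le> K / (c0 * r)" using K c0 r by (intro divide_right_mono) auto
        finally show ?thesis .
      qed
      from this[of 1] this[of "-1"] have "norm (contour_integral (?hseg \<theta>) f) \<le> K / (c0 * r)"
        "norm (contour_integral (?hseg (-\<theta>)) f) \<le> K / (c0 * r)" by auto
      ultimately show ?thesis
        using norm_triangle_ineq4[of "contour_integral (?hseg \<theta>) f" "contour_integral (?hseg (-\<theta>)) f"]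
        by simp
    qed
    have exp_lim: "((\<lambda>x. exp (- (\<alpha> * x))) \<longlongrightarrow> 0) at_top"
      using \<alpha>(1) by real_asymp
    have right: "(V \<longlongrightarrow> 2 * pi * \<i> * ml \<alpha> \<beta> z) at_top"
    proof (rule LIM_zero_cancel, rule Lim_null_comparison)
      have "((\<lambda>x. norm z * exp (- (\<alpha> * x))) \<longlongrightarrow> 0) at_top"
        by (rule tendsto_mult_right_zero[OF exp_lim])
      then have "\<forall>\<^sub>F x in at_top. norm z * exp (- (\<alpha> * x)) < 1 / 2"
        by (rule order_tendstoD) simp
      then show "\<forall>\<^sub>F x in at_top. norm (V x - 2 * pi * \<i> * ml \<alpha> \<beta> z) \<le> 4 / c * exp (- c * exp x)"
        using eventually_ge_at_top[of 0]
      proof eventually_elim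
        case (elim x)
        then show ?case using ml_contour_bound[OF \<alpha>(1) \<beta>(1) \<theta>, of x z] by (simp add: V_def f_def c_def)
      qed
      show "((\<lambda>x. 4 / c * exp (- c * exp x)) \<longlongrightarrow> 0) at_top" using c by real_asymp
    qed
    \<comment> \<open>Far to the left exp (\<alpha> w) is small against \<open>z\<close>: the
      denominator is at least \<open>norm z / 2\<close>, while the numerator carries the factor
      \<open>exp (- (\<alpha> * x))\<close>.\<close>
    have left: "((\<lambda>x. V (- x)) \<longlongrightarrow> 0) at_top"
    proof (rule Lim_null_comparison)
      have "\<forall>\<^sub>F x in at_top. exp (- (\<alpha> * x)) < norm z / 2"
        by (rule order_tendstoD[OF exp_lim]) (use z in simp)
      then show "\<forall>\<^sub>F x in at_top. norm (V (- x)) \<le> (2 * exp 1 / norm z) * exp (- (\<alpha> * x)) * (2 * \<theta>)"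
        using eventually_ge_at_top[of 0]
      proof eventually_elim
        case (elim x)
        define sg where "sg = closed_segment (Complex (-x) (-\<theta>)) (Complex (-x) \<theta>)"
        have sg: "norm (exp (of_real \<alpha> * w)) = exp (- (\<alpha> * x))" "norm (hankel_fun \<beta> w) \<le> exp 1"
          "norm z / 2 \<le> norm (exp (of_real \<alpha> * w) - z)" if "w \<in> sg" for w
        proof -
          have w: "w = Complex (-x) (Im w)" using that by (auto simp: sg_def closed_segment_same_Re complex_eq_iff)
          show 1: "norm (exp (of_real \<alpha> * w)) = exp (- (\<alpha> * x))" by (subst w) simp
          then show "norm z / 2 \<le> norm (exp (of_real \<alpha> * w) - z)"
            using elim norm_triangle_ineq2[of z "exp (of_real \<alpha> * w)"] by (simp add: norm_minus_commute)
          have "exp (- x) * cos (Im w) \<le> exp (- x) * 1" by (intro mult_left_mono) simp_all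
          also have "\<dots> \<le> 1" using elim by simp
          finally have "exp (- x) * cos (Im w) \<le> 1" .
          moreover have "(1 - \<beta>) * - x \<le> 0" using elim \<beta> by (intro mult_nonneg_nonpos) auto
          ultimately show "norm (hankel_fun \<beta> w) \<le> exp 1" by (subst w, subst norm_hankel_fun) simp
        qed
        have "exp (of_real \<alpha> * w) \<noteq> z" if "w \<in> sg" for w
          using sg(3)[OF that] z(1) by auto
        then have "continuous_on sg f"
          unfolding f_def ml_kernel_def hankel_fun_def by (auto intro!: continuous_intros)
        then have "(f has_contour_integral V (-x)) (vseg \<theta> (-x))"
          unfolding V_def vseg_def sg_def by (intro has_contour_integral_integral contour_integrable_continuous_linepath)
        then have "norm (V (-x)) \<le> ((2 * exp 1 / norm z) * exp (- (\<alpha> * x))) * norm (Complex (-x) \<theta> - Complex (-x) (-\<theta>))"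
          unfolding vseg_def
        proof (rule has_contour_integral_bound_linepath)
          fix w assume "w \<in> closed_segment (Complex (-x) (-\<theta>)) (Complex (-x) \<theta>)"
          then have w: "w \<in> sg" by (simp add: sg_def)
          have "norm (f w) \<le> (exp 1 * exp (- (\<alpha> * x))) / (norm z / 2)"
            unfolding f_def ml_kernel_def norm_divide norm_mult sg(1)[OF w]
            using sg(2,3)[OF w] z(1) by (intro frac_le mult_right_mono mult_nonneg_nonneg) simp_all
          then show "norm (f w) \<le> (2 * exp 1 / norm z) * exp (- (\<alpha> * x))" by (simp add: mult_ac)
        qed simp
        then show ?case using \<theta>0 by (simp only: norm_vertical_diff order_less_imp_le)
      qed
      show "((\<lambda>x. (2 * exp 1 / norm z) * exp (- (\<alpha> * x)) * (2 * \<theta>)) \<longlongrightarrow> 0) at_top"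
        by (intro tendsto_mult_left_zero tendsto_mult_right_zero exp_lim)
    qed
    have "((\<lambda>x. norm (V x - V (-x) - 2 * pi * \<i> * residue f q)) \<longlongrightarrow>
        norm (2 * pi * \<i> * ml \<alpha> \<beta> z - 0 - 2 * pi * \<i> * residue f q)) at_top"
      by (intro tendsto_intros right left)
    then have "norm (2 * pi * \<i> * ml \<alpha> \<beta> z - 0 - 2 * pi * \<i> * residue f q) \<le> 2 * K / (c0 * r)"
    proof (rule tendsto_upperbound)
      show "\<forall>\<^sub>F x in at_top. norm (V x - V (-x) - 2 * pi * \<i> * residue f q) \<le> 2 * K / (c0 * r)"
        using eventually_gt_at_top[of "\<bar>Re q\<bar>"] by eventually_elim (rule main, auto)
    qed simp
    also have "2 * pi * \<i> * ml \<alpha> \<beta> z - 0 - 2 * pi * \<i> * residue f q = 2 * pi * \<i> * (ml \<alpha> \<beta> z - residue f q)"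
      by (simp add: algebra_simps)
    finally have *: "2 * pi * norm (ml \<alpha> \<beta> z - residue f q) \<le> 2 * (K / (c0 * r))" by (simp add: norm_mult)
    have "2 * norm (ml \<alpha> \<beta> z - residue f q) \<le> 2 * pi * norm (ml \<alpha> \<beta> z - residue f q)"
      using pi_ge_two by (intro mult_right_mono) auto
    with * have "norm (ml \<alpha> \<beta> z - residue f q) \<le> K / c0 / r" by simp
    then show "norm (ml \<alpha> \<beta> (a * of_real r) -
      (if \<bar>Arg a\<bar> < \<alpha> * \<theta> then hankel_fun \<beta> ((Ln a + of_real (ln r)) / of_real \<alpha>) / of_real \<alpha> else 0)) \<le> K / c0 / r"
      unfolding residue z_def w0_def .
  qed
qed

section \<open>Causal convolutions and fractional power series\<close>

text \<open>The integral runs over the whole line. For causal arguments the integrand vanishes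
  outside the interval from 0 to \<open>t\<close>, so commutativity and Fubini's theorem involve no
  moving limits.\<close>

definition conv :: "(real \<Rightarrow> complex) \<Rightarrow> (real \<Rightarrow> complex) \<Rightarrow> real \<Rightarrow> complex" where
  "conv f g t = (LINT \<tau>|lborel. f (t - \<tau>) * g \<tau>)"

text \<open>Causal locally integrable functions are the kernels, possibly singular at 0; the causal
  locally bounded functions below are the solutions and forcings. With one factor of each kind a
  convolution exists at every point and is again locally bounded.\<close>

definition locint :: "(real \<Rightarrow> complex) \<Rightarrow> bool" where
  "locint f \<longleftrightarrow> f \<in> borel_measurable borel \<and> (\<forall>t<0. f t = 0) \<and> (\<forall>T. set_integrable lborel {0..T} f)"

definition locbdd :: "(real \<Rightarrow> complex) \<Rightarrow> bool" where
  "locbdd f \<longleftrightarrow> f \<in> borel_measurable borel \<and> (\<forall>t<0. f t = 0) \<and> (\<forall>T. \<exists>M. \<forall>t\<le>T. norm (f t) \<le> M)"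

lemma locint_measurable: "locint f \<Longrightarrow> f \<in> borel_measurable borel"
  and locbdd_measurable: "locbdd f \<Longrightarrow> f \<in> borel_measurable borel"
  by (simp_all add: locint_def locbdd_def)

lemma locbdd_bound:
  assumes "locbdd f" obtains M where "M \<ge> 0" "\<And>t. t \<le> T \<Longrightarrow> norm (f t) \<le> M"
proof -
  obtain M where M: "\<forall>t\<le>T. norm (f t) \<le> M" using assms unfolding locbdd_def by blast
  show ?thesis by (rule that[of "max 0 M"]) (use M in \<open>auto intro: order_trans[OF _ max.cobounded2]\<close>)
qed

lemma locbdd_imp_locint: assumes "locbdd f" shows "locint f"
proof -
  have "set_integrable lborel {0..T} f" for T
  proof -
    obtain M where M: "M \<ge> 0" "\<And>t. t \<le> T \<Longrightarrow> norm (f t) \<le> M" using locbdd_bound[OF assms] by blast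
    have "set_integrable lborel {0..T} (\<lambda>_. M)"
      by (rule borel_integrable_atLeastAtMost') simp
    then show ?thesis unfolding set_integrable_def
    proof (rule Bochner_Integration.integrable_bound)
      show "(\<lambda>x. indicat_real {0..T} x *\<^sub>R f x) \<in> borel_measurable lborel"
        using locbdd_measurable[OF assms] by simp
      show "AE x in lborel. norm (indicat_real {0..T} x *\<^sub>R f x) \<le> norm (indicat_real {0..T} x *\<^sub>R M)"
        using M by (auto intro!: AE_I2 simp: indicator_def)
    qed
  qed
  then show ?thesis using assms by (simp add: locint_def locbdd_def)
qed

text \<open>Only the values of \<open>f\<close> on \<open>{0..T}\<close> enter, so a kernel can be
  replaced by a function that is integrable over the whole line.\<close>

lemma conv_window:
  fixes f g :: "real \<Rightarrow> complex"
  assumes "\<And>t. t < 0 \<Longrightarrow> f t = 0" "\<And>t. t < 0 \<Longrightarrow> g t = 0" "t \<le> T"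
  shows "f (t - \<tau>) * g \<tau> = (indicat_real {0..T} (t - \<tau>) *\<^sub>R f (t - \<tau>)) * g \<tau>"
  using assms by (cases "\<tau> < 0"; cases "t - \<tau> < 0") (auto simp: indicator_def)

lemma integrable_reflect: "integrable lborel f \<Longrightarrow> integrable lborel (\<lambda>\<tau>. f (t - \<tau> :: real))"
  for f :: "real \<Rightarrow> 'a :: {banach, second_countable_topology}"
  using lborel_integrable_real_affine[of f "-1" t] by simp

lemma integral_reflect: "(LINT \<tau>|lborel. f (t - \<tau>)) = (LINT \<tau>|lborel. f (\<tau> :: real))"
  for f :: "real \<Rightarrow> 'a :: {banach, second_countable_topology}"
  using lborel_integral_real_affine[of "-1" f t] by simp

lemma conv_integrable:
  assumes f: "locint f" and g: "locbdd g"
  shows "integrable lborel (\<lambda>\<tau>. f (t - \<tau>) * g \<tau>)"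
proof -
  obtain M where M: "M \<ge> 0" "\<And>s. s \<le> t \<Longrightarrow> norm (g s) \<le> M" using locbdd_bound[OF g] by blast
  define F where "F x = indicat_real {0..t} x *\<^sub>R f x" for x
  have "integrable lborel F" using f by (simp add: locint_def set_integrable_def F_def[abs_def])
  then have "integrable lborel (\<lambda>\<tau>. M *\<^sub>R F (t - \<tau>))" by (intro integrable_scaleR_right integrable_reflect)
  then show ?thesis
  proof (rule Bochner_Integration.integrable_bound)
    show "(\<lambda>\<tau>. f (t - \<tau>) * g \<tau>) \<in> borel_measurable lborel"
      using locint_measurable[OF f] locbdd_measurable[OF g] by measurable
    have "norm (f (t - \<tau>) * g \<tau>) \<le> norm (M *\<^sub>R F (t - \<tau>))" for \<tau>
    proof (cases "\<tau> \<le> t")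
      case True
      have "f (t - \<tau>) * g \<tau> = F (t - \<tau>) * g \<tau>"
        unfolding F_def by (rule conv_window) (use f g in \<open>auto simp: locint_def locbdd_def\<close>)
      then show ?thesis using mult_left_mono[OF M(2)[OF True], of "norm (F (t - \<tau>))"] M(1)
        by (simp only: norm_mult norm_scaleR abs_of_nonneg mult.commute norm_ge_zero)
    next
      case False
      then show ?thesis using f by (simp add: locint_def)
    qed
    then show "AE \<tau> in lborel. norm (f (t - \<tau>) * g \<tau>) \<le> norm (M *\<^sub>R F (t - \<tau>))" by simp
  qed
qed

lemma conv_measurable:
  assumes [measurable]: "f \<in> borel_measurable borel" "g \<in> borel_measurable borel"
  shows "conv f g \<in> borel_measurable borel"
proof -
  have "(\<lambda>t. LINT \<tau>|lborel. f (t - \<tau>) * g \<tau>) \<in> borel_measurable borel"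
    by measurable
  then show ?thesis by (simp add: conv_def[abs_def])
qed

lemma conv_locbdd:
  assumes f: "locint f" and g: "locbdd g"
  shows "locbdd (conv f g)"
  unfolding locbdd_def
proof (intro conjI allI impI)
  show "conv f g \<in> borel_measurable borel"
    by (rule conv_measurable[OF locint_measurable[OF f] locbdd_measurable[OF g]])
  fix t :: real assume "t < 0"
  then have "f (t - \<tau>) * g \<tau> = 0" for \<tau>
    using f g by (cases "\<tau> < 0") (auto simp: locint_def locbdd_def)
  then show "conv f g t = 0" unfolding conv_def by (simp only: integral_zero)
next
  fix T
  obtain M where M: "M \<ge> 0" "\<And>s. s \<le> T \<Longrightarrow> norm (g s) \<le> M" using locbdd_bound[OF g] by blast
  define F where "F x = indicat_real {0..T} x *\<^sub>R f x" for x
  have F: "integrable lborel F" using f by (simp add: locint_def set_integrable_def F_def[abs_def])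
  show "\<exists>M. \<forall>t\<le>T. norm (conv f g t) \<le> M"
  proof (intro exI allI impI)
    fix t assume t: "t \<le> T"
    have "norm (conv f g t) \<le> (LINT \<tau>|lborel. M * norm (F (t - \<tau>)))"
      unfolding conv_def
    proof (rule Bochner_Integration.integral_norm_bound_integral)
      show "integrable lborel (\<lambda>\<tau>. f (t - \<tau>) * g \<tau>)" by (rule conv_integrable[OF f g])
      show "integrable lborel (\<lambda>\<tau>. M * norm (F (t - \<tau>)))"
        by (intro integrable_mult_right integrable_norm integrable_reflect F)
      fix \<tau>
      show "norm (f (t - \<tau>) * g \<tau>) \<le> M * norm (F (t - \<tau>))"
      proof (cases "\<tau> \<le> t")
        case True
        have "f (t - \<tau>) * g \<tau> = F (t - \<tau>) * g \<tau>"
          unfolding F_def by (rule conv_window) (use f g t in \<open>auto simp: locint_def locbdd_def\<close>)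
        then show ?thesis using mult_left_mono[OF M(2), of \<tau> "norm (F (t - \<tau>))"] t True
          by (simp only: norm_mult mult.commute norm_ge_zero)
      next
        case False
        then show ?thesis using f M(1) by (simp add: locint_def)
      qed
    qed
    also have "\<dots> = M * (LINT \<tau>|lborel. norm (F \<tau>))"
      using integral_reflect[of "\<lambda>x. norm (F x)" t] by simp
    finally show "norm (conv f g t) \<le> M * (LINT \<tau>|lborel. norm (F \<tau>))" .
  qed
qed

section \<open>Algebra of convolutions and closure properties\<close>

lemma conv_commute: "conv f g = conv g f"
proof
  fix t
  show "conv f g t = conv g f t"
    unfolding conv_def using integral_reflect[of "\<lambda>\<tau>. f (t - \<tau>) * g \<tau>" t] by (simp add: mult.commute)
qed

lemma conv_add_right:
  assumes "locint f" "locbdd g" "locbdd h"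
  shows "conv f (\<lambda>t. g t + h t) t = conv f g t + conv f h t"
  unfolding conv_def distrib_left using conv_integrable assms by (intro Bochner_Integration.integral_add)

lemma conv_diff_right:
  assumes "locint f" "locbdd g" "locbdd h"
  shows "conv f (\<lambda>t. g t - h t) t = conv f g t - conv f h t"
  unfolding conv_def right_diff_distrib using conv_integrable assms by (intro Bochner_Integration.integral_diff)

lemma conv_add_left:
  assumes "locint f" "locint g" "locbdd h"
  shows "conv (\<lambda>t. f t + g t) h t = conv f h t + conv g h t"
  unfolding conv_def distrib_right using conv_integrable assms by (intro Bochner_Integration.integral_add)

lemma conv_cmult_right: "conv f (\<lambda>t. c * g t) t = c * conv f g t"
  unfolding conv_def by (simp add: mult.left_commute)

lemma conv_cmult_left: "conv (\<lambda>t. c * f t) g t = c * conv f g t"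
  unfolding conv_def by (simp add: mult.assoc)

lemma locbdd_zero: "locbdd (\<lambda>_. 0)"
  by (auto simp: locbdd_def)

lemma locbdd_add: assumes "locbdd f" "locbdd g" shows "locbdd (\<lambda>t. f t + g t)"
  unfolding locbdd_def
proof (intro conjI allI)
  show "(\<lambda>t. f t + g t) \<in> borel_measurable borel" using assms[THEN locbdd_measurable] by simp
  fix T
  obtain M where M: "\<And>t. t \<le> T \<Longrightarrow> norm (f t) \<le> M" using locbdd_bound[OF assms(1)] by blast
  obtain N where N: "\<And>t. t \<le> T \<Longrightarrow> norm (g t) \<le> N" using locbdd_bound[OF assms(2)] by blast
  show "\<exists>M. \<forall>t\<le>T. norm (f t + g t) \<le> M"
    by (intro exI[of _ "M + N"] allI impI norm_triangle_le add_mono M N)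
qed (use assms in \<open>auto simp: locbdd_def\<close>)

lemma locbdd_cmult: assumes "locbdd f" shows "locbdd (\<lambda>t. c * f t)"
  unfolding locbdd_def
proof (intro conjI allI)
  show "(\<lambda>t. c * f t) \<in> borel_measurable borel" using assms[THEN locbdd_measurable] by simp
  fix T
  obtain M where M: "\<And>t. t \<le> T \<Longrightarrow> norm (f t) \<le> M" using locbdd_bound[OF assms(1)] by blast
  show "\<exists>M. \<forall>t\<le>T. norm (c * f t) \<le> M"
    unfolding norm_mult by (intro exI[of _ "norm c * M"] allI impI mult_left_mono M norm_ge_zero)
qed (use assms in \<open>auto simp: locbdd_def\<close>)

lemma locbdd_sum: "(\<And>j. j \<in> A \<Longrightarrow> locbdd (f j)) \<Longrightarrow> locbdd (\<lambda>t. \<Sum>j\<in>A. f j t)"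
  by (induction A rule: infinite_finite_induct) (auto intro: locbdd_zero locbdd_add)

lemma locint_zero: "locint (\<lambda>_. 0)"
  by (rule locbdd_imp_locint[OF locbdd_zero])

lemma locint_cmult: assumes "locint f" shows "locint (\<lambda>t. c * f t)"
proof -
  have "set_integrable lborel {0..T} (\<lambda>t. c * f t)" for T
    using assms by (intro set_integrable_mult_right) (auto simp: locint_def)
  then show ?thesis using assms by (auto simp: locint_def)
qed

lemma locint_add: assumes "locint f" "locint g" shows "locint (\<lambda>t. f t + g t)"
  using assms by (auto simp: locint_def intro: set_integral_add)

lemma locint_sum: "(\<And>j. j \<in> A \<Longrightarrow> locint (f j)) \<Longrightarrow> locint (\<lambda>t. \<Sum>j\<in>A. f j t)"
  by (induction A rule: infinite_finite_induct) (auto intro: locint_zero locint_add)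

lemma conv_sum_right:
  assumes "locint f" "\<And>j. j \<in> A \<Longrightarrow> locbdd (g j)"
  shows "conv f (\<lambda>t. \<Sum>j\<in>A. g j t) t = (\<Sum>j\<in>A. conv f (g j) t)"
  unfolding conv_def sum_distrib_left by (intro Bochner_Integration.integral_sum conv_integrable assms)

lemma conv_sum_left:
  assumes "locbdd f" "\<And>j. j \<in> A \<Longrightarrow> locint (g j)"
  shows "conv (\<lambda>t. \<Sum>j\<in>A. g j t) f t = (\<Sum>j\<in>A. conv (g j) f t)"
  unfolding conv_def sum_distrib_right by (intro Bochner_Integration.integral_sum conv_integrable assms)

lemma locint_norm: "locint f \<Longrightarrow> locint (\<lambda>t. of_real (norm (f t)))"
  unfolding locint_def
proof (intro conjI allI)
  assume f: "f \<in> borel_measurable borel \<and> (\<forall>t<0. f t = 0) \<and> (\<forall>T. set_integrable lborel {0..T} f)"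
  then show "(\<lambda>t. complex_of_real (norm (f t))) \<in> borel_measurable borel" by auto
  fix T
  have "set_integrable lborel {0..T} (\<lambda>t. norm (f t))" using f by (auto intro: set_integrable_norm)
  then show "set_integrable lborel {0..T} (\<lambda>t. complex_of_real (norm (f t)))"
    unfolding set_integrable_def by (simp add: scaleR_conv_of_real flip: of_real_mult)
qed auto

lemma locbdd_norm: "locbdd f \<Longrightarrow> locbdd (\<lambda>t. of_real (norm (f t)))"
  by (auto simp: locbdd_def)

text \<open>Fubini's theorem. The absolute integrability it asks for is the existence of the
  iterated convolution of the norms, which belong to the same classes as the three
  functions.\<close>

lemma conv_assoc:
  assumes f: "locint f" and g: "locint g" and h: "locbdd h"
  shows "conv f (conv g h) t = conv (conv f g) h t"
proof -
  define F where "F x = complex_of_real (norm (f x))" for x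
  define G where "G x = complex_of_real (norm (g x))" for x
  define H where "H x = complex_of_real (norm (h x))" for x
  have FGH: "locint F" "locint G" "locbdd H"
    using f g h by (auto simp: F_def[abs_def] G_def[abs_def] H_def[abs_def] intro: locint_norm locbdd_norm)
  have [measurable]: "f \<in> borel_measurable borel" "g \<in> borel_measurable borel" "h \<in> borel_measurable borel"
    using f g h by (auto intro: locint_measurable locbdd_measurable)
  have int: "integrable (lborel \<Otimes>\<^sub>M lborel) (\<lambda>(\<tau>, s). f (t - \<tau>) * (g (\<tau> - s) * h s))"
  proof (rule lborel_pair.Fubini_integrable)
    show "(\<lambda>(\<tau>, s). f (t - \<tau>) * (g (\<tau> - s) * h s)) \<in> borel_measurable (lborel \<Otimes>\<^sub>M lborel)"
      by measurable
    show "AE \<tau> in lborel. integrable lborel (\<lambda>s. case (\<tau>, s) of (\<tau>, s) \<Rightarrow> f (t - \<tau>) * (g (\<tau> - s) * h s))"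
      using conv_integrable[OF g h] by auto
    have "integrable lborel (\<lambda>\<tau>. F (t - \<tau>) * conv G H \<tau>)"
      by (intro conv_integrable conv_locbdd FGH)
    moreover have "F (t - \<tau>) * conv G H \<tau> = of_real (norm (f (t - \<tau>)) * (LINT s|lborel. norm (g (\<tau> - s)) * norm (h s)))" for \<tau>
      unfolding conv_def F_def G_def H_def by (simp flip: of_real_mult)
    ultimately have "integrable lborel (\<lambda>\<tau>. complex_of_real (norm (f (t - \<tau>)) * (LINT s|lborel. norm (g (\<tau> - s)) * norm (h s))))"
      by simp
    then have "integrable lborel (\<lambda>\<tau>. norm (f (t - \<tau>)) * (LINT s|lborel. norm (g (\<tau> - s)) * norm (h s)))"
      by (subst (asm) complex_of_real_integrable_eq)
    then show "integrable lborel (\<lambda>\<tau>. LINT s|lborel. norm (case (\<tau>, s) of (\<tau>, s) \<Rightarrow> f (t - \<tau>) * (g (\<tau> - s) * h s)))"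
      by (simp add: norm_mult)
  qed
  have "conv f (conv g h) t = (LINT \<tau>|lborel. LINT s|lborel. f (t - \<tau>) * (g (\<tau> - s) * h s))"
    unfolding conv_def by simp
  also have "\<dots> = (LINT s|lborel. LINT \<tau>|lborel. f (t - \<tau>) * (g (\<tau> - s) * h s))"
    by (rule lborel_pair.Fubini_integral[OF int, symmetric])
  also have "\<dots> = (LINT s|lborel. conv f g (t - s) * h s)"
  proof (intro Bochner_Integration.integral_cong refl)
    fix s
    have "(LINT \<tau>|lborel. f (t - \<tau>) * (g (\<tau> - s) * h s)) = (LINT r|lborel. f (t - (s + r)) * (g (s + r - s) * h s))"
      using lborel_integral_real_affine[of 1 "\<lambda>\<tau>. f (t - \<tau>) * (g (\<tau> - s) * h s)" s] by simp
    also have "\<dots> = conv f g (t - s) * h s"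
      unfolding conv_def by (simp add: mult.assoc[symmetric] diff_diff_eq)
    finally show "(LINT \<tau>|lborel. f (t - \<tau>) * (g (\<tau> - s) * h s)) = conv f g (t - s) * h s" .
  qed
  finally show ?thesis by (simp add: conv_def)
qed

text \<open>The Riemann-Liouville kernel \<open>t\<^sup>b\<^sup>-\<^sup>1/\<Gamma>(b)\<close>, extended by \<open>0\<close> to \<open>t \<le> 0\<close> (also for \<open>b = 1\<close>).\<close>
definition rl :: "real \<Rightarrow> real \<Rightarrow> complex" where
  "rl b t = (if t > 0 then of_real (t powr (b - 1) * rGamma b) else 0)"

lemma rl_measurable [measurable]: "rl b \<in> borel_measurable borel"
  unfolding rl_def[abs_def] by measurable

text \<open>Nonnegativity makes the norm of a product of two kernels integrate to the norm of the
  resulting kernel, with equality. Termwise integration of the series below relies on this.\<close>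

lemma rl_nonneg: assumes "b > 0" shows "rl b t = of_real (norm (rl b t))"
proof -
  have "rGamma b > 0" using Gamma_real_pos[OF assms] by (simp add: rGamma_inverse_Gamma)
  then have "0 \<le> t powr (b - 1) * rGamma b" by simp
  then show ?thesis by (cases "t > 0") (simp_all only: rl_def norm_of_real abs_of_nonneg if_True if_False norm_zero of_real_0)
qed

text \<open>Semigroup property of fractional integration: the substitution \<tau> = t u reduces it
  to the Beta integral, whose Gamma quotient cancels against the normalizations.\<close>

lemma rl_conv_integral:
  assumes a: "a > 0" and b: "b > 0"
  shows "has_bochner_integral lborel (\<lambda>\<tau>. rl a (t - \<tau>) * rl b \<tau>) (rl (a + b) t)"
proof (cases "t > 0")
  case False
  then have "rl a (t - \<tau>) * rl b \<tau> = 0" for \<tau> by (auto simp: rl_def)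
  moreover have "rl (a + b) t = 0" using False by (simp add: rl_def)
  ultimately show ?thesis by (simp only: has_bochner_integral_zero)
next
  case True
  let ?c = "complex_of_real (t powr (a - 1 + (b - 1)) * rGamma a * rGamma b)"
  define h where "h u = u powr (b - 1) * (1 - u) powr (a - 1)" for u :: real
  have int: "set_integrable lborel {0..1} h" using integrable_Beta[OF b a] by (simp add: h_def[abs_def])
  have "(LINT u:{0..1}|lborel. h u) = Beta b a"
    using set_borel_integral_eq_integral(2)[OF int] has_integral_Beta_real[OF b a]
    by (simp add: h_def[abs_def] integral_unique)
  with int have "has_bochner_integral lborel (\<lambda>u. indicat_real {0..1} u *\<^sub>R h u) (Beta b a)"
    by (simp add: has_bochner_integral_iff set_integrable_def set_lebesgue_integral_def)
  then have "has_bochner_integral lborel (\<lambda>u. complex_of_real (indicat_real {0..1} u *\<^sub>R h u)) (of_real (Beta b a))"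
    by (rule has_bochner_integral_of_real)
  then have "has_bochner_integral lborel (\<lambda>u. ?c * complex_of_real (indicat_real {0..1} u *\<^sub>R h u))
      (?c * of_real (Beta b a))"
    by (rule has_bochner_integral_mult_right)
  moreover have "?c * complex_of_real (indicat_real {0..1} u *\<^sub>R h u)
      = rl a (t - (0 + t * u)) * rl b (0 + t * u)" for u
  proof -
    consider "u \<le> 0" | "u \<ge> 1" | "0 < u" "u < 1" by linarith
    then show ?thesis
    proof cases
      case 1
      then have "t * u \<le> 0" using True by (simp add: mult_nonneg_nonpos)
      with 1 show ?thesis by (auto simp: rl_def h_def indicator_def)
    next
      case 2
      then have "t \<le> t * u" using True by simp
      with 2 show ?thesis by (auto simp: rl_def h_def indicator_def)
    next
      case 3
      then have "t * u < t" "0 < t * u" using True by simp_all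
      moreover have "t - t * u = t * (1 - u)" by (simp add: algebra_simps)
      ultimately show ?thesis using 3 True unfolding powr_add[of t "a - 1" "b - 1"]
        by (simp add: rl_def h_def powr_mult mult_ac flip: of_real_mult)
    qed
  qed
  ultimately have hb: "has_bochner_integral lborel (\<lambda>u. rl a (t - (0 + t * u)) * rl b (0 + t * u))
      (?c * of_real (Beta b a))" by simp
  have eq: "(rl (a + b) t) /\<^sub>R \<bar>t\<bar> = ?c * of_real (Beta b a)"
  proof -
    have G: "rGamma a * Gamma a = 1" "rGamma b * Gamma b = 1"
      using Gamma_real_pos[OF a] Gamma_real_pos[OF b] by (auto simp: rGamma_inverse_Gamma)
    have "rGamma a * rGamma b * Beta b a = (rGamma a * Gamma a) * (rGamma b * Gamma b) * rGamma (b + a)"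
      unfolding Beta_altdef by (simp only: mult_ac)
    then have B: "rGamma a * rGamma b * Beta b a = rGamma (a + b)" unfolding G by (simp only: mult_1 add.commute)
    have "t powr (a - 1 + (b - 1)) = t powr (a + b - 1 - 1)" by (rule arg_cong[where f = "(powr) t"]) simp
    also have "\<dots> = t powr (a + b - 1) / t" using True by (simp only: powr_diff powr_one less_imp_le)
    finally have "t powr (a + b - 1) * rGamma (a + b) / t = t powr (a - 1 + (b - 1)) * (rGamma a * rGamma b * Beta b a)"
      unfolding B by simp
    moreover have "rl (a + b) t /\<^sub>R \<bar>t\<bar> = of_real (t powr (a + b - 1) * rGamma (a + b) / t)"
      using True by (simp add: rl_def scaleR_conv_of_real field_simps)
    ultimately show ?thesis by (simp only: of_real_mult mult.assoc)
  qed
  show ?thesis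
    using lborel_has_bochner_integral_real_affine_iff[of t "\<lambda>\<tau>. rl a (t - \<tau>) * rl b \<tau>" "rl (a + b) t" 0] hb True
    unfolding eq by simp
qed


text \<open>For \<open>c\<^sub>k = a\<^sup>k\<close> and \<open>t > 0\<close> this is \<open>t\<^sup>\<beta>\<^sup>-\<^sup>1 E\<^sub>\<alpha>\<^sub>,\<^sub>\<beta>(a t\<^sup>\<alpha>)\<close>; matrix entries of Mittag-Leffler functions are
  obtained from \<open>c\<^sub>k = (B\<^sup>k)\<^sub>i\<^sub>j\<close>.\<close>
definition frac_series :: "real \<Rightarrow> (nat \<Rightarrow> complex) \<Rightarrow> real \<Rightarrow> real \<Rightarrow> complex" where
  "frac_series \<alpha> c \<beta> t = (\<Sum>k. c k * rl (\<alpha> * real k + \<beta>) t)"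

lemma rl_scaling:
  assumes "t > 0"
  shows "rl (\<alpha> * real k + \<beta>) t = of_real (t powr (\<beta> - 1)) * (of_real (t powr \<alpha>) ^ k * of_real (rGamma (\<alpha> * real k + \<beta>)))"
proof -
  have "t powr (\<alpha> * real k + \<beta> - 1) = t powr (\<beta> - 1) * (t powr \<alpha>) ^ k"
    using assms by (simp add: powr_power powr_add[symmetric] algebra_simps)
  then show ?thesis using assms by (simp add: rl_def)
qed

lemma rl_1: "rl 1 t = (if t > 0 then 1 else 0)"
  by (simp add: rl_def)

lemma frac_series_nonpos: "t \<le> 0 \<Longrightarrow> frac_series \<alpha> c \<beta> t = 0"
  by (simp add: frac_series_def rl_def)

lemma rl_locint:
  assumes \<beta>: "0 < \<beta>"
  shows "locint (rl \<beta>)"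
  unfolding locint_def
proof (intro conjI allI impI)
  fix T
  \<comment> \<open>Convolution with \<open>rl 1\<close> is plain integration. The point is
    \<open>T + 1\<close> rather than \<open>T\<close> because \<open>rl 1\<close> vanishes at 0, and
    the factor has to equal 1 on all of \<open>{0..T}\<close>.\<close>
  have "integrable lborel (\<lambda>\<tau>. rl 1 (T + 1 - \<tau>) * rl \<beta> \<tau>)"
    using rl_conv_integral[OF less_numeral_extra(1) \<beta>] by (simp add: has_bochner_integral_iff)
  then show "set_integrable lborel {0..T} (rl \<beta>)"
    unfolding set_integrable_def
    by (rule Bochner_Integration.integrable_bound) (auto simp: indicator_def rl_1)
qed (auto simp: rl_def)

context
  fixes \<alpha> \<beta> M :: real and c :: "nat \<Rightarrow> complex"
  assumes \<alpha>: "0 < \<alpha>" and c: "\<And>k. norm (c k) \<le> M ^ k" and \<beta>: "0 < \<beta>"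
begin

lemma geometric_bound_nonneg: "0 \<le> M"
  using order_trans[OF norm_ge_zero c[of 1]] by simp

text \<open>Near 0 the series is no more singular than its first kernel \<open>rl \<beta>\<close>:
  the extra powers of \<open>t\<close> are bounded by those of \<open>T\<close> because \<alpha> >
  0. Both conjuncts rest on the same majorizing series \<open>u\<close>.\<close>

lemma frac_series_majorant:
  shows "(\<forall>t\<le>T. summable (\<lambda>k. norm (c k * rl (\<alpha> * real k + \<beta>) t))) \<and>
    (\<exists>K\<ge>0. \<forall>t\<le>T. norm (frac_series \<alpha> c \<beta> t) \<le> K * norm (rl \<beta> t))"
proof -
  define x where "x = M * \<bar>T\<bar> powr \<alpha>"
  have x: "0 \<le> x" using geometric_bound_nonneg by (simp add: x_def)
  define u where "u k = x ^ k * \<bar>rGamma (\<alpha> * real k + \<beta>)\<bar>" for k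
  have u: "summable u" unfolding u_def using summable_rGamma[OF \<alpha> less_imp_le[OF \<beta>] x] .
  have G: "Gamma \<beta> > 0" "rGamma \<beta> > 0" using \<beta> Gamma_real_pos[OF \<beta>] by (auto simp: rGamma_inverse_Gamma)
  have term_le: "norm (c k * rl (\<alpha> * real k + \<beta>) t) \<le> (Gamma \<beta> * norm (rl \<beta> t)) * u k" if "t \<le> T" for t k
  proof (cases "t > 0")
    case True
    have "norm (c k * rl (\<alpha> * real k + \<beta>) t) = t powr (\<beta> - 1) * ((norm (c k) * (t powr \<alpha>) ^ k) * \<bar>rGamma (\<alpha> * real k + \<beta>)\<bar>)"
      unfolding rl_scaling[OF True] by (simp add: norm_mult norm_power)
    also have "\<dots> \<le> t powr (\<beta> - 1) * ((M ^ k * (\<bar>T\<bar> powr \<alpha>) ^ k) * \<bar>rGamma (\<alpha> * real k + \<beta>)\<bar>)"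
      using that True \<alpha> geometric_bound_nonneg
      by (intro mult_left_mono mult_right_mono mult_mono power_mono powr_mono2 c) auto
    also have "\<dots> = t powr (\<beta> - 1) * u k" by (simp add: u_def x_def power_mult_distrib)
    also have "t powr (\<beta> - 1) = Gamma \<beta> * norm (rl \<beta> t)"
    proof -
      have "norm (rl \<beta> t) = t powr (\<beta> - 1) * rGamma \<beta>"
        using G(2) True by (simp only: rl_def if_True norm_of_real abs_mult abs_of_pos abs_of_nonneg powr_ge_zero)
      then show ?thesis using G(1) by (simp add: rGamma_inverse_Gamma)
    qed
    finally show ?thesis .
  qed (simp add: rl_def)
  have sum: "summable (\<lambda>k. norm (c k * rl (\<alpha> * real k + \<beta>) t))" if "t \<le> T" for t
    by (rule summable_comparison_test'[OF summable_mult[OF u, of "Gamma \<beta> * norm (rl \<beta> t)"]]) (use term_le[OF that] in simp)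
  have "norm (frac_series \<alpha> c \<beta> t) \<le> suminf u * Gamma \<beta> * norm (rl \<beta> t)" if t: "t \<le> T" for t
  proof -
    have "norm (frac_series \<alpha> c \<beta> t) \<le> (\<Sum>k. norm (c k * rl (\<alpha> * real k + \<beta>) t))"
      unfolding frac_series_def by (rule summable_norm[OF sum[OF t]])
    also have "\<dots> \<le> (\<Sum>k. (Gamma \<beta> * norm (rl \<beta> t)) * u k)"
      by (rule suminf_le[OF term_le[OF t] sum[OF t] summable_mult[OF u]])
    also have "\<dots> = suminf u * Gamma \<beta> * norm (rl \<beta> t)"
      using suminf_mult[OF u, of "Gamma \<beta> * norm (rl \<beta> t)"] by (simp only: mult_ac)
    finally show ?thesis .
  qed
  moreover have "0 \<le> suminf u * Gamma \<beta>"
    by (rule mult_nonneg_nonneg[OF suminf_nonneg[OF u] less_imp_le[OF G(1)]]) (use x in \<open>simp add: u_def\<close>)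
  ultimately show ?thesis using sum by blast
qed

lemma summable_frac_series: "summable (\<lambda>k. norm (c k * rl (\<alpha> * real k + \<beta>) t))"
  using conjunct1[OF frac_series_majorant[of t]] by simp

lemma frac_series_measurable: "frac_series \<alpha> c \<beta> \<in> borel_measurable borel"
  unfolding frac_series_def[abs_def] by measurable

lemma frac_series_locint: "locint (frac_series \<alpha> c \<beta>)"
  unfolding locint_def
proof (intro conjI allI impI)
  fix T
  obtain K where K: "K \<ge> 0" "\<And>t. t \<le> T \<Longrightarrow> norm (frac_series \<alpha> c \<beta> t) \<le> K * norm (rl \<beta> t)"
    using conjunct2[OF frac_series_majorant[of T]] by blast
  have "set_integrable lborel {0..T} (\<lambda>t. of_real K * rl \<beta> t)"
    using rl_locint[OF \<beta>] by (intro set_integrable_mult_right) (auto simp: locint_def)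
  then show "set_integrable lborel {0..T} (frac_series \<alpha> c \<beta>)"
    unfolding set_integrable_def
  proof (rule Bochner_Integration.integrable_bound)
    show "(\<lambda>x. indicat_real {0..T} x *\<^sub>R frac_series \<alpha> c \<beta> x) \<in> borel_measurable lborel"
      using frac_series_measurable by simp
    show "AE x in lborel. norm (indicat_real {0..T} x *\<^sub>R frac_series \<alpha> c \<beta> x)
        \<le> norm (indicat_real {0..T} x *\<^sub>R (complex_of_real K * rl \<beta> x))"
      using K by (auto simp: indicator_def norm_mult)
  qed
qed (auto simp: frac_series_measurable frac_series_nonpos)

end

text \<open>Termwise by the semigroup property. Since the kernels are nonnegative, the integral of
  the norm of a term equals the norm of the term it becomes, so the interchange reduces to absolute
  convergence of the two series.\<close>

lemma conv_rl_frac_series: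
  fixes \<alpha> \<beta> M a :: real
  assumes \<alpha>: "0 < \<alpha>" and c: "\<And>k. norm (c k) \<le> M ^ k" and \<beta>: "0 < \<beta>" and a: "0 < a"
  shows "conv (rl a) (frac_series \<alpha> c \<beta>) t = frac_series \<alpha> c (\<beta> + a) t"
proof -
  have b: "\<alpha> * real k + \<beta> > 0" for k using \<alpha> \<beta> by (intro add_nonneg_pos) auto
  define f where "f k \<tau> = rl a (t - \<tau>) * (c k * rl (\<alpha> * real k + \<beta>) \<tau>)" for k \<tau>
  have hb: "has_bochner_integral lborel (f k) (c k * rl (\<alpha> * real k + (\<beta> + a)) t)" for k
    using has_bochner_integral_mult_right[OF rl_conv_integral[OF a b[of k]], of "c k" t]
    unfolding f_def by (simp only: mult.left_commute[of "c k"] add.commute[of a] add.assoc)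
  have norm_f: "has_bochner_integral lborel (\<lambda>\<tau>. norm (f k \<tau>)) (norm (c k * rl (\<alpha> * real k + (\<beta> + a)) t))" for k
  proof -
    have "has_bochner_integral lborel (\<lambda>\<tau>. norm (c k) * Re (rl a (t - \<tau>) * rl (\<alpha> * real k + \<beta>) \<tau>))
        (norm (c k) * Re (rl (a + (\<alpha> * real k + \<beta>)) t))"
      by (rule has_bochner_integral_mult_right[OF has_bochner_integral_bounded_linear[OF bounded_linear_Re rl_conv_integral[OF a b]]])
    moreover have "Re (rl a (t - \<tau>) * rl (\<alpha> * real k + \<beta>) \<tau>) = norm (rl a (t - \<tau>) * rl (\<alpha> * real k + \<beta>) \<tau>)" for \<tau>
    proof -
      have "rl a (t - \<tau>) * rl (\<alpha> * real k + \<beta>) \<tau> = of_real (norm (rl a (t - \<tau>)) * norm (rl (\<alpha> * real k + \<beta>) \<tau>))"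
        unfolding of_real_mult using rl_nonneg[OF a, of "t - \<tau>"] rl_nonneg[OF b, of k \<tau>] by (simp only:)
      then show ?thesis unfolding norm_mult by (simp only: Re_complex_of_real)
    qed
    moreover have "Re (rl (a + (\<alpha> * real k + \<beta>)) t) = norm (rl (a + (\<alpha> * real k + \<beta>)) t)"
      using arg_cong[OF rl_nonneg[OF add_pos_pos[OF a b], of k t], of Re] by (simp only: Re_complex_of_real)
    moreover have "norm (f k \<tau>) = norm (c k) * norm (rl a (t - \<tau>) * rl (\<alpha> * real k + \<beta>) \<tau>)" for \<tau>
      unfolding f_def norm_mult by (simp only: mult_ac)
    moreover have "norm (c k * rl (\<alpha> * real k + (\<beta> + a)) t) = norm (c k) * norm (rl (a + (\<alpha> * real k + \<beta>)) t)"
      unfolding norm_mult by (simp only: add_ac)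
    ultimately show ?thesis by (simp only:)
  qed
  have "conv (rl a) (frac_series \<alpha> c \<beta>) t = (LINT \<tau>|lborel. (\<Sum>k. f k \<tau>))"
    unfolding conv_def frac_series_def f_def
    by (rule Bochner_Integration.integral_cong[OF refl],
        rule suminf_mult[OF summable_norm_cancel[OF summable_frac_series[OF \<alpha> c \<beta>]], symmetric])
  also have "\<dots> = (\<Sum>k. LINT \<tau>|lborel. f k \<tau>)"
  proof (rule integral_suminf)
    show "integrable lborel (f k)" for k using hb by (simp add: has_bochner_integral_iff)
    show "AE \<tau> in lborel. summable (\<lambda>k. norm (f k \<tau>))"
      unfolding f_def norm_mult[of "rl a _"] by (intro AE_I2 summable_mult summable_frac_series[OF \<alpha> c \<beta>])
    show "summable (\<lambda>k. LINT \<tau>|lborel. norm (f k \<tau>))"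
      unfolding has_bochner_integral_integral_eq[OF norm_f] by (rule summable_frac_series[OF \<alpha> c add_pos_pos[OF \<beta> a]])
  qed
  also have "\<dots> = frac_series \<alpha> c (\<beta> + a) t"
    unfolding frac_series_def has_bochner_integral_integral_eq[OF hb] ..
  finally show ?thesis .
qed


lemma frac_series_shift:
  fixes \<alpha> \<beta> M :: real
  assumes \<alpha>: "0 < \<alpha>" and c: "\<And>k. norm (c k) \<le> M ^ k" and \<beta>: "0 < \<beta>"
  shows "frac_series \<alpha> c \<beta> t = c 0 * rl \<beta> t + frac_series \<alpha> (\<lambda>k. c (Suc k)) (\<beta> + \<alpha>) t"
proof -
  have "summable (\<lambda>k. c k * rl (\<alpha> * real k + \<beta>) t)"
    by (rule summable_norm_cancel[OF summable_frac_series[OF \<alpha> c \<beta>]])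
  from suminf_split_head[OF this] show ?thesis
    by (simp add: frac_series_def algebra_simps)
qed

lemma frac_series_sum:
  fixes \<alpha> \<beta> M :: real
  assumes \<alpha>: "0 < \<alpha>" and c: "\<And>j k. j \<in> J \<Longrightarrow> norm (c j k) \<le> M ^ k" and \<beta>: "0 < \<beta>"
  shows "frac_series \<alpha> (\<lambda>k. \<Sum>j\<in>J. b j * c j k) \<beta> t = (\<Sum>j\<in>J. b j * frac_series \<alpha> (c j) \<beta> t)"
proof -
  have "summable (\<lambda>k. c j k * rl (\<alpha> * real k + \<beta>) t)" if "j \<in> J" for j
    by (rule summable_norm_cancel[OF summable_frac_series[OF \<alpha> c[OF that] \<beta>]])
  then have "(\<Sum>k. \<Sum>j\<in>J. b j * (c j k * rl (\<alpha> * real k + \<beta>) t)) = (\<Sum>j\<in>J. \<Sum>k. b j * (c j k * rl (\<alpha> * real k + \<beta>) t))"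
    by (intro suminf_sum) (rule summable_mult)
  also have "\<dots> = (\<Sum>j\<in>J. b j * frac_series \<alpha> (c j) \<beta> t)"
    unfolding frac_series_def
    by (rule sum.cong[OF refl], rule suminf_mult, rule summable_norm_cancel[OF summable_frac_series[OF \<alpha> c \<beta>]])
  finally show ?thesis by (simp add: frac_series_def sum_distrib_right mult.assoc)
qed

lemma rl_1_locbdd: "locbdd (rl 1)"
  unfolding locbdd_def by (auto simp: rl_1 intro!: exI[of _ 1])

lemma frac_series_1_locbdd:
  fixes \<alpha> M :: real
  assumes \<alpha>: "0 < \<alpha>" and c: "\<And>k. norm (c k) \<le> M ^ k"
  shows "locbdd (frac_series \<alpha> c 1)"
  unfolding locbdd_def
proof (intro conjI allI impI)
  show "frac_series \<alpha> c 1 \<in> borel_measurable borel" by (rule frac_series_measurable[OF \<alpha> c]) simp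
  fix T
  obtain K where K: "K \<ge> 0" "\<And>t. t \<le> T \<Longrightarrow> norm (frac_series \<alpha> c 1 t) \<le> K * norm (rl 1 t)"
    using conjunct2[OF frac_series_majorant[OF \<alpha> c less_numeral_extra(1), of T]] by blast
  have "norm (frac_series \<alpha> c 1 t) \<le> K" if "t \<le> T" for t
    using K(1) K(2)[OF that] by (auto simp: rl_1 split: if_splits)
  then show "\<exists>M. \<forall>t\<le>T. norm (frac_series \<alpha> c 1 t) \<le> M" by blast
qed (simp add: frac_series_nonpos)

text \<open>Resolvent equations: the head of the series is \<open>rl\<close>, and the tail is
  \<open>a\<close> times the series with its parameter raised by \<alpha>, which is a
  convolution.\<close>

lemma scalar_resolvent:
  assumes \<alpha>: "0 < \<alpha>"
  shows "frac_series \<alpha> (power a) \<alpha> = (\<lambda>t. rl \<alpha> t + a * conv (frac_series \<alpha> (power a) \<alpha>) (rl \<alpha>) t)"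
    and "frac_series \<alpha> (power a) 1 = (\<lambda>t. rl 1 t + a * conv (frac_series \<alpha> (power a) \<alpha>) (rl 1) t)"
proof -
  have c: "norm (a ^ k) \<le> norm a ^ k" for k by (simp add: norm_power)
  have shift: "frac_series \<alpha> (power a) \<beta> t = rl \<beta> t + a * conv (frac_series \<alpha> (power a) \<alpha>) (rl \<beta>) t"
    if "\<beta> > 0" for \<beta> t
  proof -
    have "frac_series \<alpha> (power a) \<beta> t = a ^ 0 * rl \<beta> t + frac_series \<alpha> (\<lambda>k. a ^ Suc k) (\<beta> + \<alpha>) t"
      by (rule frac_series_shift[OF \<alpha> c that])
    \<comment> \<open>A sum over one index, so that linearity of the series in its coefficients
      takes out the factor \<open>a\<close>.\<close>
    also have "(\<lambda>k. a ^ Suc k) = (\<lambda>k. \<Sum>j\<in>{()}. a * a ^ k)" by simp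
    also have "frac_series \<alpha> \<dots> (\<beta> + \<alpha>) t = (\<Sum>j\<in>{()}. a * frac_series \<alpha> (power a) (\<beta> + \<alpha>) t)"
      by (rule frac_series_sum[OF \<alpha> c add_pos_pos[OF that \<alpha>]])
    also have "frac_series \<alpha> (power a) (\<beta> + \<alpha>) t = conv (rl \<beta>) (frac_series \<alpha> (power a) \<alpha>) t"
      unfolding add.commute[of \<beta>] by (rule conv_rl_frac_series[OF \<alpha> c \<alpha> that, symmetric])
    also have "conv (rl \<beta>) (frac_series \<alpha> (power a) \<alpha>) = conv (frac_series \<alpha> (power a) \<alpha>) (rl \<beta>)"
      by (rule conv_commute)
    finally show ?thesis by simp
  qed
  show "frac_series \<alpha> (power a) \<alpha> = (\<lambda>t. rl \<alpha> t + a * conv (frac_series \<alpha> (power a) \<alpha>) (rl \<alpha>) t)"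
    by (rule ext) (rule shift[OF \<alpha>])
  show "frac_series \<alpha> (power a) 1 = (\<lambda>t. rl 1 t + a * conv (frac_series \<alpha> (power a) \<alpha>) (rl 1) t)"
    by (rule ext) (rule shift[OF less_numeral_extra(1)])
qed

text \<open>Convolve the equation with \<open>k\<close>, the resolvent kernel, and use \<open>k = rl\<^sub>\<alpha> + a (k * rl\<^sub>\<alpha>)\<close> and associativity.\<close>
theorem volterra_solution:
  assumes \<alpha>: "0 < \<alpha>" and z: "locbdd z" and f: "locbdd f"
    and eq: "\<And>t. z t = z0 * rl 1 t + conv (rl \<alpha>) (\<lambda>t. a * z t + f t) t"
  shows "z t = z0 * frac_series \<alpha> (power a) 1 t + conv (frac_series \<alpha> (power a) \<alpha>) f t"
proof -
  define k where "k = frac_series \<alpha> (power a) \<alpha>"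
  have c: "norm (a ^ k) \<le> norm a ^ k" for k by (simp add: norm_power)
  have k: "locint k" unfolding k_def by (rule frac_series_locint[OF \<alpha> c \<alpha>])
  \<comment> \<open>Local integrability of this convolution of two kernels is read off from its
    being a fractional series again.\<close>
  have kr: "locint (conv k (rl \<alpha>))"
  proof -
    have "conv k (rl \<alpha>) = frac_series \<alpha> (power a) (\<alpha> + \<alpha>)"
      unfolding k_def conv_commute[of _ "rl \<alpha>"] by (rule ext, rule conv_rl_frac_series[OF \<alpha> c \<alpha> \<alpha>])
    then show ?thesis using frac_series_locint[OF \<alpha> c add_pos_pos[OF \<alpha> \<alpha>]] by simp
  qed
  define F where "F = (\<lambda>t. a * z t + f t)"
  have F: "locbdd F" unfolding F_def by (intro locbdd_add locbdd_cmult z f)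
  have rF: "conv (rl \<alpha>) F = (\<lambda>t. z t - z0 * rl 1 t)"
  proof
    fix t
    have "z t = z0 * rl 1 t + conv (rl \<alpha>) F t" unfolding F_def by (rule eq)
    then show "conv (rl \<alpha>) F t = z t - z0 * rl 1 t" by simp
  qed
  have "conv k F t = conv (\<lambda>t. rl \<alpha> t + a * conv k (rl \<alpha>) t) F t"
    unfolding k_def by (rule arg_cong[OF scalar_resolvent(1)[OF \<alpha>, of a], of "\<lambda>k. conv k F t"])
  also have "\<dots> = conv (rl \<alpha>) F t + a * conv (conv k (rl \<alpha>)) F t"
    using conv_add_left[OF rl_locint[OF \<alpha>] locint_cmult[OF kr] F] by (simp add: conv_cmult_left)
  also have "conv (conv k (rl \<alpha>)) F t = conv k (conv (rl \<alpha>) F) t"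
    by (rule conv_assoc[OF k rl_locint[OF \<alpha>] F, symmetric])
  also have "\<dots> = conv k z t - z0 * conv k (rl 1) t"
    unfolding rF using conv_diff_right[OF k z locbdd_cmult[OF rl_1_locbdd]] by (simp add: conv_cmult_right)
  finally have 1: "conv k F t = z t - z0 * rl 1 t + a * (conv k z t - z0 * conv k (rl 1) t)" by (simp add: rF)
  \<comment> \<open>The same convolution evaluated by linearity; on comparison with \<open>1\<close>
    the terms with \<open>conv k z\<close> cancel.\<close>
  have 2: "conv k F t = a * conv k z t + conv k f t"
    unfolding F_def using conv_add_right[OF k locbdd_cmult[OF z] f] by (simp add: conv_cmult_right)
  have 3: "frac_series \<alpha> (power a) 1 t = rl 1 t + a * conv k (rl 1) t"
    unfolding k_def using scalar_resolvent(2)[OF \<alpha>, of a] by (rule fun_cong)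
  show ?thesis using 1 2 unfolding 3 k_def[symmetric] by (simp add: algebra_simps)
qed

section \<open>Bounded solutions of scalar equations\<close>

lemma frac_series_power_eq_ml:
  assumes "0 < \<alpha>" "0 \<le> \<beta>" "0 < t"
  shows "frac_series \<alpha> (power a) \<beta> t = of_real (t powr (\<beta> - 1)) * ml \<alpha> \<beta> (a * of_real (t powr \<alpha>))"
proof -
  have "frac_series \<alpha> (power a) \<beta> t = (\<Sum>k. of_real (t powr (\<beta> - 1)) * ((a * of_real (t powr \<alpha>)) ^ k * of_real (rGamma (\<alpha> * real k + \<beta>))))"
    unfolding frac_series_def rl_scaling[OF assms(3)] power_mult_distrib by (simp only: mult_ac)
  also have "\<dots> = of_real (t powr (\<beta> - 1)) * ml \<alpha> \<beta> (a * of_real (t powr \<alpha>))"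
    unfolding ml_def by (rule suminf_mult[OF summable_ml[OF assms(1,2)]])
  finally show ?thesis .
qed

text \<open>Since \<open>1/\<Gamma>(0) = 0\<close>, the \<open>O(1/|z|)\<close> remainder of \<open>E\<^sub>\<alpha>\<^sub>,\<^sub>0\<close> becomes \<open>O(1/|z|\<^sup>2)\<close> for \<open>E\<^sub>\<alpha>\<^sub>,\<^sub>\<alpha>\<close>, which makes
  the remainder of the resolvent kernel integrable at infinity.\<close>
lemma ml_0_eq:
  assumes "0 < \<alpha>"
  shows "ml \<alpha> 0 z = z * ml \<alpha> \<alpha> z"
proof -
  have "ml \<alpha> 0 z = (\<Sum>k. z ^ Suc k * of_real (rGamma (\<alpha> * real (Suc k) + 0)))"
    unfolding ml_def using suminf_split_head[OF summable_ml[OF assms order_refl, of z]] by simp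
  also have "\<dots> = (\<Sum>k. z * (z ^ k * of_real (rGamma (\<alpha> * real k + \<alpha>))))"
    by (rule suminf_cong) (simp add: algebra_simps)
  also have "\<dots> = z * ml \<alpha> \<alpha> z"
    unfolding ml_def by (rule suminf_mult[OF summable_ml[OF assms less_imp_le[OF assms]]])
  finally show ?thesis .
qed

section \<open>Integrable kernels acting on bounded functions\<close>

lemma set_integrable_of_has_integral:
  fixes h :: "real \<Rightarrow> real"
  assumes "(h has_integral I) S" "S \<in> sets borel" "h \<in> borel_measurable borel" "\<And>x. x \<in> S \<Longrightarrow> 0 \<le> h x"
  shows "set_integrable lborel S h"
proof -
  have "h absolutely_integrable_on S"
    by (rule nonnegative_absolutely_integrable_1) (use assms in auto)
  then have "integrable lebesgue (\<lambda>x. indicat_real S x *\<^sub>R h x)" by (simp add: set_integrable_def)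
  then show ?thesis unfolding set_integrable_def
    by (subst (asm) integrable_completion) (use assms in auto)
qed

lemma integrable_exp_halfline:
  fixes m :: real
  assumes "m > 0"
  shows "integrable lborel (\<lambda>x. indicat_real {0..} x * exp (- m * x))"
  using set_integrable_of_has_integral[OF has_integral_exp_minus_to_infinity[OF assms, of 0]]
  by (simp add: set_integrable_def)

lemma integrable_power_tail:
  fixes \<alpha> :: real
  assumes "\<alpha> > 0"
  shows "integrable lborel (\<lambda>x. indicat_real {1..} x * x powr (- 1 - \<alpha>))"
  using set_integrable_of_has_integral[OF has_integral_powr_to_inf[of "- 1 - \<alpha>" 1]] assms
  by (simp add: set_integrable_def)

text \<open>Dominated convergence after the shift has been moved from the kernel to
  \<open>f\<close>. The kernel may live on both half-lines, as the remainder kernel below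
  does.\<close>

lemma tendsto_conv_L1:
  fixes K f :: "real \<Rightarrow> complex"
  assumes K: "integrable lborel K" and f: "f \<in> borel_measurable borel" "\<And>t. norm (f t) \<le> M"
    and lim: "(f \<longlongrightarrow> 0) at_top"
  shows "((\<lambda>t. LINT \<tau>|lborel. K (t - \<tau>) * f \<tau>) \<longlongrightarrow> 0) at_top"
proof -
  have [measurable]: "f \<in> borel_measurable borel" "K \<in> borel_measurable borel"
    using f(1) borel_measurable_integrable[OF K] by auto
  have "(LINT \<tau>|lborel. K (t - \<tau>) * f \<tau>) = (LINT u|lborel. K u * f (t - u))" for t
    using integral_reflect[of "\<lambda>u. K u * f (t - u)" t] by simp
  moreover have "((\<lambda>t. LINT u|lborel. K u * f (t - u)) \<longlongrightarrow> integral\<^sup>L lborel (\<lambda>_ :: real. 0 :: complex)) at_top"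
  proof (rule integral_dominated_convergence_at_top)
    show "integrable lborel (\<lambda>u. M * norm (K u))" by (intro integrable_mult_right integrable_norm K)
    show "\<forall>\<^sub>F t in at_top. AE u in lborel. norm (K u * f (t - u)) \<le> M * norm (K u)"
      unfolding norm_mult mult.commute[of M]
      by (intro always_eventually allI AE_I2 mult_left_mono[OF f(2) norm_ge_zero])
    have "((\<lambda>t. K u * f (t - u)) \<longlongrightarrow> 0) at_top" for u
    proof (rule tendsto_mult_right_zero)
      have "filterlim (\<lambda>t. t - u) at_top at_top"
        using filterlim_tendsto_add_at_top[OF tendsto_const filterlim_ident, of "- u"] by simp
      then show "((\<lambda>t. f (t - u)) \<longlongrightarrow> 0) at_top" by (rule filterlim_compose[OF lim])
    qed
    then show "AE u in lborel. ((\<lambda>t. K u * f (t - u)) \<longlongrightarrow> 0) at_top" by simp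
  qed measurable
  ultimately show ?thesis by simp
qed

lemma bounded_conv_L1:
  fixes K f :: "real \<Rightarrow> complex"
  assumes K: "integrable lborel K" and f: "f \<in> borel_measurable borel" "\<And>t. norm (f t) \<le> M"
  shows "integrable lborel (\<lambda>\<tau>. K (t - \<tau>) * f \<tau>)"
    and "norm (LINT \<tau>|lborel. K (t - \<tau>) * f \<tau>) \<le> M * (LINT u|lborel. norm (K u))"
proof -
  have [measurable]: "f \<in> borel_measurable borel" "K \<in> borel_measurable borel"
    using f(1) borel_measurable_integrable[OF K] by auto
  have M: "M \<ge> 0" using order_trans[OF norm_ge_zero f(2)[of 0]] .
  have int: "integrable lborel (\<lambda>\<tau>. M * norm (K (t - \<tau>)))"
    by (intro integrable_mult_right integrable_norm integrable_reflect K)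
  have le: "norm (K (t - \<tau>) * f \<tau>) \<le> M * norm (K (t - \<tau>))" for \<tau>
    using mult_left_mono[OF f(2)[of \<tau>], of "norm (K (t - \<tau>))"] by (simp add: norm_mult mult.commute)
  show 1: "integrable lborel (\<lambda>\<tau>. K (t - \<tau>) * f \<tau>)"
    using int by (rule Bochner_Integration.integrable_bound)
      (use le M in \<open>auto simp: abs_mult intro!: AE_I2\<close>)
  have "norm (LINT \<tau>|lborel. K (t - \<tau>) * f \<tau>) \<le> (LINT \<tau>|lborel. M * norm (K (t - \<tau>)))"
    by (rule Bochner_Integration.integral_norm_bound_integral[OF 1 int le])
  also have "\<dots> = M * (LINT u|lborel. norm (K u))"
    using integral_reflect[of "\<lambda>u. norm (K u)" t] by simp
  finally show "norm (LINT \<tau>|lborel. K (t - \<tau>) * f \<tau>) \<le> M * (LINT u|lborel. norm (K u))" .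
qed

definition bdd :: "(real \<Rightarrow> complex) \<Rightarrow> bool" where
  "bdd f \<longleftrightarrow> (\<exists>M. \<forall>t. norm (f t) \<le> M)"

lemma bdd_of_tail:
  assumes "locbdd z" "\<And>t. t \<ge> T \<Longrightarrow> norm (z t) \<le> M"
  shows "bdd z"
proof -
  obtain N where N: "\<And>t. t \<le> T \<Longrightarrow> norm (z t) \<le> N" using locbdd_bound[OF assms(1)] by blast
  have "norm (z t) \<le> max M N" for t
    using assms(2)[of t] N[of t] by (cases "t \<le> T") auto
  then show ?thesis unfolding bdd_def by blast
qed

text \<open>Three regions: for negative \<open>t\<close> only the exponential is left, and it decays
  because \<open>Re \<mu> > 0\<close>; on \<open>{0..1}\<close> both parts are integrable; beyond 1
  the assumed decay is integrable.\<close>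

lemma integrable_remainder_kernel:
  fixes k :: "real \<Rightarrow> complex"
  assumes k: "locint k" and \<alpha>: "\<alpha> > 0" and \<mu>: "Re \<mu> > 0"
    and decay: "\<And>t. t \<ge> 1 \<Longrightarrow> norm (k t - c * exp (of_real t * \<mu>)) \<le> C * t powr (- 1 - \<alpha>)"
  shows "integrable lborel (\<lambda>t. k t - c * exp (of_real t * \<mu>))"
proof -
  define K where "K t = k t - c * exp (of_real t * \<mu>)" for t
  have [measurable]: "k \<in> borel_measurable borel" by (rule locint_measurable[OF k])
  have Km [measurable]: "K \<in> borel_measurable borel" unfolding K_def[abs_def] by measurable
  have 1: "integrable lborel (\<lambda>t. indicat_real {..<0} t *\<^sub>R K t)"
  proof (rule Bochner_Integration.integrable_bound)
    show "integrable lborel (\<lambda>t. norm c * (indicat_real {0..} (0 - t) * exp (- Re \<mu> * (0 - t))))"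
      by (intro integrable_mult_right integrable_reflect[where t = 0] integrable_exp_halfline \<mu>)
    show "AE t in lborel. norm (indicat_real {..<0} t *\<^sub>R K t) \<le> norm (norm c * (indicat_real {0..} (0 - t) * exp (- Re \<mu> * (0 - t))))"
      using k by (intro AE_I2) (auto simp: indicator_def K_def locint_def norm_mult mult.commute)
  qed measurable
  have 2: "integrable lborel (\<lambda>t. indicat_real {0..1} t *\<^sub>R K t)"
  proof -
    have "set_integrable lborel {0..1} (\<lambda>t. c * exp (of_real t * \<mu>))"
      by (rule borel_integrable_atLeastAtMost') (intro continuous_intros)
    moreover have "set_integrable lborel {0..1} k" using k by (simp add: locint_def)
    ultimately have "set_integrable lborel {0..1} K" unfolding K_def[abs_def] by (intro set_integral_diff)
    then show ?thesis by (simp add: set_integrable_def)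
  qed
  have 3: "integrable lborel (\<lambda>t. indicat_real {1<..} t *\<^sub>R K t)"
  proof (rule Bochner_Integration.integrable_bound)
    show "integrable lborel (\<lambda>t. C * (indicat_real {1..} t * t powr (- 1 - \<alpha>)))"
      by (intro integrable_mult_right integrable_power_tail \<alpha>)
    have "norm (K t) \<le> \<bar>C * t powr (- 1 - \<alpha>)\<bar>" if "t > 1" for t
      using decay[of t] that unfolding K_def by linarith
    then show "AE t in lborel. norm (indicat_real {1<..} t *\<^sub>R K t) \<le> norm (C * (indicat_real {1..} t * t powr (- 1 - \<alpha>)))"
      by (intro AE_I2) (auto simp: indicator_def)
  qed measurable
  have "integrable lborel (\<lambda>t. indicat_real {..<0} t *\<^sub>R K t + indicat_real {0..1} t *\<^sub>R K t + indicat_real {1<..} t *\<^sub>R K t)"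
    by (intro Bochner_Integration.integrable_add 1 2 3)
  moreover have "indicat_real {..<0} t *\<^sub>R K t + indicat_real {0..1} t *\<^sub>R K t + indicat_real {1<..} t *\<^sub>R K t = K t" for t
    by (auto simp: indicator_def)
  ultimately show ?thesis by (simp add: K_def)
qed

text \<open>Subtracting the exponential from \<open>k\<close> on the whole real line leaves a two-sided integrable kernel;
  the subtracted part contributes a multiple of \<open>e\<^sup>\<mu>\<^sup>t\<close>, whose coefficient is affine in \<open>z0\<close>.\<close>
lemma scalar_alternative:
  fixes e k f :: "real \<Rightarrow> complex"
  assumes \<alpha>: "\<alpha> > 0" and k: "locint k" and e: "locbdd e" and f: "locbdd f" "bdd f" and \<mu>: "Re \<mu> > 0"
    and e_asymp: "\<And>t. t \<ge> 1 \<Longrightarrow> norm (e t - \<kappa> * exp (of_real t * \<mu>)) \<le> C * t powr (- \<alpha>)"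
    and k_asymp: "\<And>t. t \<ge> 1 \<Longrightarrow> norm (k t - \<kappa> * \<nu> * exp (of_real t * \<mu>)) \<le> C * t powr (- 1 - \<alpha>)"
  obtains L where "\<And>z0. bdd (\<lambda>t. z0 * e t + conv k f t) \<longleftrightarrow> \<kappa> * (z0 + \<nu> * L) = 0"
    "\<And>z0. bdd (\<lambda>t. z0 * e t + conv k f t) \<Longrightarrow> (f \<longlongrightarrow> 0) at_top \<Longrightarrow> ((\<lambda>t. z0 * e t + conv k f t) \<longlongrightarrow> 0) at_top"
proof -
  let ?q = "\<lambda>\<tau>. exp (- of_real \<tau> * \<mu>) * f \<tau>"
  let ?z = "\<lambda>z0 t. z0 * e t + conv k f t"
  obtain M where M: "\<And>t. norm (f t) \<le> M" using f(2) by (auto simp: bdd_def)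
  have fm [measurable]: "f \<in> borel_measurable borel" by (rule locbdd_measurable[OF f(1)])
  \<comment> \<open>The Laplace transform of \<open>f\<close> at \<mu>, finite because
    \<open>f\<close> is bounded and causal.\<close>
  define L where "L = (LINT \<tau>|lborel. ?q \<tau>)"
  have L_int: "integrable lborel (\<lambda>\<tau>. ?q \<tau>)"
  proof (rule Bochner_Integration.integrable_bound)
    show "integrable lborel (\<lambda>\<tau>. M * (indicat_real {0..} \<tau> * exp (- Re \<mu> * \<tau>)))"
      by (intro integrable_mult_right integrable_exp_halfline \<mu>)
    have "norm (?q \<tau>) \<le> \<bar>M\<bar> * (indicat_real {0..} \<tau> * exp (- Re \<mu> * \<tau>))" for \<tau>
    proof (cases "\<tau> < 0")
      case True
      then show ?thesis using f(1) by (simp add: locbdd_def)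
    next
      case False
      have "norm (f \<tau>) \<le> \<bar>M\<bar>" using M[of \<tau>] by linarith
      with False show ?thesis by (simp add: norm_mult mult.commute)
    qed
    then show "AE \<tau> in lborel. norm (?q \<tau>) \<le> norm (M * (indicat_real {0..} \<tau> * exp (- Re \<mu> * \<tau>)))"
      by (intro AE_I2) (simp add: abs_mult)
  qed measurable
  define K where "K t = k t - \<kappa> * \<nu> * exp (of_real t * \<mu>)" for t
  have K: "integrable lborel K"
    unfolding K_def[abs_def] by (rule integrable_remainder_kernel[OF k \<alpha> \<mu> k_asymp])
  define r where "r t = (LINT \<tau>|lborel. K (t - \<tau>) * f \<tau>)" for t
  define N where "N = M * (LINT u|lborel. norm (K u))"
  have r: "norm (r t) \<le> N" for t unfolding r_def N_def by (rule bounded_conv_L1(2)[OF K fm M])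
  have split: "conv k f t = r t + \<kappa> * \<nu> * exp (of_real t * \<mu>) * L" for t
  proof -
    have "k (t - \<tau>) * f \<tau> = K (t - \<tau>) * f \<tau> + \<kappa> * \<nu> * exp (of_real t * \<mu>) * (?q \<tau>)" for \<tau>
    proof -
      have "exp (of_real (t - \<tau>) * \<mu>) = exp (of_real t * \<mu>) * exp (- of_real \<tau> * \<mu>)"
        by (simp add: exp_add[symmetric] algebra_simps)
      then show ?thesis by (simp add: K_def algebra_simps)
    qed
    then have "conv k f t = (LINT \<tau>|lborel. K (t - \<tau>) * f \<tau> + \<kappa> * \<nu> * exp (of_real t * \<mu>) * (?q \<tau>))"
      by (simp add: conv_def)
    also have "\<dots> = r t + (LINT \<tau>|lborel. \<kappa> * \<nu> * exp (of_real t * \<mu>) * (?q \<tau>))"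
      unfolding r_def by (intro Bochner_Integration.integral_add bounded_conv_L1(1)[OF K fm M] integrable_mult_right L_int)
    also have "(LINT \<tau>|lborel. \<kappa> * \<nu> * exp (of_real t * \<mu>) * (?q \<tau>)) = \<kappa> * \<nu> * exp (of_real t * \<mu>) * L"
      unfolding L_def by (rule integral_mult_right_zero)
    finally show ?thesis .
  qed
  define \<rho> where "\<rho> t = e t - \<kappa> * exp (of_real t * \<mu>)" for t
  \<comment> \<open>A part bounded for \<open>t \<ge> 1\<close> plus a single exponential mode:
    boundedness amounts to the vanishing of the coefficient of that mode.\<close>
  have z: "z0 * e t + conv k f t = z0 * \<rho> t + r t + \<kappa> * (z0 + \<nu> * L) * exp (of_real t * \<mu>)" for z0 t
    unfolding split \<rho>_def by (simp add: algebra_simps)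
  have \<rho>: "norm (\<rho> t) \<le> \<bar>C\<bar>" if "t \<ge> 1" for t
  proof -
    have "t powr (- \<alpha>) \<le> 1 powr (- \<alpha>)" using that \<alpha> by (intro powr_mono2') auto
    then have "\<bar>C\<bar> * t powr (- \<alpha>) \<le> \<bar>C\<bar> * 1" by (intro mult_left_mono) auto
    moreover have "C * t powr (- \<alpha>) \<le> \<bar>C\<bar> * t powr (- \<alpha>)" by (intro mult_right_mono) auto
    ultimately show ?thesis using e_asymp[OF that] by (simp add: \<rho>_def)
  qed
  have bound1: "norm (z0 * \<rho> t + r t) \<le> norm z0 * \<bar>C\<bar> + N" if "t \<ge> 1" for z0 t
    by (rule norm_triangle_le, rule add_mono) (use \<rho>[OF that] r in \<open>auto simp: norm_mult intro: mult_left_mono\<close>)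
  have loc: "locbdd (?z z0)" for z0
    by (intro locbdd_add locbdd_cmult e conv_locbdd k f)
  have iff: "bdd (?z z0) \<longleftrightarrow> \<kappa> * (z0 + \<nu> * L) = 0" for z0
  proof
    assume 0: "\<kappa> * (z0 + \<nu> * L) = 0"
    have "norm (z0 * e t + conv k f t) \<le> norm z0 * \<bar>C\<bar> + N" if "t \<ge> 1" for t
      using bound1[OF that, of z0] unfolding z 0 by simp
    then show "bdd (?z z0)" by (rule bdd_of_tail[OF loc])
  next
    assume "bdd (?z z0)"
    then obtain B where B: "\<And>t. norm (z0 * e t + conv k f t) \<le> B" by (auto simp: bdd_def)
    define x where "x = norm (\<kappa> * (z0 + \<nu> * L))"
    have up: "x * exp (Re \<mu> * t) \<le> B + (norm z0 * \<bar>C\<bar> + N)" if "t \<ge> 1" for t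
    proof -
      have "\<kappa> * (z0 + \<nu> * L) * exp (of_real t * \<mu>) = (z0 * e t + conv k f t) - (z0 * \<rho> t + r t)"
        unfolding z by simp
      then have "norm (\<kappa> * (z0 + \<nu> * L) * exp (of_real t * \<mu>)) \<le> B + (norm z0 * \<bar>C\<bar> + N)"
        using norm_triangle_ineq4[of "z0 * e t + conv k f t" "z0 * \<rho> t + r t"] B[of t] bound1[OF that, of z0] by simp
      then show ?thesis by (simp add: x_def norm_mult mult.commute)
    qed
    have "x = 0"
    proof (rule ccontr)
      assume "x \<noteq> 0"
      then have "x > 0" by (simp add: x_def)
      \<comment> \<open>So large that already the linear lower bound 1 + y \<le> exp y of the mode
        contradicts \<open>up\<close>.\<close>
      define t where "t = max 1 ((B + (norm z0 * \<bar>C\<bar> + N)) / (x * Re \<mu>))"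
      have "B + (norm z0 * \<bar>C\<bar> + N) \<le> x * (Re \<mu> * t)"
      proof -
        have "(B + (norm z0 * \<bar>C\<bar> + N)) / (x * Re \<mu>) \<le> t" by (simp add: t_def)
        then show ?thesis using \<open>x > 0\<close> \<mu> by (simp add: pos_divide_le_eq mult_ac)
      qed
      also have "\<dots> < x * (1 + Re \<mu> * t)" using \<open>x > 0\<close> by simp
      also have "\<dots> \<le> x * exp (Re \<mu> * t)" using \<open>x > 0\<close> by (intro mult_left_mono exp_ge_add_one_self) auto
      also have "\<dots> \<le> B + (norm z0 * \<bar>C\<bar> + N)" by (rule up) (simp add: t_def)
      finally show False by simp
    qed
    then show "\<kappa> * (z0 + \<nu> * L) = 0" by (simp add: x_def)
  qed
  have "((?z z0) \<longlongrightarrow> 0) at_top"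
    if b: "bdd (?z z0)" and lim: "(f \<longlongrightarrow> 0) at_top" for z0
  proof -
    have 0: "\<kappa> * (z0 + \<nu> * L) = 0" using b iff by simp
    have "(\<rho> \<longlongrightarrow> 0) at_top"
    proof (rule Lim_null_comparison)
      show "\<forall>\<^sub>F t in at_top. norm (\<rho> t) \<le> C * t powr (- \<alpha>)"
        using eventually_ge_at_top[of 1] by eventually_elim (simp add: \<rho>_def e_asymp)
      show "((\<lambda>t. C * t powr (- \<alpha>)) \<longlongrightarrow> 0) at_top"
        by (rule tendsto_mult_right_zero) (use \<alpha> in \<open>intro tendsto_neg_powr filterlim_ident, simp\<close>)
    qed
    moreover have "(r \<longlongrightarrow> 0) at_top" unfolding r_def by (rule tendsto_conv_L1[OF K fm M lim])
    ultimately have "((\<lambda>t. z0 * \<rho> t + r t) \<longlongrightarrow> z0 * 0 + 0) at_top" by (intro tendsto_intros)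
    then show ?thesis unfolding z 0 by simp
  qed
  with iff show ?thesis using that by blast
qed


text \<open>Both kernels carry the same mode, with coefficients \<kappa> and \<kappa> \<nu>. This
  proportionality is what turns the coefficient in a solution into \<kappa> (z0 + \<nu> L);
  stability is encoded as \<kappa> = 0.\<close>

lemma asymptotic_kernels:
  fixes a :: complex
  assumes \<alpha>: "0 < \<alpha>" "\<alpha> < 1" and a: "a \<noteq> 0" and Arg: "\<bar>Arg a\<bar> \<noteq> \<alpha> * pi / 2"
  obtains \<mu> \<kappa> \<nu> C where "Re \<mu> > 0" "\<kappa> = 0 \<longleftrightarrow> \<bar>Arg a\<bar> > \<alpha> * pi / 2"
    "\<And>t. t \<ge> 1 \<Longrightarrow> norm (frac_series \<alpha> (power a) 1 t - \<kappa> * exp (of_real t * \<mu>)) \<le> C * t powr (- \<alpha>)"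
    "\<And>t. t \<ge> 1 \<Longrightarrow> norm (frac_series \<alpha> (power a) \<alpha> t - \<kappa> * \<nu> * exp (of_real t * \<mu>)) \<le> C * t powr (- 1 - \<alpha>)"
proof -
  define u where "u \<longleftrightarrow> \<bar>Arg a\<bar> < \<alpha> * pi / 2"
  \<comment> \<open>In the unstable case the angle pi encloses the pole. Otherwise \<theta> is the
    midpoint between pi/2 and the smaller of pi and the height of the pole, which leaves the pole
    outside.\<close>
  define \<theta> where "\<theta> = (if u then pi else (pi / 2 + min pi (\<bar>Arg a\<bar> / \<alpha>)) / 2)"
  have *: "pi / 2 < \<bar>Arg a\<bar> / \<alpha>" if "\<not> u"
    using that Arg \<alpha> by (simp add: u_def pos_less_divide_eq mult.commute)
  have \<theta>: "pi / 2 < \<theta>" "\<theta> \<le> pi"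
    using * pi_gt_zero by (auto simp: \<theta>_def min_def)
  have "\<theta> < \<bar>Arg a\<bar> / \<alpha>" if "\<not> u" using that *[OF that] pi_gt_zero unfolding \<theta>_def by (simp add: min_def)
  then have 1: "\<alpha> * \<theta> < \<bar>Arg a\<bar>" if "\<not> u" using that \<alpha> by (simp add: pos_less_divide_eq mult.commute)
  have 2: "\<bar>Arg a\<bar> < \<alpha> * \<theta>" if u
  proof -
    have "\<alpha> * pi / 2 < \<alpha> * pi" using mult_pos_pos[OF \<alpha>(1) pi_gt_zero] by linarith
    then show ?thesis using that by (simp add: u_def \<theta>_def)
  qed
  have Arg\<theta>: "\<bar>Arg a\<bar> \<noteq> \<alpha> * \<theta>" "\<bar>Arg a\<bar> < \<alpha> * \<theta> \<longleftrightarrow> u"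
    by (cases u, use 1 2 in linarith, use 1 2 in linarith)+
  define w where "w t = (Ln a + of_real (ln (t powr \<alpha>))) / of_real \<alpha>" for t
  obtain C1 where C1: "\<And>r. r > 0 \<Longrightarrow> norm (ml \<alpha> 1 (a * of_real r) -
      (if \<bar>Arg a\<bar> < \<alpha> * \<theta> then hankel_fun 1 ((Ln a + of_real (ln r)) / of_real \<alpha>) / of_real \<alpha> else 0)) \<le> C1 / r"
    using ml_asymptotic[OF \<alpha> zero_le_one order_refl a \<theta> Arg\<theta>(1)] by blast
  obtain C0 where C0: "\<And>r. r > 0 \<Longrightarrow> norm (ml \<alpha> 0 (a * of_real r) -
      (if \<bar>Arg a\<bar> < \<alpha> * \<theta> then hankel_fun 0 ((Ln a + of_real (ln r)) / of_real \<alpha>) / of_real \<alpha> else 0)) \<le> C0 / r"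
    using ml_asymptotic[OF \<alpha> order_refl zero_le_one a \<theta> Arg\<theta>(1)] by blast
  define \<kappa> where "\<kappa> = (if u then 1 / complex_of_real \<alpha> else 0)"
  \<comment> \<open>The principal power a^(1/\<alpha>). In the stable case \<kappa> = 0 annihilates
    the mode, and 1 is a placeholder with positive real part.\<close>
  define \<mu> where "\<mu> = (if u then exp (Ln a / of_real \<alpha>) else 1)"
  \<comment> \<open>For \<beta> = 0 the residue contributes the mode \<mu> t exp (\<mu> t) /
    \<alpha>. Passing to the resolvent kernel divides it by a t and leaves the factor \<mu> /
    a.\<close>
  define \<nu> where "\<nu> = \<mu> / a"
  define C where "C = max C1 (C0 / norm a)"
  let ?E = "\<lambda>t. exp (complex_of_real t * \<mu>)"
  show ?thesis
  proof (rule that[of \<mu> \<kappa> C \<nu>])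
    show "Re \<mu> > 0"
    proof (cases u)
      case True
      have "\<bar>Arg a / \<alpha>\<bar> < pi / 2" using True \<alpha> by (simp add: u_def abs_divide pos_divide_less_eq mult.commute)
      then have "cos (Arg a / \<alpha>) > 0" by (intro cos_gt_zero_pi) linarith+
      moreover have "Im (Ln a) = Arg a"
        using a by (simp add: Arg_eq_Im_Ln)
      ultimately show ?thesis using True by (simp add: \<mu>_def Re_exp Im_divide_of_real)
    qed (simp add: \<mu>_def)
    show "\<kappa> = 0 \<longleftrightarrow> \<bar>Arg a\<bar> > \<alpha> * pi / 2" using Arg \<alpha> by (auto simp: \<kappa>_def u_def)
    have expw: "exp (w t) = of_real t * \<mu>" if "t > 0" u for t
    proof -
      have "w t = Ln a / of_real \<alpha> + of_real (ln t)"
        using that \<alpha> by (simp add: w_def ln_powr add_divide_distrib)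
      then show ?thesis using that by (simp add: \<mu>_def exp_add exp_of_real mult.commute)
    qed
    fix t :: real assume t: "t \<ge> 1"
    then have t0: "t > 0" and r: "t powr \<alpha> > 0" by auto
    have "(if \<bar>Arg a\<bar> < \<alpha> * \<theta> then hankel_fun 1 (w t) / of_real \<alpha> else 0) = \<kappa> * ?E t"
      unfolding Arg\<theta> using expw[OF t0] by (simp add: \<kappa>_def hankel_fun_def)
    with C1[OF r] have "norm (ml \<alpha> 1 (a * of_real (t powr \<alpha>)) - \<kappa> * ?E t) \<le> C1 / t powr \<alpha>"
      by (simp only: w_def)
    moreover have "frac_series \<alpha> (power a) 1 t = ml \<alpha> 1 (a * of_real (t powr \<alpha>))"
      using frac_series_power_eq_ml[OF \<alpha>(1) zero_le_one t0, of a] t0 by simp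
    moreover have "C1 / t powr \<alpha> \<le> C * t powr (- \<alpha>)"
      unfolding powr_minus divide_inverse C_def by (intro mult_right_mono) auto
    ultimately show "norm (frac_series \<alpha> (power a) 1 t - \<kappa> * ?E t) \<le> C * t powr (- \<alpha>)"
      by (simp only: order_trans)
    define z where "z = a * of_real (t powr \<alpha>)"
    have z: "z \<noteq> 0" using a t0 by (simp add: z_def)
    have "(if \<bar>Arg a\<bar> < \<alpha> * \<theta> then hankel_fun 0 (w t) / of_real \<alpha> else 0) = \<kappa> * (?E t * (of_real t * \<mu>))"
      unfolding Arg\<theta> using expw[OF t0] by (simp add: \<kappa>_def hankel_fun_def exp_add)
    with C0[OF r] have C0': "norm (ml \<alpha> 0 z - \<kappa> * (?E t * (of_real t * \<mu>))) \<le> C0 / t powr \<alpha>"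
      by (simp only: w_def z_def)
    have s: "t powr (\<alpha> - 1) * t = t powr \<alpha>" using t0 by (simp add: powr_diff)
    have "of_real (t powr (\<alpha> - 1)) / z * (\<kappa> * (?E t * (of_real t * \<mu>))) =
        \<kappa> * \<mu> * ?E t * (of_real (t powr (\<alpha> - 1) * t) / z)"
      unfolding of_real_mult divide_inverse by (simp only: mult_ac)
    also have "of_real (t powr (\<alpha> - 1) * t) / z = 1 / a" unfolding s using t0 by (simp add: z_def)
    finally have P: "of_real (t powr (\<alpha> - 1)) / z * (\<kappa> * (?E t * (of_real t * \<mu>))) = \<kappa> * \<nu> * ?E t"
      by (simp add: \<nu>_def)
    have "frac_series \<alpha> (power a) \<alpha> t = of_real (t powr (\<alpha> - 1)) / z * ml \<alpha> 0 z"
      unfolding ml_0_eq[OF \<alpha>(1)] using frac_series_power_eq_ml[OF \<alpha>(1) less_imp_le[OF \<alpha>(1)] t0, of a] z by (simp add: z_def)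
    then have "frac_series \<alpha> (power a) \<alpha> t - \<kappa> * \<nu> * ?E t =
        of_real (t powr (\<alpha> - 1)) / z * (ml \<alpha> 0 z - \<kappa> * (?E t * (of_real t * \<mu>)))"
      unfolding right_diff_distrib P by simp
    then have "norm (frac_series \<alpha> (power a) \<alpha> t - \<kappa> * \<nu> * ?E t) =
        t powr (\<alpha> - 1) / norm z * norm (ml \<alpha> 0 z - \<kappa> * (?E t * (of_real t * \<mu>)))"
      by (simp only: norm_mult norm_divide norm_of_real) simp
    also have "\<dots> \<le> t powr (\<alpha> - 1) / norm z * (C0 / t powr \<alpha>)"
      by (rule mult_left_mono[OF C0']) simp
    also have "\<dots> = C0 / norm a * (t powr (\<alpha> - 1) / (t powr \<alpha> * t powr \<alpha>))"
      by (simp add: z_def norm_mult mult_ac)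
    also have "t powr (\<alpha> - 1) / (t powr \<alpha> * t powr \<alpha>) = t powr (- 1 - \<alpha>)"
      unfolding powr_add[symmetric] powr_diff[symmetric]
      by (rule arg_cong[where f = "(powr) t"]) simp
    also have "C0 / norm a * t powr (- 1 - \<alpha>) \<le> C * t powr (- 1 - \<alpha>)"
      unfolding C_def by (intro mult_right_mono) auto
    finally show "norm (frac_series \<alpha> (power a) \<alpha> t - \<kappa> * \<nu> * ?E t) \<le> C * t powr (- 1 - \<alpha>)" .
  qed
qed

definition scalar_sol :: "real \<Rightarrow> complex \<Rightarrow> complex \<Rightarrow> (real \<Rightarrow> complex) \<Rightarrow> real \<Rightarrow> complex" where
  "scalar_sol \<alpha> a z0 f t = z0 * frac_series \<alpha> (power a) 1 t + conv (frac_series \<alpha> (power a) \<alpha>) f t"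

text \<open>All three are read off from the coefficient \<kappa> (z0 + \<nu> L): it is identically 0
  in the stable case and vanishes only at z0 = - \<nu> L in the unstable one.\<close>

lemma
  fixes a :: complex
  assumes \<alpha>: "0 < \<alpha>" "\<alpha> < 1" and a: "a \<noteq> 0" and Arg: "\<bar>Arg a\<bar> \<noteq> \<alpha> * pi / 2" and f: "locbdd f" "bdd f"
  shows scalar_sol_stable: "\<bar>Arg a\<bar> > \<alpha> * pi / 2 \<Longrightarrow> bdd (scalar_sol \<alpha> a z0 f)"
    and scalar_sol_unstable: "\<bar>Arg a\<bar> < \<alpha> * pi / 2 \<Longrightarrow> \<exists>z1. \<forall>z0. bdd (scalar_sol \<alpha> a z0 f) \<longleftrightarrow> z0 = z1"
    and scalar_sol_tendsto: "bdd (scalar_sol \<alpha> a z0 f) \<Longrightarrow> (f \<longlongrightarrow> 0) at_top \<Longrightarrow> (scalar_sol \<alpha> a z0 f \<longlongrightarrow> 0) at_top"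
proof -
  have c: "norm (a ^ k) \<le> norm a ^ k" for k by (simp add: norm_power)
  have sol: "scalar_sol \<alpha> a z0 f = (\<lambda>t. z0 * frac_series \<alpha> (power a) 1 t + conv (frac_series \<alpha> (power a) \<alpha>) f t)" for z0
    by (rule ext) (rule scalar_sol_def)
  obtain \<mu> \<kappa> \<nu> C where *: "Re \<mu> > 0" "\<kappa> = 0 \<longleftrightarrow> \<bar>Arg a\<bar> > \<alpha> * pi / 2"
    "\<And>t. t \<ge> 1 \<Longrightarrow> norm (frac_series \<alpha> (power a) 1 t - \<kappa> * exp (of_real t * \<mu>)) \<le> C * t powr (- \<alpha>)"
    "\<And>t. t \<ge> 1 \<Longrightarrow> norm (frac_series \<alpha> (power a) \<alpha> t - \<kappa> * \<nu> * exp (of_real t * \<mu>)) \<le> C * t powr (- 1 - \<alpha>)"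
    by (rule asymptotic_kernels[OF \<alpha> a Arg]) (rule that, assumption+)
  obtain L where L0:
    "\<And>z0. bdd (\<lambda>t. z0 * frac_series \<alpha> (power a) 1 t + conv (frac_series \<alpha> (power a) \<alpha>) f t) \<longleftrightarrow> \<kappa> * (z0 + \<nu> * L) = 0"
    "\<And>z0. bdd (\<lambda>t. z0 * frac_series \<alpha> (power a) 1 t + conv (frac_series \<alpha> (power a) \<alpha>) f t) \<Longrightarrow> (f \<longlongrightarrow> 0) at_top \<Longrightarrow>
       ((\<lambda>t. z0 * frac_series \<alpha> (power a) 1 t + conv (frac_series \<alpha> (power a) \<alpha>) f t) \<longlongrightarrow> 0) at_top"
    by (rule scalar_alternative[OF \<alpha>(1) frac_series_locint[OF \<alpha>(1) c \<alpha>(1)] frac_series_1_locbdd[OF \<alpha>(1) c] f *(1,3,4)])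
      (assumption, assumption, rule that, assumption+)
  note L = L0[folded sol]
  show "bdd (scalar_sol \<alpha> a z0 f)" if "\<bar>Arg a\<bar> > \<alpha> * pi / 2"
    using that *(2) unfolding L(1) by simp
  show "\<exists>z1. \<forall>z0. bdd (scalar_sol \<alpha> a z0 f) \<longleftrightarrow> z0 = z1" if "\<bar>Arg a\<bar> < \<alpha> * pi / 2"
    using that *(2) unfolding L(1) by (intro exI[of _ "- (\<nu> * L)"]) (simp add: eq_neg_iff_add_eq_0)
  show "(scalar_sol \<alpha> a z0 f \<longlongrightarrow> 0) at_top" if "bdd (scalar_sol \<alpha> a z0 f)" "(f \<longlongrightarrow> 0) at_top"
    by (rule L(2)[OF that])
qed

section \<open>Triangular systems\<close>

lemma upper_triangular_induct [consumes 1, case_names step]: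
  fixes i n :: nat
  assumes "i < n" and "\<And>i. i < n \<Longrightarrow> (\<And>l. i < l \<Longrightarrow> l < n \<Longrightarrow> P l) \<Longrightarrow> P i"
  shows "P i"
  using assms(1)
proof (induction "n - i" arbitrary: i rule: less_induct)
  case less
  show ?case
  proof (rule assms(2)[OF less.prems])
    fix l assume "i < l" "l < n"
    then show "P l" using less.hyps[of l] by simp
  qed
qed

lemma bdd_zero: "bdd (\<lambda>_. 0)"
  by (auto simp: bdd_def)

lemma bdd_add: assumes "bdd f" "bdd g" shows "bdd (\<lambda>t. f t + g t)"
proof -
  obtain M N where "\<And>t. norm (f t) \<le> M" "\<And>t. norm (g t) \<le> N" using assms by (auto simp: bdd_def)
  then show ?thesis unfolding bdd_def
    by (intro exI[of _ "M + N"] allI norm_triangle_le add_mono) auto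
qed

lemma bdd_cmult: assumes "bdd f" shows "bdd (\<lambda>t. c * f t)"
proof -
  obtain M where "\<And>t. norm (f t) \<le> M" using assms by (auto simp: bdd_def)
  then show ?thesis unfolding bdd_def norm_mult
    by (intro exI[of _ "norm c * M"] allI mult_left_mono) auto
qed

lemma bdd_sum: "(\<And>j. j \<in> A \<Longrightarrow> bdd (f j)) \<Longrightarrow> bdd (\<lambda>t. \<Sum>j\<in>A. f j t)"
  by (induction A rule: infinite_finite_induct) (auto intro: bdd_zero bdd_add)

section \<open>Entries of matrix powers\<close>

lemma pow_mat_Suc_left:
  assumes "(B :: complex mat) \<in> carrier_mat n n"
  shows "B ^\<^sub>m Suc k = B * B ^\<^sub>m k"
proof (induction k)
  case (Suc k)
  have "B ^\<^sub>m Suc (Suc k) = (B * B ^\<^sub>m k) * B" using Suc by simp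
  also have "\<dots> = B * (B ^\<^sub>m k * B)"
    by (rule assoc_mult_mat[of _ n n _ n _ n]) (use assms in auto)
  finally show ?case by simp
qed (use assms in simp)

lemma smult_pow_mat:
  assumes "(B :: complex mat) \<in> carrier_mat n n"
  shows "(x \<cdot>\<^sub>m B) ^\<^sub>m k = x ^ k \<cdot>\<^sub>m (B ^\<^sub>m k)"
proof (induction k)
  case (Suc k)
  have P: "B ^\<^sub>m k \<in> carrier_mat n n" using assms by simp
  have "(x \<cdot>\<^sub>m B) ^\<^sub>m Suc k = (x ^ k \<cdot>\<^sub>m (B ^\<^sub>m k)) * (x \<cdot>\<^sub>m B)" using Suc by simp
  also have "\<dots> = x ^ k \<cdot>\<^sub>m (x \<cdot>\<^sub>m (B ^\<^sub>m k * B))"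
    by (subst mult_smult_assoc_mat[OF P smult_carrier_mat[OF assms]], subst mult_smult_distrib[OF P assms]) (rule refl)
  also have "\<dots> = x ^ Suc k \<cdot>\<^sub>m (B ^\<^sub>m Suc k)" by (rule eq_matI) auto
  finally show ?case .
qed (use assms in \<open>auto intro!: eq_matI\<close>)

lemma mult_mat_entry:
  assumes "(A :: complex mat) \<in> carrier_mat n n" "B \<in> carrier_mat n n" "i < n" "j < n"
  shows "(A * B) $$ (i, j) = (\<Sum>l<n. A $$ (i, l) * B $$ (l, j))"
  using assms by (auto simp: scalar_prod_def atLeast0LessThan)

locale fractional_system =
  fixes \<alpha> :: real and n :: nat and B :: "complex mat"
  assumes \<alpha>: "0 < \<alpha>" "\<alpha> < 1" and B: "B \<in> carrier_mat n n"
begin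

definition coef :: "nat \<Rightarrow> nat \<Rightarrow> nat \<Rightarrow> complex" where
  "coef i j k = (B ^\<^sub>m k) $$ (i, j)"

text \<open>Dominates every row sum of moduli, so each multiplication by \<open>B\<close> from the
  left costs one factor in the bound for the entries. Fractional series ask for such a geometric
  bound.\<close>

definition growth :: real where
  "growth = 1 + (\<Sum>i<n. \<Sum>j<n. norm (B $$ (i, j)))"

lemma coef_0: "i < n \<Longrightarrow> j < n \<Longrightarrow> coef i j 0 = (if i = j then 1 else 0)"
  using B by (simp add: coef_def)

lemma coef_Suc:
  assumes "i < n" "j < n"
  shows "coef i j (Suc k) = (\<Sum>l<n. B $$ (i, l) * coef l j k)"
  unfolding coef_def pow_mat_Suc_left[OF B] by (rule mult_mat_entry) (use B assms in auto)

lemma coef_bound: "i < n \<Longrightarrow> j < n \<Longrightarrow> norm (coef i j k) \<le> growth ^ k"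
proof (induction k arbitrary: i)
  case 0
  then show ?case by (simp add: coef_0)
next
  case (Suc k)
  have g: "0 \<le> growth" unfolding growth_def by (intro add_nonneg_nonneg sum_nonneg) auto
  have "norm (coef i j (Suc k)) \<le> (\<Sum>l<n. norm (B $$ (i, l)) * growth ^ k)"
    unfolding coef_Suc[OF Suc.prems]
    by (rule sum_norm_le) (use Suc in \<open>auto simp: norm_mult intro: mult_left_mono\<close>)
  also have "\<dots> = (\<Sum>l<n. norm (B $$ (i, l))) * growth ^ k" by (simp add: sum_distrib_right)
  also have "\<dots> \<le> growth * growth ^ k"
  proof (rule mult_right_mono)
    have "(\<Sum>l<n. norm (B $$ (i, l))) \<le> (\<Sum>i<n. \<Sum>j<n. norm (B $$ (i, j)))"
      using Suc.prems by (intro member_le_sum[of i "{..<n}" "\<lambda>i. \<Sum>j<n. norm (B $$ (i, j))"]) (auto intro: sum_nonneg)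
    then show "(\<Sum>l<n. norm (B $$ (i, l))) \<le> growth" by (simp add: growth_def)
  qed (use g in simp)
  finally show ?case by simp
qed

text \<open>For \<open>t > 0\<close> this is the entry of t^(\<beta> - 1) times the Mittag-Leffler
  matrix with parameters \<alpha>, \<beta> at t^\<alpha> B, extended by 0 to
  \<open>t \<le> 0\<close>.\<close>

definition ker :: "nat \<Rightarrow> nat \<Rightarrow> real \<Rightarrow> real \<Rightarrow> complex" where
  "ker i j \<beta> = frac_series \<alpha> (coef i j) \<beta>"

lemma ker_locint: "i < n \<Longrightarrow> j < n \<Longrightarrow> 0 < \<beta> \<Longrightarrow> locint (ker i j \<beta>)"
  unfolding ker_def by (rule frac_series_locint[OF \<alpha>(1) coef_bound])

lemma ker_1_locbdd: "i < n \<Longrightarrow> j < n \<Longrightarrow> locbdd (ker i j 1)"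
  unfolding ker_def by (rule frac_series_1_locbdd[OF \<alpha>(1) coef_bound])

lemma conv_rl_ker: "i < n \<Longrightarrow> j < n \<Longrightarrow> 0 < \<beta> \<Longrightarrow> conv (rl \<alpha>) (ker i j \<beta>) = ker i j (\<beta> + \<alpha>)"
  unfolding ker_def by (rule ext) (rule conv_rl_frac_series[OF \<alpha>(1) coef_bound _ \<alpha>(1)])

text \<open>Matrix resolvent equation with \<open>B\<close> on the left: row \<open>i\<close> of
  \<open>B\<close> couples the \<open>i\<close>-th entry to the others, which is the form in which
  triangularity can act.\<close>

lemma ker_shift:
  assumes ij: "i < n" "j < n" and \<beta>: "0 < \<beta>"
  shows "ker i j \<beta> t = (if i = j then rl \<beta> t else 0) + (\<Sum>l<n. B $$ (i, l) * conv (rl \<alpha>) (ker l j \<beta>) t)"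
proof -
  have "ker i j \<beta> t = coef i j 0 * rl \<beta> t + frac_series \<alpha> (\<lambda>k. coef i j (Suc k)) (\<beta> + \<alpha>) t"
    unfolding ker_def by (rule frac_series_shift[OF \<alpha>(1) coef_bound[OF ij] \<beta>])
  also have "(\<lambda>k. coef i j (Suc k)) = (\<lambda>k. \<Sum>l<n. B $$ (i, l) * coef l j k)"
    by (rule ext) (rule coef_Suc[OF ij])
  also have "frac_series \<alpha> (\<lambda>k. \<Sum>l<n. B $$ (i, l) * coef l j k) (\<beta> + \<alpha>) t = (\<Sum>l<n. B $$ (i, l) * frac_series \<alpha> (coef l j) (\<beta> + \<alpha>) t)"
    by (rule frac_series_sum[where M = growth, OF \<alpha>(1)]) (use coef_bound ij \<beta> \<alpha> in auto)
  also have "\<dots> = (\<Sum>l<n. B $$ (i, l) * conv (rl \<alpha>) (ker l j \<beta>) t)"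
    by (rule sum.cong[OF refl]) (use conv_rl_ker ij \<beta> in \<open>simp add: ker_def\<close>)
  finally show ?thesis using coef_0[OF ij] by simp
qed

text \<open>Causal version of the variation of constants formula. At \<open>t = 0\<close> it is 0
  and not the initial value, since the kernels vanish there.\<close>

definition sol :: "(nat \<Rightarrow> real \<Rightarrow> complex) \<Rightarrow> (nat \<Rightarrow> complex) \<Rightarrow> nat \<Rightarrow> real \<Rightarrow> complex" where
  "sol g y0 i t = (\<Sum>j<n. y0 j * ker i j 1 t + conv (ker i j \<alpha>) (g j) t)"

context
  fixes g :: "nat \<Rightarrow> real \<Rightarrow> complex"
  assumes g: "\<And>j. j < n \<Longrightarrow> locbdd (g j)"
begin

lemma conv_ker_locbdd: "i < n \<Longrightarrow> j < n \<Longrightarrow> locbdd (conv (ker i j \<alpha>) (g j))"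
  by (intro conv_locbdd ker_locint \<alpha> g)

lemma sol_locbdd: "i < n \<Longrightarrow> locbdd (sol g y0 i)"
  unfolding sol_def[abs_def]
  by (rule locbdd_sum) (intro locbdd_add locbdd_cmult ker_1_locbdd conv_ker_locbdd, auto)

lemma conv_rl_sol:
  assumes "l < n"
  shows "conv (rl \<alpha>) (sol g y0 l) t =
    (\<Sum>j<n. y0 j * conv (rl \<alpha>) (ker l j 1) t + conv (rl \<alpha>) (conv (ker l j \<alpha>) (g j)) t)"
proof -
  have r: "locint (rl \<alpha>)" by (rule rl_locint[OF \<alpha>(1)])
  have "conv (rl \<alpha>) (sol g y0 l) t = (\<Sum>j<n. conv (rl \<alpha>) (\<lambda>t. y0 j * ker l j 1 t + conv (ker l j \<alpha>) (g j) t) t)"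
    unfolding sol_def[abs_def] using assms
    by (intro conv_sum_right[OF r] locbdd_add locbdd_cmult ker_1_locbdd conv_ker_locbdd) auto
  also have "\<dots> = (\<Sum>j<n. y0 j * conv (rl \<alpha>) (ker l j 1) t + conv (rl \<alpha>) (conv (ker l j \<alpha>) (g j)) t)"
  proof (rule sum.cong[OF refl])
    fix j assume "j \<in> {..<n}"
    then show "conv (rl \<alpha>) (\<lambda>t. y0 j * ker l j 1 t + conv (ker l j \<alpha>) (g j) t) t =
        y0 j * conv (rl \<alpha>) (ker l j 1) t + conv (rl \<alpha>) (conv (ker l j \<alpha>) (g j)) t"
      using conv_add_right[OF r locbdd_cmult[OF ker_1_locbdd[of l j]] conv_ker_locbdd[of l j]] assms
      by (simp add: conv_cmult_right)
  qed
  finally show ?thesis .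
qed

lemma conv_ker_shift:
  assumes ij: "i < n" "j < n"
  shows "conv (ker i j \<alpha>) (g j) t = (if i = j then conv (rl \<alpha>) (g j) t else 0) +
    (\<Sum>l<n. B $$ (i, l) * conv (rl \<alpha>) (conv (ker l j \<alpha>) (g j)) t)"
proof -
  have r: "locint (rl \<alpha>)" by (rule rl_locint[OF \<alpha>(1)])
  have rk: "locint (conv (rl \<alpha>) (ker l j \<alpha>))" if "l < n" for l
    using ker_locint[OF that ij(2), of "\<alpha> + \<alpha>"] conv_rl_ker[OF that ij(2) \<alpha>(1)] \<alpha> by simp
  have "ker i j \<alpha> = (\<lambda>t. (if i = j then 1 else 0) * rl \<alpha> t + (\<Sum>l<n. B $$ (i, l) * conv (rl \<alpha>) (ker l j \<alpha>) t))"
    by (rule ext) (use ker_shift[OF ij \<alpha>(1)] in simp)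
  then have "conv (ker i j \<alpha>) (g j) t =
      conv (\<lambda>t. (if i = j then 1 else 0) * rl \<alpha> t + (\<Sum>l<n. B $$ (i, l) * conv (rl \<alpha>) (ker l j \<alpha>) t)) (g j) t"
    by (rule arg_cong)
  also have "\<dots> = conv (\<lambda>t. (if i = j then 1 else 0) * rl \<alpha> t) (g j) t
      + conv (\<lambda>t. \<Sum>l<n. B $$ (i, l) * conv (rl \<alpha>) (ker l j \<alpha>) t) (g j) t"
    using rk by (intro conv_add_left locint_cmult locint_sum r g ij) auto
  also have "conv (\<lambda>t. (if i = j then 1 else 0) * rl \<alpha> t) (g j) t = (if i = j then conv (rl \<alpha>) (g j) t else 0)"
    unfolding conv_cmult_left by simp
  also have "conv (\<lambda>t. \<Sum>l<n. B $$ (i, l) * conv (rl \<alpha>) (ker l j \<alpha>) t) (g j) t =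
      (\<Sum>l<n. conv (\<lambda>t. B $$ (i, l) * conv (rl \<alpha>) (ker l j \<alpha>) t) (g j) t)"
    using rk by (intro conv_sum_left g ij locint_cmult) auto
  also have "\<dots> = (\<Sum>l<n. B $$ (i, l) * conv (rl \<alpha>) (conv (ker l j \<alpha>) (g j)) t)"
    by (rule sum.cong[OF refl]) (use conv_assoc[OF r ker_locint[OF _ ij(2) \<alpha>(1)] g[OF ij(2)]] in \<open>simp add: conv_cmult_left\<close>)
  finally show ?thesis .
qed

text \<open>The fractionally integrated equation y = y0 + I^\<alpha> (B y + g). In contrast to the
  defining formula, whose kernels come from all powers of \<open>B\<close>, only row
  \<open>i\<close> of \<open>B\<close> itself occurs.\<close>

theorem sol_volterra:
  assumes i: "i < n"
  shows "sol g y0 i t = y0 i * rl 1 t + conv (rl \<alpha>) (\<lambda>t. (\<Sum>l<n. B $$ (i, l) * sol g y0 l t) + g i t) t"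
proof -
  have r: "locint (rl \<alpha>)" by (rule rl_locint[OF \<alpha>(1)])
  have "sol g y0 i t = (\<Sum>j<n. y0 j * ((if i = j then rl 1 t else 0) + (\<Sum>l<n. B $$ (i, l) * conv (rl \<alpha>) (ker l j 1) t))
      + ((if i = j then conv (rl \<alpha>) (g j) t else 0) + (\<Sum>l<n. B $$ (i, l) * conv (rl \<alpha>) (conv (ker l j \<alpha>) (g j)) t)))"
    unfolding sol_def
    by (rule sum.cong[OF refl]) (use ker_shift[OF i] conv_ker_shift[OF i] in simp)
  also have "\<dots> = (\<Sum>j<n. (if i = j then y0 j * rl 1 t else 0)) + (\<Sum>j<n. (if i = j then conv (rl \<alpha>) (g j) t else 0))
      + (\<Sum>j<n. \<Sum>l<n. B $$ (i, l) * (y0 j * conv (rl \<alpha>) (ker l j 1) t + conv (rl \<alpha>) (conv (ker l j \<alpha>) (g j)) t))"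
    unfolding sum.distrib[symmetric]
    by (rule sum.cong[OF refl]) (simp add: distrib_left sum_distrib_left sum.distrib mult_ac)
  also have "(\<Sum>j<n. \<Sum>l<n. B $$ (i, l) * (y0 j * conv (rl \<alpha>) (ker l j 1) t + conv (rl \<alpha>) (conv (ker l j \<alpha>) (g j)) t))
      = (\<Sum>l<n. B $$ (i, l) * conv (rl \<alpha>) (sol g y0 l) t)"
    by (subst sum.swap, rule sum.cong[OF refl]) (simp add: conv_rl_sol sum_distrib_left)
  also have "\<dots> = conv (rl \<alpha>) (\<lambda>t. \<Sum>l<n. B $$ (i, l) * sol g y0 l t) t"
    using conv_sum_right[OF r, of "{..<n}" "\<lambda>l t. B $$ (i, l) * sol g y0 l t"] locbdd_cmult[OF sol_locbdd]
    by (simp add: conv_cmult_right)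
  also have "(\<Sum>j<n. (if i = j then y0 j * rl 1 t else 0)) = y0 i * rl 1 t" using i by simp
  also have "(\<Sum>j<n. (if i = j then conv (rl \<alpha>) (g j) t else 0)) = conv (rl \<alpha>) (g i) t" using i by simp
  also have "y0 i * rl 1 t + conv (rl \<alpha>) (g i) t + conv (rl \<alpha>) (\<lambda>t. \<Sum>l<n. B $$ (i, l) * sol g y0 l t) t =
      y0 i * rl 1 t + conv (rl \<alpha>) (\<lambda>t. (\<Sum>l<n. B $$ (i, l) * sol g y0 l t) + g i t) t"
    using conv_add_right[OF r locbdd_sum[of "{..<n}" "\<lambda>l t. B $$ (i, l) * sol g y0 l t"] g[OF i]] locbdd_cmult[OF sol_locbdd]
    by simp
  finally show ?thesis .
qed

end

end

section \<open>Triangular systems, one component at a time\<close>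

locale triangular_fractional_system = fractional_system +
  assumes triangular: "\<And>i l. l < i \<Longrightarrow> i < n \<Longrightarrow> B $$ (i, l) = 0"
    and diag: "\<And>i. i < n \<Longrightarrow> B $$ (i, i) \<noteq> 0" "\<And>i. i < n \<Longrightarrow> \<bar>Arg (B $$ (i, i))\<bar> \<noteq> \<alpha> * pi / 2"
begin

context
  fixes g :: "nat \<Rightarrow> real \<Rightarrow> complex"
  assumes g: "\<And>j. j < n \<Longrightarrow> locbdd (g j)" "\<And>j. j < n \<Longrightarrow> bdd (g j)"
begin

definition forcing :: "(nat \<Rightarrow> complex) \<Rightarrow> nat \<Rightarrow> real \<Rightarrow> complex" where
  "forcing y0 i t = (\<Sum>l\<in>{i<..<n}. B $$ (i, l) * sol g y0 l t) + g i t"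

lemma forcing_locbdd: "i < n \<Longrightarrow> locbdd (forcing y0 i)"
  unfolding forcing_def[abs_def] by (intro locbdd_add locbdd_sum locbdd_cmult sol_locbdd g) auto

lemma forcing_bdd: "i < n \<Longrightarrow> (\<And>l. i < l \<Longrightarrow> l < n \<Longrightarrow> bdd (sol g y0 l)) \<Longrightarrow> bdd (forcing y0 i)"
  unfolding forcing_def[abs_def] by (intro bdd_add bdd_sum bdd_cmult g) auto

text \<open>By triangularity the Volterra equation of component \<open>i\<close> contains itself
  only through the diagonal entry, and otherwise later components. For a given forcing the scalar
  formula then isolates the influence of \<open>y0 i\<close>.\<close>

lemma sol_triangular:
  assumes i: "i < n"
  shows "sol g y0 i = scalar_sol \<alpha> (B $$ (i, i)) (y0 i) (forcing y0 i)"
proof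
  fix t
  show "sol g y0 i t = scalar_sol \<alpha> (B $$ (i, i)) (y0 i) (forcing y0 i) t"
    unfolding scalar_sol_def
  proof (rule volterra_solution[OF \<alpha>(1)])
    fix t
    have "(\<Sum>l<n. B $$ (i, l) * sol g y0 l t) = (\<Sum>l\<in>{i..<n}. B $$ (i, l) * sol g y0 l t)" for t
      by (rule sum.mono_neutral_right) (use triangular[OF _ i] in auto)
    moreover have "(\<Sum>l\<in>{i..<n}. B $$ (i, l) * sol g y0 l t) = B $$ (i, i) * sol g y0 i t + (\<Sum>l\<in>{i<..<n}. B $$ (i, l) * sol g y0 l t)" for t
    proof -
      have "{i..<n} = insert i {i<..<n}" using i by auto
      then show ?thesis by simp
    qed
    ultimately show "sol g y0 i t = y0 i * rl 1 t + conv (rl \<alpha>) (\<lambda>t. B $$ (i, i) * sol g y0 i t + forcing y0 i t) t"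
      using sol_volterra[of g i y0 t] g i by (simp add: forcing_def add.assoc)
  qed (use i g sol_locbdd forcing_locbdd in auto)
qed

lemma sol_stable_bdd:
  assumes "\<And>i. i < n \<Longrightarrow> \<bar>Arg (B $$ (i, i))\<bar> > \<alpha> * pi / 2" and "i < n"
  shows "bdd (sol g y0 i)"
  using \<open>i < n\<close>
proof (induction rule: upper_triangular_induct)
  case (step i)
  have f: "bdd (forcing y0 i)" by (rule forcing_bdd[OF step(1) step(2)])
  show ?case
    unfolding sol_triangular[OF step(1)]
    by (rule scalar_sol_stable[OF \<alpha> diag(1)[OF step(1)] diag(2)[OF step(1)] forcing_locbdd[OF step(1)] f assms(1)[OF step(1)]])
qed

text \<open>Component \<open>i\<close> depends only on initial values of index at least
  \<open>i\<close>, so a value of smaller index can be adjusted without disturbing it.\<close>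

lemma sol_agree:
  assumes "\<And>l. m \<le> l \<Longrightarrow> l < n \<Longrightarrow> y0 l = y0' l" and "i < n" "m \<le> i"
  shows "sol g y0 i = sol g y0' i"
  using \<open>i < n\<close> \<open>m \<le> i\<close>
proof (induction rule: upper_triangular_induct)
  case (step i)
  have "forcing y0 i = forcing y0' i" unfolding forcing_def[abs_def] using step by (intro ext) simp
  then show ?case unfolding sol_triangular[OF step(1)] using assms(1)[OF step(3,1)] by simp
qed

text \<open>Induction on the number \<open>m\<close> of trailing components already made bounded.
  The next initial value is the single good one for a forcing that the later components have
  fixed.\<close>

lemma sol_unstable_exists:
  assumes unstable: "\<And>i. i < n \<Longrightarrow> \<bar>Arg (B $$ (i, i))\<bar> < \<alpha> * pi / 2"
  shows "\<exists>y0. \<forall>i<n. bdd (sol g y0 i)"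
proof -
  have "\<exists>y0. \<forall>i<n. n - m \<le> i \<longrightarrow> bdd (sol g y0 i)" for m
  proof (induction m)
    case (Suc m)
    then obtain y0 where y0: "\<And>i. i < n \<Longrightarrow> n - m \<le> i \<Longrightarrow> bdd (sol g y0 i)" by blast
    show ?case
    proof (cases "m < n")
      case False
      then show ?thesis using y0 by (intro exI[of _ y0]) auto
    next
      case True
      define i where "i = n - Suc m"
      have i: "i < n" "Suc i = n - m" using True by (auto simp: i_def)
      have f: "bdd (forcing y0 i)" by (rule forcing_bdd[OF i(1)]) (use y0 i in auto)
      obtain z1 where z1: "\<forall>z0. bdd (scalar_sol \<alpha> (B $$ (i, i)) z0 (forcing y0 i)) \<longleftrightarrow> z0 = z1"
        using scalar_sol_unstable[OF \<alpha> diag(1)[OF i(1)] diag(2)[OF i(1)] forcing_locbdd[OF i(1)] f unstable[OF i(1)]] ..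
      define y1 where "y1 = y0(i := z1)"
      have agree: "sol g y1 l = sol g y0 l" if "i < l" "l < n" for l
        by (rule sol_agree[of "Suc i"]) (use that in \<open>auto simp: y1_def\<close>)
      have "forcing y1 i = forcing y0 i" unfolding forcing_def[abs_def] using agree by (intro ext) simp
      then have "bdd (sol g y1 i)"
        unfolding sol_triangular[OF i(1)] using z1 by (simp add: y1_def)
      moreover have "bdd (sol g y1 l)" if "i < l" "l < n" for l
        using agree[OF that] y0[of l] that i by simp
      ultimately have "bdd (sol g y1 l)" if "l < n" "i \<le> l" for l
        using that by (cases "l = i") auto
      then have "\<forall>l<n. n - Suc m \<le> l \<longrightarrow> bdd (sol g y1 l)" by (simp add: i_def)
      then show ?thesis by blast
    qed
  qed auto
  from this[of n] show ?thesis by simp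
qed

text \<open>Once the later initial values agree, so do the forcings, and the scalar equation admits
  only one bounded choice.\<close>

lemma sol_unstable_unique:
  assumes unstable: "\<And>i. i < n \<Longrightarrow> \<bar>Arg (B $$ (i, i))\<bar> < \<alpha> * pi / 2"
    and bdd: "\<And>i. i < n \<Longrightarrow> bdd (sol g y0 i)" "\<And>i. i < n \<Longrightarrow> bdd (sol g y0' i)" and "i < n"
  shows "y0 i = y0' i"
  using \<open>i < n\<close>
proof (induction rule: upper_triangular_induct)
  case (step i)
  have f: "bdd (forcing y0 i)" by (rule forcing_bdd[OF step(1) bdd(1)])
  obtain z1 where z1: "\<forall>z0. bdd (scalar_sol \<alpha> (B $$ (i, i)) z0 (forcing y0 i)) \<longleftrightarrow> z0 = z1"
    using scalar_sol_unstable[OF \<alpha> diag(1)[OF step(1)] diag(2)[OF step(1)] forcing_locbdd[OF step(1)] f unstable[OF step(1)]] ..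
  have "sol g y0 l = sol g y0' l" if "i < l" "l < n" for l
    by (rule sol_agree[of "Suc i"]) (use that step in auto)
  then have "forcing y0' i = forcing y0 i" unfolding forcing_def[abs_def] by (intro ext) simp
  then have "y0' i = z1" using bdd(2)[OF step(1)] z1 unfolding sol_triangular[OF step(1)] by simp
  moreover have "y0 i = z1" using bdd(1)[OF step(1)] z1 unfolding sol_triangular[OF step(1)] by simp
  ultimately show ?case by simp
qed

lemma sol_tendsto_0:
  assumes lim: "\<And>j. j < n \<Longrightarrow> (g j \<longlongrightarrow> 0) at_top" and bdd: "\<And>i. i < n \<Longrightarrow> bdd (sol g y0 i)" and "i < n"
  shows "(sol g y0 i \<longlongrightarrow> 0) at_top"
  using \<open>i < n\<close>
proof (induction rule: upper_triangular_induct)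
  case (step i)
  have "((\<lambda>t. (\<Sum>l\<in>{i<..<n}. B $$ (i, l) * sol g y0 l t) + g i t) \<longlongrightarrow> (\<Sum>l\<in>{i<..<n}. B $$ (i, l) * 0) + 0) at_top"
    by (intro tendsto_intros lim step) auto
  then have f: "(forcing y0 i \<longlongrightarrow> 0) at_top" by (simp add: forcing_def[abs_def])
  have b: "bdd (scalar_sol \<alpha> (B $$ (i, i)) (y0 i) (forcing y0 i))"
    using bdd[OF step(1)] unfolding sol_triangular[OF step(1)] .
  have "bdd (forcing y0 i)" by (rule forcing_bdd[OF step(1) bdd])
  then show ?case
    unfolding sol_triangular[OF step(1)]
    by (rule scalar_sol_tendsto[OF \<alpha> diag(1)[OF step(1)] diag(2)[OF step(1)] forcing_locbdd[OF step(1)] _ b f])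
qed

end

end

section \<open>Vector-valued solutions and their causal components\<close>

definition causal_component :: "(real \<Rightarrow> complex vec) \<Rightarrow> nat \<Rightarrow> real \<Rightarrow> complex" where
  "causal_component g j t = (if 0 \<le> t then g t $ j else 0)"

lemma mittag_leffler_mat_smult_entry:
  assumes B: "B \<in> carrier_mat n n" and "i < n" "j < n"
  shows "mittag_leffler_mat \<alpha> \<beta> (x \<cdot>\<^sub>m B) $$ (i, j) =
    (\<Sum>k. x ^ k * (B ^\<^sub>m k) $$ (i, j) / of_real (Gamma (\<alpha> * real k + \<beta>)))"
proof -
  have "((x \<cdot>\<^sub>m B) ^\<^sub>m k) $$ (i, j) = x ^ k * (B ^\<^sub>m k) $$ (i, j)" for k
    unfolding smult_pow_mat[OF B] using assms by simp
  then show ?thesis using assms by (simp add: mittag_leffler_mat_def)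
qed

lemma mittag_leffler_mat_carrier: "B \<in> carrier_mat n m \<Longrightarrow> mittag_leffler_mat \<alpha> \<beta> (x \<cdot>\<^sub>m B) \<in> carrier_mat n m"
  by (auto simp: mittag_leffler_mat_def)

lemma dim_frac_sol: "dim_vec (frac_sol \<alpha> B g y0 t) = dim_row B"
  by (simp add: frac_sol_def)

lemma mult_mat_vec_entry:
  assumes "A \<in> carrier_mat n m" "dim_vec v = m" "i < n"
  shows "(A *\<^sub>v v) $ i = (\<Sum>j<m. A $$ (i, j) * v $ j)"
  using assms by (auto simp: scalar_prod_def atLeast0LessThan)

context fractional_system
begin

lemma mittag_leffler_mat_ker:
  assumes ij: "i < n" "j < n" and t: "0 < t" and \<beta>: "0 < \<beta>"
  shows "of_real (t powr (\<beta> - 1)) * mittag_leffler_mat \<alpha> \<beta> (of_real (t powr \<alpha>) \<cdot>\<^sub>m B) $$ (i, j) = ker i j \<beta> t"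
proof -
  define x where "x = complex_of_real (t powr \<alpha>)"
  define f where "f k = x ^ k * coef i j k / of_real (Gamma (\<alpha> * real k + \<beta>))" for k
  have f: "of_real (t powr (\<beta> - 1)) * f k = coef i j k * rl (\<alpha> * real k + \<beta>) t" for k
    unfolding rl_scaling[OF t] f_def x_def rGamma_inverse_Gamma by (simp add: field_simps)
  have "summable (\<lambda>k. of_real (t powr (\<beta> - 1)) * f k)"
    unfolding f by (rule summable_norm_cancel[OF summable_frac_series[OF \<alpha>(1) coef_bound[OF ij] \<beta>]])
  then have "summable f" by (rule summable_mult_D) (use t in simp)
  then have "of_real (t powr (\<beta> - 1)) * suminf f = ker i j \<beta> t"
    unfolding ker_def frac_series_def f[symmetric] by (rule suminf_mult[symmetric])
  moreover have "mittag_leffler_mat \<alpha> \<beta> (x \<cdot>\<^sub>m B) $$ (i, j) = suminf f"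
    unfolding mittag_leffler_mat_smult_entry[OF B ij] f_def coef_def ..
  ultimately show ?thesis by (simp add: x_def)
qed

context
  fixes g :: "real \<Rightarrow> complex vec" and y0 :: "complex vec"
  assumes dim_g: "\<And>t. 0 \<le> t \<Longrightarrow> dim_vec (g t) = n"
    and g: "\<And>j. j < n \<Longrightarrow> locbdd (causal_component g j)"
    and dim_y0: "dim_vec y0 = n"
begin

text \<open>Confined to \<open>t > 0\<close> because at 0 the causal version is 0 while the vector
  solution takes its initial value. The Henstock-Kurzweil integral over \<open>{0..t}\<close>
  becomes a Lebesgue integral over the line, as the kernel and the forcing vanish outside.\<close>

lemma frac_sol_eq_sol:
  assumes i: "i < n" and t: "0 < t"
  shows "frac_sol \<alpha> B g y0 t $ i = sol (causal_component g) (($) y0) i t"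
proof -
  let ?M = "\<lambda>\<beta> s. mittag_leffler_mat \<alpha> \<beta> (complex_of_real (s powr \<alpha>) \<cdot>\<^sub>m B)"
  let ?h = "\<lambda>\<tau>. complex_of_real ((t - \<tau>) powr (\<alpha> - 1)) * ((?M \<alpha> (t - \<tau>) *\<^sub>v g \<tau>) $ i)"
  define F where "F \<tau> = (\<Sum>j<n. ker i j \<alpha> (t - \<tau>) * causal_component g j \<tau>)" for \<tau>
  have k0: "ker i j \<alpha> s = 0" if "s \<le> 0" for j s
    using that by (simp add: ker_def frac_series_nonpos)
  have Fint: "integrable lborel F"
    unfolding F_def[abs_def]
    by (intro Bochner_Integration.integrable_sum conv_integrable ker_locint g i \<alpha>) auto
  have LF: "integral\<^sup>L lborel F = (\<Sum>j<n. conv (ker i j \<alpha>) (causal_component g j) t)"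
    unfolding F_def[abs_def] conv_def
    by (intro Bochner_Integration.integral_sum conv_integrable ker_locint g i \<alpha>) auto
  have F_supp: "(\<lambda>\<tau>. if \<tau> \<in> {0..t} then F \<tau> else 0) = F"
    by (rule ext) (auto simp: F_def k0 causal_component_def)
  have "((\<lambda>\<tau>. if \<tau> \<in> {0..t} then F \<tau> else 0) has_integral integral\<^sup>L lborel F) UNIV"
    unfolding F_supp by (rule has_integral_integral_lborel[OF Fint])
  then have FI: "(F has_integral integral\<^sup>L lborel F) {0..t}"
    by (simp only: has_integral_restrict_UNIV)
  have "integral {0..t} ?h = integral {0..t} F"
  proof (rule Henstock_Kurzweil_Integration.integral_cong)
    fix \<tau> assume \<tau>: "\<tau> \<in> {0..t}"
    show "?h \<tau> = F \<tau>"
    \<comment> \<open>At the endpoint the weight \<open>0 powr (\<alpha> - 1)\<close> is 0 by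
      convention, in agreement with the kernel extended by 0.\<close>
    proof (cases "\<tau> = t")
      case True
      then show ?thesis by (simp add: F_def k0)
    next
      case False
      with \<tau> have pos: "0 < t - \<tau>" "0 \<le> \<tau>" by auto
      have "(?M \<alpha> (t - \<tau>) *\<^sub>v g \<tau>) $ i =
          (\<Sum>j<n. ?M \<alpha> (t - \<tau>) $$ (i, j) * g \<tau> $ j)"
        by (rule mult_mat_vec_entry[OF mittag_leffler_mat_carrier[OF B] dim_g[OF pos(2)] i])
      then show ?thesis
        unfolding F_def using pos mittag_leffler_mat_ker[OF i _ pos(1) \<alpha>(1)]
        by (simp add: sum_distrib_left mult.assoc[symmetric] causal_component_def)
    qed
  qed
  also have "\<dots> = (\<Sum>j<n. conv (ker i j \<alpha>) (causal_component g j) t)"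
    using FI LF by (simp add: integral_unique)
  finally have 2: "integral {0..t} ?h =
       (\<Sum>j<n. conv (ker i j \<alpha>) (causal_component g j) t)" .
  have "(?M 1 t *\<^sub>v y0) $ i =
      (\<Sum>j<n. ?M 1 t $$ (i, j) * y0 $ j)"
    by (rule mult_mat_vec_entry[OF mittag_leffler_mat_carrier[OF B] dim_y0 i])
  also have "\<dots> = (\<Sum>j<n. y0 $ j * ker i j 1 t)"
    by (rule sum.cong[OF refl]) (use mittag_leffler_mat_ker[OF i _ t, of _ 1] t in simp)
  finally show ?thesis
    unfolding frac_sol_def using B i 2 by (simp add: sol_def sum.distrib)
qed

lemma bounded_nonneg_frac_sol:
  "bounded_nonneg (frac_sol \<alpha> B g y0) \<longleftrightarrow> (\<forall>i<n. bdd (sol (causal_component g) (($) y0) i))"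
proof
  assume "bounded_nonneg (frac_sol \<alpha> B g y0)"
  then obtain M where M: "\<And>t i. 0 \<le> t \<Longrightarrow> i < n \<Longrightarrow> norm (frac_sol \<alpha> B g y0 t $ i) \<le> M"
    using B by (auto simp: bounded_nonneg_def dim_frac_sol)
  show "\<forall>i<n. bdd (sol (causal_component g) (($) y0) i)"
  proof (intro allI impI)
    fix i assume i: "i < n"
    show "bdd (sol (causal_component g) (($) y0) i)"
    proof (rule bdd_of_tail[where T = 1, OF sol_locbdd[where g = "causal_component g", OF g i]])
      fix t :: real assume "1 \<le> t"
      then show "norm (sol (causal_component g) (($) y0) i t) \<le> M"
        using frac_sol_eq_sol[OF i, of t] M[of t i] i by simp
    qed
  qed
next
  assume bdd: "\<forall>i<n. bdd (sol (causal_component g) (($) y0) i)"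
  have "\<exists>M. \<forall>t\<ge>0. norm (frac_sol \<alpha> B g y0 t $ i) \<le> M" if i: "i < n" for i
  proof -
    obtain M where M: "\<And>t. norm (sol (causal_component g) (($) y0) i t) \<le> M"
      using bdd i by (auto simp: bdd_def)
    \<comment> \<open>The value at 0 enters the bound separately, as the two functions need not
      agree there.\<close>
    have "norm (frac_sol \<alpha> B g y0 t $ i) \<le> max M (norm (frac_sol \<alpha> B g y0 0 $ i))" if "t \<ge> 0" for t
      using frac_sol_eq_sol[OF i, of t] M[of t] that by (cases "t = 0") auto
    then show ?thesis by blast
  qed
  then obtain M where M: "\<And>i t. i < n \<Longrightarrow> 0 \<le> t \<Longrightarrow> norm (frac_sol \<alpha> B g y0 t $ i) \<le> M i" by metis
  have "norm (frac_sol \<alpha> B g y0 t $ i) \<le> (\<Sum>i<n. \<bar>M i\<bar>)" if "i < n" "0 \<le> t" for i t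
  proof -
    have "norm (frac_sol \<alpha> B g y0 t $ i) \<le> \<bar>M i\<bar>" using M[OF that] by linarith
    also have "\<dots> \<le> (\<Sum>i<n. \<bar>M i\<bar>)" using that by (intro member_le_sum) auto
    finally show ?thesis .
  qed
  then show "bounded_nonneg (frac_sol \<alpha> B g y0)"
    unfolding bounded_nonneg_def dim_frac_sol using B by (intro exI[of _ "\<Sum>i<n. \<bar>M i\<bar>"]) auto
qed

lemma frac_sol_tendsto_iff:
  assumes "i < n"
  shows "((\<lambda>t. frac_sol \<alpha> B g y0 t $ i) \<longlongrightarrow> l) at_top \<longleftrightarrow> (sol (causal_component g) (($) y0) i \<longlongrightarrow> l) at_top"
proof (rule filterlim_cong[OF refl refl])
  show "\<forall>\<^sub>F t in at_top. frac_sol \<alpha> B g y0 t $ i = sol (causal_component g) (($) y0) i t"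
    using eventually_gt_at_top[of 0] by eventually_elim (rule frac_sol_eq_sol[OF assms])
qed

end

end

lemma causal_component_locbdd_bdd:
  fixes g :: "real \<Rightarrow> complex vec"
  assumes cont: "continuous_on {0..} (\<lambda>t. g t $ j)" and bound: "bounded_nonneg g"
    and j: "\<And>t. 0 \<le> t \<Longrightarrow> j < dim_vec (g t)"
  shows "locbdd (causal_component g j)" and "bdd (causal_component g j)"
proof -
  obtain M where M: "\<And>t. 0 \<le> t \<Longrightarrow> norm (g t $ j) \<le> M"
    using bound j by (auto simp: bounded_nonneg_def)
  have *: "norm (causal_component g j t) \<le> \<bar>M\<bar>" for t
    using M[of t] by (auto simp: causal_component_def)
  then show "bdd (causal_component g j)" by (auto simp: bdd_def)
  have "(\<lambda>t. indicator {0..} t *\<^sub>R (g t $ j)) \<in> borel_measurable borel"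
    by (rule borel_measurable_continuous_on_indicator[OF _ cont]) simp
  moreover have "(\<lambda>t. indicator {0..} t *\<^sub>R (g t $ j)) = causal_component g j"
    by (auto simp: causal_component_def)
  ultimately have "causal_component g j \<in> borel_measurable borel" by simp
  moreover have "causal_component g j t = 0" if "t < 0" for t using that by (simp add: causal_component_def)
  ultimately show "locbdd (causal_component g j)" unfolding locbdd_def using * by blast
qed

section \<open>Decoupling of block-diagonal systems\<close>

lemma mittag_leffler_mat_four_block:
  assumes A: "A \<in> carrier_mat n n" and D: "D \<in> carrier_mat m m"
  shows "mittag_leffler_mat \<alpha> \<beta> (x \<cdot>\<^sub>m four_block_mat A (0\<^sub>m n m) (0\<^sub>m m n) D) =
    four_block_mat (mittag_leffler_mat \<alpha> \<beta> (x \<cdot>\<^sub>m A)) (0\<^sub>m n m) (0\<^sub>m m n) (mittag_leffler_mat \<alpha> \<beta> (x \<cdot>\<^sub>m D))"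
  (is "mittag_leffler_mat \<alpha> \<beta> (x \<cdot>\<^sub>m ?F) = ?R")
proof (rule eq_matI)
  have F: "?F \<in> carrier_mat (n + m) (n + m)" using A D by (rule four_block_carrier_mat)
  note carr = mittag_leffler_mat_carrier[OF A, of \<alpha> \<beta> x] mittag_leffler_mat_carrier[OF D, of \<alpha> \<beta> x]
  show "dim_row (mittag_leffler_mat \<alpha> \<beta> (x \<cdot>\<^sub>m ?F)) = dim_row ?R" "dim_col (mittag_leffler_mat \<alpha> \<beta> (x \<cdot>\<^sub>m ?F)) = dim_col ?R"
    using carr A D by (simp_all add: mittag_leffler_mat_def)
  fix i j assume "i < dim_row ?R" "j < dim_col ?R"
  then have ij: "i < n + m" "j < n + m" using carr by auto
  have Ak: "A ^\<^sub>m k \<in> carrier_mat n n" "D ^\<^sub>m k \<in> carrier_mat m m" for k using A D by auto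
  have F_pow: "(?F ^\<^sub>m k) $$ (i, j) = (if i < n then if j < n then (A ^\<^sub>m k) $$ (i, j) else 0
      else if j < n then 0 else (D ^\<^sub>m k) $$ (i - n, j - n))" for k
    unfolding pow_four_block_mat[OF A D] using Ak[of k] ij A D by simp
  show "mittag_leffler_mat \<alpha> \<beta> (x \<cdot>\<^sub>m ?F) $$ (i, j) = ?R $$ (i, j)"
    unfolding mittag_leffler_mat_smult_entry[OF F ij] F_pow
    using carr ij mittag_leffler_mat_smult_entry[OF A, of i j] mittag_leffler_mat_smult_entry[OF D, of "i - n" "j - n"]
    by (cases "i < n"; cases "j < n") simp_all
qed

lemma frac_sol_four_block:
  assumes A: "A \<in> carrier_mat n n" and D: "D \<in> carrier_mat m m"
    and ga: "\<And>t. 0 \<le> t \<Longrightarrow> dim_vec (ga t) = n" and gd: "\<And>t. 0 \<le> t \<Longrightarrow> dim_vec (gd t) = m"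
    and a: "dim_vec a = n" and d: "dim_vec d = m"
  shows "frac_sol \<alpha> (four_block_mat A (0\<^sub>m n m) (0\<^sub>m m n) D) (\<lambda>t. ga t @\<^sub>v gd t) (a @\<^sub>v d) t =
    frac_sol \<alpha> A ga a t @\<^sub>v frac_sol \<alpha> D gd d t"
proof -
  let ?F = "four_block_mat A (0\<^sub>m n m) (0\<^sub>m m n) D"
  have split: "mittag_leffler_mat \<alpha> \<beta> (x \<cdot>\<^sub>m ?F) *\<^sub>v (u @\<^sub>v v) =
      mittag_leffler_mat \<alpha> \<beta> (x \<cdot>\<^sub>m A) *\<^sub>v u @\<^sub>v mittag_leffler_mat \<alpha> \<beta> (x \<cdot>\<^sub>m D) *\<^sub>v v"
    if "dim_vec u = n" "dim_vec v = m" for u v x \<beta>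
    unfolding mittag_leffler_mat_four_block[OF A D]
    by (rule mult_mat_vec_split[OF mittag_leffler_mat_carrier[OF A] mittag_leffler_mat_carrier[OF D]])
      (use that in \<open>auto intro: carrier_vecI\<close>)
  have dims: "dim_row (mittag_leffler_mat \<alpha> \<beta> (x \<cdot>\<^sub>m A)) = n" "dim_row (mittag_leffler_mat \<alpha> \<beta> (x \<cdot>\<^sub>m D)) = m" for x \<beta>
    using A D by (simp_all add: mittag_leffler_mat_def)
  show ?thesis
  proof (rule eq_vecI)
    show "dim_vec (frac_sol \<alpha> (?F) (\<lambda>t. ga t @\<^sub>v gd t) (a @\<^sub>v d) t) =
        dim_vec (frac_sol \<alpha> A ga a t @\<^sub>v frac_sol \<alpha> D gd d t)"
      using A D by (simp add: dim_frac_sol)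
    fix i assume "i < dim_vec (frac_sol \<alpha> A ga a t @\<^sub>v frac_sol \<alpha> D gd d t)"
    then have i: "i < n + m" using A D by (simp add: dim_frac_sol)
    let ?k = "\<lambda>M v i. integral {0..t} (\<lambda>\<tau>. complex_of_real ((t - \<tau>) powr (\<alpha> - 1)) *
        ((mittag_leffler_mat \<alpha> \<alpha> (complex_of_real ((t - \<tau>) powr \<alpha>) \<cdot>\<^sub>m M) *\<^sub>v v \<tau>) $ i))"
    have int: "?k ?F (\<lambda>\<tau>. ga \<tau> @\<^sub>v gd \<tau>) i = (if i < n then ?k A ga i else ?k D gd (i - n))"
      unfolding if_distrib[symmetric]
      by (cases "i < n") (auto intro!: Henstock_Kurzweil_Integration.integral_cong simp: split ga gd dims i simp del: index_mult_mat_vec)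
    show "frac_sol \<alpha> (?F) (\<lambda>t. ga t @\<^sub>v gd t) (a @\<^sub>v d) t $ i =
        (frac_sol \<alpha> A ga a t @\<^sub>v frac_sol \<alpha> D gd d t) $ i"
      unfolding frac_sol_def split[OF a d] using i A D int by (simp add: dims del: index_mult_mat_vec)
  qed
qed

lemma bounded_nonneg_append:
  fixes y a b :: "real \<Rightarrow> complex vec"
  assumes "\<And>t. 0 \<le> t \<Longrightarrow> y t = a t @\<^sub>v b t"
  shows "bounded_nonneg y \<longleftrightarrow> bounded_nonneg a \<and> bounded_nonneg b"
proof (intro iffI conjI)
  assume "bounded_nonneg y"
  then obtain M where M: "\<And>t i. 0 \<le> t \<Longrightarrow> i < dim_vec (a t) + dim_vec (b t) \<Longrightarrow> norm ((a t @\<^sub>v b t) $ i) \<le> M"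
    using assms by (auto simp: bounded_nonneg_def)
  show "bounded_nonneg a"
    unfolding bounded_nonneg_def
  proof (intro exI[of _ M] allI impI)
    fix t i assume "(0::real) \<le> t" "i < dim_vec (a t)"
    then show "norm (a t $ i) \<le> M" using M[of t i] by simp
  qed
  show "bounded_nonneg b"
    unfolding bounded_nonneg_def
  proof (intro exI[of _ M] allI impI)
    fix t i assume "(0::real) \<le> t" "i < dim_vec (b t)"
    then show "norm (b t $ i) \<le> M" using M[of t "dim_vec (a t) + i"] by simp
  qed
next
  assume "bounded_nonneg a \<and> bounded_nonneg b"
  then obtain M N where MN: "\<And>t i. 0 \<le> t \<Longrightarrow> i < dim_vec (a t) \<Longrightarrow> norm (a t $ i) \<le> M"
    "\<And>t i. 0 \<le> t \<Longrightarrow> i < dim_vec (b t) \<Longrightarrow> norm (b t $ i) \<le> N"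
    unfolding bounded_nonneg_def by blast
  show "bounded_nonneg y"
    unfolding bounded_nonneg_def
  proof (intro exI[of _ "max M N"] allI impI)
    fix t i assume t: "(0::real) \<le> t" and i: "i < dim_vec (y t)"
    show "norm (y t $ i) \<le> max M N"
      using MN(1)[OF t, of i] MN(2)[OF t, of "i - dim_vec (a t)"] i assms[OF t]
      by (cases "i < dim_vec (a t)") (auto simp: le_max_iff_disj)
  qed
qed

lemma bounded_nonneg_cong: "(\<And>t. 0 \<le> t \<Longrightarrow> y t = z t) \<Longrightarrow> bounded_nonneg y \<longleftrightarrow> bounded_nonneg z"
  by (simp add: bounded_nonneg_def)

section \<open>Jordan matrices as triangular systems\<close>

lemma jordan_matrix_diag_mem:
  "i < dim_row (jordan_matrix nas) \<Longrightarrow> \<exists>n. (n, jordan_matrix nas $$ (i, i) :: complex) \<in> set nas"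
proof (induction nas arbitrary: i)
  case (Cons na nas)
  obtain n a where na: "na = (n, a)" by (cases na)
  show ?case
  proof (cases "i < n")
    case True
    then have "jordan_matrix (na # nas) $$ (i, i) = a"
      using Cons.prems unfolding na jordan_matrix_Cons by (simp add: jordan_block_def)
    then show ?thesis by (auto simp: na)
  next
    case False
    then have "jordan_matrix (na # nas) $$ (i, i) = jordan_matrix nas $$ (i - n, i - n)"
      using Cons.prems unfolding na jordan_matrix_Cons by (simp add: jordan_block_def)
    moreover have "i - n < dim_row (jordan_matrix nas)" using False Cons.prems by (simp add: na)
    ultimately show ?thesis using Cons.IH[of "i - n"] by auto
  qed
qed simp

lemma triangular_fractional_system_jordan:
  fixes nas :: "(nat \<times> complex) list"
  assumes "0 < \<alpha>" "\<alpha> < 1" and spec: "\<And>m a. (m, a) \<in> set nas \<Longrightarrow> a \<noteq> 0 \<and> \<bar>Arg a\<bar> \<noteq> \<alpha> * pi / 2"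
  shows "triangular_fractional_system \<alpha> (dim_row (jordan_matrix nas)) (jordan_matrix nas)"
proof unfold_locales
  fix i assume "i < dim_row (jordan_matrix nas)"
  then obtain m where "(m, jordan_matrix nas $$ (i, i)) \<in> set nas" using jordan_matrix_diag_mem by blast
  from spec[OF this] show "jordan_matrix nas $$ (i, i) \<noteq> 0" "\<bar>Arg (jordan_matrix nas $$ (i, i))\<bar> \<noteq> \<alpha> * pi / 2" by auto
qed (use assms in \<open>auto simp: jordan_matrix_upper_triangular\<close>)

theorem mainTheorem8:
  fixes \<alpha> :: real and nas_s nas_u :: "(nat \<times> complex) list"
    and gs gu :: "real \<Rightarrow> complex vec"
  defines "Bs \<equiv> jordan_matrix nas_s"
    and "Bu \<equiv> jordan_matrix nas_u"
    and "ds \<equiv> dim_row (jordan_matrix nas_s)"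
    and "du \<equiv> dim_row (jordan_matrix nas_u)"
    and "B \<equiv> four_block_mat (jordan_matrix nas_s) (0\<^sub>m (dim_row (jordan_matrix nas_s)) (dim_row (jordan_matrix nas_u)))
                            (0\<^sub>m (dim_row (jordan_matrix nas_u)) (dim_row (jordan_matrix nas_s))) (jordan_matrix nas_u)"
    and "g \<equiv> (\<lambda>t. gs t @\<^sub>v gu t)"
  assumes "0 < \<alpha>" and "\<alpha> < 1"
    and "\<forall>(n, a) \<in> set nas_s. a \<in> Lambda_s \<alpha>"
    and "\<forall>(n, a) \<in> set nas_u. a \<in> Lambda_u \<alpha>"
    and "\<forall>t\<ge>0. dim_vec (gs t) = ds"
    and "\<forall>t\<ge>0. dim_vec (gu t) = du"
    and "\<forall>i<ds. continuous_on {0..} (\<lambda>t. gs t $ i)"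
    and "\<forall>i<du. continuous_on {0..} (\<lambda>t. gu t $ i)"
    and "bounded_nonneg gs" and "bounded_nonneg gu"
  shows "\<exists>\<phi>bar.
     is_caputo_sol \<alpha> Bu gu \<phi>bar \<and> bounded_nonneg \<phi>bar \<and>
     (\<forall>\<psi>. is_caputo_sol \<alpha> Bu gu \<psi> \<and> bounded_nonneg \<psi> \<longrightarrow> (\<forall>t\<ge>0. \<psi> t = \<phi>bar t)) \<and>
     (\<forall>y0s. dim_vec y0s = ds \<longrightarrow> bounded_nonneg (frac_sol \<alpha> Bs gs y0s)) \<and>
     (\<forall>y. (is_caputo_sol \<alpha> B g y \<and> bounded_nonneg y) \<longleftrightarrow>
          (\<exists>y0s. dim_vec y0s = ds \<and> (\<forall>t\<ge>0. y t = frac_sol \<alpha> Bs gs y0s t @\<^sub>v \<phi>bar t))) \<and>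
     ((\<forall>i<ds. ((\<lambda>t. gs t $ i) \<longlongrightarrow> 0) at_top) \<and> (\<forall>i<du. ((\<lambda>t. gu t $ i) \<longlongrightarrow> 0) at_top)
        \<longrightarrow> (\<forall>y. is_caputo_sol \<alpha> B g y \<and> bounded_nonneg y \<longrightarrow>
               (\<forall>i<ds + du. ((\<lambda>t. y t $ i) \<longlongrightarrow> 0) at_top)))"
proof -
  have dimB: "Bs \<in> carrier_mat ds ds" "Bu \<in> carrier_mat du du"
    by (simp_all add: Bs_def Bu_def ds_def du_def)
  have B_eq: "B = four_block_mat Bs (0\<^sub>m ds du) (0\<^sub>m du ds) Bu" by (simp add: B_def Bs_def Bu_def ds_def du_def)
  note \<alpha> = \<open>0 < \<alpha>\<close> \<open>\<alpha> < 1\<close>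
  have spec_s: "a \<noteq> 0 \<and> \<bar>Arg a\<bar> > \<alpha> * pi / 2" if "(m, a) \<in> set nas_s" for m a
    using bspec[OF assms(9) that] by (simp add: Lambda_s_def)
  have spec_u: "a \<noteq> 0 \<and> \<bar>Arg a\<bar> < \<alpha> * pi / 2" if "(m, a) \<in> set nas_u" for m a
    using bspec[OF assms(10) that] by (simp add: Lambda_u_def)
  interpret S: triangular_fractional_system \<alpha> ds Bs
    unfolding Bs_def ds_def by (rule triangular_fractional_system_jordan[OF \<alpha>]) (drule spec_s, simp)
  interpret U: triangular_fractional_system \<alpha> du Bu
    unfolding Bu_def du_def by (rule triangular_fractional_system_jordan[OF \<alpha>]) (drule spec_u, simp)
  have diag_s: "\<alpha> * pi / 2 < \<bar>Arg (Bs $$ (i, i))\<bar>" if "i < ds" for i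
    using jordan_matrix_diag_mem[of i nas_s] that spec_s unfolding Bs_def ds_def by blast
  have diag_u: "\<bar>Arg (Bu $$ (i, i))\<bar> < \<alpha> * pi / 2" if "i < du" for i
    using jordan_matrix_diag_mem[of i nas_u] that spec_u unfolding Bu_def du_def by blast
  have dim_gs: "dim_vec (gs t) = ds" and dim_gu: "dim_vec (gu t) = du" if "0 \<le> t" for t
    using that assms(11,12) by auto
  have gs: "locbdd (causal_component gs j)" "bdd (causal_component gs j)" if "j < ds" for j
  proof -
    have c: "continuous_on {0..} (\<lambda>t. gs t $ j)" using assms(13) that by blast
    have d: "j < dim_vec (gs t)" if "0 \<le> t" for t using dim_gs[OF that] \<open>j < ds\<close> by simp
    show "locbdd (causal_component gs j)" "bdd (causal_component gs j)"
      by (rule causal_component_locbdd_bdd[OF c assms(15) d], assumption)+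
  qed
  have gu: "locbdd (causal_component gu j)" "bdd (causal_component gu j)" if "j < du" for j
  proof -
    have c: "continuous_on {0..} (\<lambda>t. gu t $ j)" using assms(14) that by blast
    have d: "j < dim_vec (gu t)" if "0 \<le> t" for t using dim_gu[OF that] \<open>j < du\<close> by simp
    show "locbdd (causal_component gu j)" "bdd (causal_component gu j)"
      by (rule causal_component_locbdd_bdd[OF c assms(16) d], assumption)+
  qed
  have S_bounded: "bounded_nonneg (frac_sol \<alpha> Bs gs y0) \<longleftrightarrow> (\<forall>i<ds. bdd (S.sol (causal_component gs) (($) y0) i))"
    if "dim_vec y0 = ds" for y0
    by (rule S.bounded_nonneg_frac_sol[OF dim_gs gs(1) that])
  have U_bounded: "bounded_nonneg (frac_sol \<alpha> Bu gu y0) \<longleftrightarrow> (\<forall>i<du. bdd (U.sol (causal_component gu) (($) y0) i))"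
    if "dim_vec y0 = du" for y0
    by (rule U.bounded_nonneg_frac_sol[OF dim_gu gu(1) that])
  obtain u where u: "\<forall>i<du. bdd (U.sol (causal_component gu) u i)"
    using U.sol_unstable_exists[where g = "causal_component gu", OF gu diag_u] by blast
  \<comment> \<open>The bounded choice \<open>u\<close> is a function on all indices;
    \<open>sol_agree\<close> transfers boundedness to the vector of its first \<open>du\<close>
    values.\<close>
  define yu where "yu = vec du u"
  have yu: "dim_vec yu = du" by (simp add: yu_def)
  have yu_bdd: "bdd (U.sol (causal_component gu) (($) yu) i)" if "i < du" for i
    using u that U.sol_agree[where g = "causal_component gu", OF gu, of 0 "($) yu" u i] by (simp add: yu_def)
  define \<phi> where "\<phi> = frac_sol \<alpha> Bu gu yu"
  have \<phi>_sol: "is_caputo_sol \<alpha> Bu gu \<phi>"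
    unfolding is_caputo_sol_def \<phi>_def using yu dimB by auto
  have \<phi>_bounded: "bounded_nonneg \<phi>" unfolding \<phi>_def using U_bounded[OF yu] yu_bdd by simp
  have unique: "y0 = yu" if "dim_vec y0 = du" "bounded_nonneg (frac_sol \<alpha> Bu gu y0)" for y0
  proof (rule eq_vecI)
    fix i assume "i < dim_vec yu"
    then have "i < du" by (simp add: yu)
    then show "y0 $ i = yu $ i"
      using U.sol_unstable_unique[where g = "causal_component gu", OF gu diag_u, of "($) y0" "($) yu"] U_bounded[OF that(1)] that(2) yu_bdd by simp
  qed (simp add: that yu)
  have stable: "bounded_nonneg (frac_sol \<alpha> Bs gs y0)" if "dim_vec y0 = ds" for y0
    unfolding S_bounded[OF that] using S.sol_stable_bdd[where g = "causal_component gs", OF gs diag_s] by blast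
  have split: "frac_sol \<alpha> B g (a @\<^sub>v b) t = frac_sol \<alpha> Bs gs a t @\<^sub>v frac_sol \<alpha> Bu gu b t"
    if "dim_vec a = ds" "dim_vec b = du" for a b t
    unfolding B_eq g_def by (rule frac_sol_four_block[OF dimB dim_gs dim_gu that])
  have dim_B: "dim_col B = ds + du" using dimB by (simp add: B_eq)
  let ?P = "\<lambda>y. \<exists>y0s. dim_vec y0s = ds \<and> (\<forall>t\<ge>0. y t = frac_sol \<alpha> Bs gs y0s t @\<^sub>v \<phi> t)"
  have iff: "is_caputo_sol \<alpha> B g y \<and> bounded_nonneg y \<longleftrightarrow>
      ?P y" for y
  proof
    assume y: "is_caputo_sol \<alpha> B g y \<and> bounded_nonneg y"
    then obtain y0 where y0: "dim_vec y0 = ds + du" "\<And>t. 0 \<le> t \<Longrightarrow> y t = frac_sol \<alpha> B g y0 t"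
      unfolding is_caputo_sol_def dim_B by blast
    \<comment> \<open>The system decouples along this splitting of the initial vector: boundedness
      forces \<open>b = yu\<close>, while \<open>a\<close> stays free.\<close>
    define a b where "a = vec_first y0 ds" and "b = vec_last y0 du"
    have ab: "dim_vec a = ds" "dim_vec b = du" by (simp_all add: a_def b_def)
    have ab_eq: "a @\<^sub>v b = y0"
      unfolding a_def b_def by (rule vec_first_last_append) (rule carrier_vecI[OF y0(1)])
    have y_eq: "y t = frac_sol \<alpha> Bs gs a t @\<^sub>v frac_sol \<alpha> Bu gu b t" if "0 \<le> t" for t
      unfolding y0(2)[OF that] by (subst split[OF ab(1,2), symmetric], subst ab_eq, rule refl)
    then have "bounded_nonneg (frac_sol \<alpha> Bu gu b)"
      using y bounded_nonneg_append[of y "frac_sol \<alpha> Bs gs a" "frac_sol \<alpha> Bu gu b"] by blast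
    then have b: "b = yu" by (rule unique[OF ab(2)])
    have "\<forall>t\<ge>0. y t = frac_sol \<alpha> Bs gs a t @\<^sub>v \<phi> t"
      using y_eq unfolding \<phi>_def b by blast
    with ab(1) show "?P y" by blast
  next
    assume "?P y"
    then obtain a where a: "dim_vec a = ds" "\<And>t. 0 \<le> t \<Longrightarrow> y t = frac_sol \<alpha> Bs gs a t @\<^sub>v \<phi> t" by blast
    have "y t = frac_sol \<alpha> B g (a @\<^sub>v yu) t" if "0 \<le> t" for t
      unfolding a(2)[OF that] \<phi>_def by (rule split[OF a(1) yu, symmetric])
    moreover have "dim_vec (a @\<^sub>v yu) = ds + du" using a(1) yu by simp
    ultimately have "is_caputo_sol \<alpha> B g y" unfolding is_caputo_sol_def dim_B by blast
    moreover have "bounded_nonneg y"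
      using bounded_nonneg_append[of y, OF a(2)] stable[OF a(1)] \<phi>_bounded by blast
    ultimately show "is_caputo_sol \<alpha> B g y \<and> bounded_nonneg y" by blast
  qed
  have limit: "((\<lambda>t. y t $ i) \<longlongrightarrow> 0) at_top"
    if lim: "\<forall>i<ds. ((\<lambda>t. gs t $ i) \<longlongrightarrow> 0) at_top" "\<forall>i<du. ((\<lambda>t. gu t $ i) \<longlongrightarrow> 0) at_top"
      and y: "is_caputo_sol \<alpha> B g y \<and> bounded_nonneg y" and i: "i < ds + du" for y :: "real \<Rightarrow> complex vec" and i
  proof -
    obtain a where a: "dim_vec a = ds" "\<And>t. 0 \<le> t \<Longrightarrow> y t = frac_sol \<alpha> Bs gs a t @\<^sub>v \<phi> t"
      using y unfolding iff by blast
    have causal_lim: "(causal_component h j \<longlongrightarrow> 0) at_top" if "((\<lambda>t. h t $ j) \<longlongrightarrow> 0) at_top" for h :: "real \<Rightarrow> complex vec" and j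
    proof (rule Lim_transform_eventually[OF that])
      show "\<forall>\<^sub>F t in at_top. h t $ j = causal_component h j t"
        using eventually_ge_at_top[of 0] by eventually_elim (simp add: causal_component_def)
    qed
    have s: "((\<lambda>t. frac_sol \<alpha> Bs gs a t $ i) \<longlongrightarrow> 0) at_top" if "i < ds" for i
    proof -
      have iff: "((\<lambda>t. frac_sol \<alpha> Bs gs a t $ i) \<longlongrightarrow> 0) at_top \<longleftrightarrow> (S.sol (causal_component gs) (($) a) i \<longlongrightarrow> 0) at_top"
        by (rule S.frac_sol_tendsto_iff[OF dim_gs gs(1) a(1) that])
      have l: "(causal_component gs j \<longlongrightarrow> 0) at_top" if "j < ds" for j using causal_lim lim(1) that by blast
      have b: "bdd (S.sol (causal_component gs) (($) a) j)" if "j < ds" for j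
        by (rule S.sol_stable_bdd[where g = "causal_component gs", OF gs diag_s that])
      show ?thesis unfolding iff by (rule S.sol_tendsto_0[where g = "causal_component gs", OF gs l b that])
    qed
    have u: "((\<lambda>t. \<phi> t $ i) \<longlongrightarrow> 0) at_top" if "i < du" for i
    proof -
      have iff: "((\<lambda>t. frac_sol \<alpha> Bu gu yu t $ i) \<longlongrightarrow> 0) at_top \<longleftrightarrow> (U.sol (causal_component gu) (($) yu) i \<longlongrightarrow> 0) at_top"
        by (rule U.frac_sol_tendsto_iff[OF dim_gu gu(1) yu that])
      have l: "(causal_component gu j \<longlongrightarrow> 0) at_top" if "j < du" for j using causal_lim lim(2) that by blast
      show ?thesis unfolding \<phi>_def iff by (rule U.sol_tendsto_0[where g = "causal_component gu", OF gu l yu_bdd that])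
    qed
    have dims: "dim_vec (frac_sol \<alpha> Bs gs a t) = ds" "dim_vec (\<phi> t) = du" for t
      using dimB by (simp_all add: dim_frac_sol \<phi>_def)
    have "((\<lambda>t. if i < ds then frac_sol \<alpha> Bs gs a t $ i else \<phi> t $ (i - ds)) \<longlongrightarrow> 0) at_top"
      using s[of i] u[of "i - ds"] i by (cases "i < ds") auto
    then show ?thesis
    proof (rule Lim_transform_eventually)
      show "\<forall>\<^sub>F t in at_top. (if i < ds then frac_sol \<alpha> Bs gs a t $ i else \<phi> t $ (i - ds)) = y t $ i"
        using eventually_ge_at_top[of 0]
        by eventually_elim (use a(2) dims i in simp)
    qed
  qed
  have unique': "\<forall>t\<ge>0. \<psi> t = \<phi> t" if \<psi>: "is_caputo_sol \<alpha> Bu gu \<psi> \<and> bounded_nonneg \<psi>" for \<psi>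
  proof -
    obtain y0 where y0: "dim_vec y0 = du" "\<And>t. 0 \<le> t \<Longrightarrow> \<psi> t = frac_sol \<alpha> Bu gu y0 t"
      using \<psi> dimB by (auto simp: is_caputo_sol_def)
    have "bounded_nonneg (frac_sol \<alpha> Bu gu y0)" using \<psi> bounded_nonneg_cong[of \<psi>, OF y0(2)] by blast
    then have "y0 = yu" by (rule unique[OF y0(1)])
    then show ?thesis using y0(2) by (simp add: \<phi>_def)
  qed
  show ?thesis
    by (rule exI[of _ \<phi>], intro conjI allI impI)
      (use \<phi>_sol \<phi>_bounded unique' stable iff limit in blast)+
qed

end
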